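(* Let $f:[0,1]^2\to\mathbb R_{\ge 0}$ be continuous and let $u:[0,1]^2\to\mathbb R$ be the value function $$u(\bm x)=\sup_{\bm\varphi\in\mathcal A(\bm x)}\int_0^1 f(\varphi_1(t),\varphi_2(t))\sqrt{\varphi_1'(t)\varphi_2'(t)}\,dt .$$ Assume that the set $A$ satisfies the conditions (A1), (A2) and that the approximations $g_h$, $h=1/N$, $N\in\mathbb N$, satisfy the conditions (G1)–(G4) listed in the context. Then the scheme $$u_h(\bm x)=\max_{\bm\alpha\in A}\Bigl[g_h(\bm x,\bm\alpha,u_h)+h f(\bm x)\sqrt{\alpha_1\alpha_2}\Bigr],\qquad \bm x\in[0,1]_h^2\cap(0,1]^2,$$ with boundary values $u_h(\bm x)=0$ whenever $x_1=0$ or $x_2=0$, is convergent: its solution $u_h:[0,1]_h^2\to\mathbb R$ satisfies $$\lim_{h\to0}\ \max_{\bm x\in[0,1]_h^2}|u_h(\bm x)-u(\bm x)|=0 .$$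
   Context: Notation: $\bm x=(x_1,x_2)$, $\bm\alpha=(\alpha_1,\alpha_2)$; $|\cdot|$ is the Euclidean norm. For $h=1/N$, $[0,1]_h^2=\{0,h,2h,\dots,1\}^2$. Admissible paths: $\mathcal A(\bm x)$ is the set of absolutely continuous $\bm\varphi=(\varphi_1,\varphi_2):[0,1]\to\mathbb R^2$ with $\bm\varphi(0)=\bm 0$, $\bm\varphi(1)=\bm x$, and $\varphi_1'(s),\varphi_2'(s)\ge0$ for a.e. $s$. The value function $u$ vanishes where $x_1=0$ or $x_2=0$, and it is the unique viscosity solution of the Hamilton–Jacobi–Bellman equation $\sup_{\bm\alpha\in A}\bigl(-Du(\bm x)\cdot\bm\alpha+f(\bm x)\sqrt{\alpha_1\alpha_2}\bigr)=0$ in $(0,1]^2$ with these boundary values; the scheme is a discretisation of this equation. Conditions on $A$: (A1) $A\subset\mathbb R_{\ge0}^2$, the closed cone generated by $A$, i.e. the closure of $\{\lambda\bm\alpha:\lambda\ge0,\ \bm\alpha\in A\}$, equals $\mathbb R_{\ge0}^2$, and $\inf_{\bm\alpha\in A}|\bm\alpha|>0$. (A2) $A$ is compact. Conditions on $g_h$: for each $h$, $g_h$ assigns a real number $g_h(\bm x,\bm\alpha,\psi)$, meant as an approximation of $\psi(\bm x-h\bm\alpha)$, to each $\bm x\in[0,1]_h^2$, $\bm\alpha\in A$ and each real-valued function $\psi$ on the grid $[0,1]_h^2$ (functions on $[0,1]^2$ are restricted to the grid), such that: (G1) $g_h$ is monotone non-decreasing in its function argument: $\psi\le\xi$ implies $g_h(\bm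 x,\bm\alpha,\psi)\le g_h(\bm x,\bm\alpha,\xi)$. (G2) $g_h$ is localised: there exists $C>0$ such that, for all functions $\psi,\xi:[0,1]^2\to\mathbb R$ that satisfy $\psi=\xi$ on the ball $B_{Ch}(\bm x)$ of radius $Ch$ centred at $\bm x$, we have $g_h(\bm x,\bm\alpha,\psi)=g_h(\bm x,\bm\alpha,\xi)$. (G3) If $\psi\equiv\psi_0$ is constant, then $g_h(\bm x,\bm\alpha,\psi)=\psi_0$. (G4) $g_h$ is a superlinear approximation: for every $\psi\in C^\infty([0,1]^2)$ and all $L>0$ there exists a modulus of continuity $\omega_{\psi,L}$ such that, for every constant $\xi$ with $|\xi|\le L$, $$\left|\frac{g_h(\bm x,\bm\alpha,\psi+\xi)-\psi(\bm x-h\bm\alpha)-\xi}{h}\right|\le\omega_{\psi,L}(h).$$ *)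

theory Defs
  imports "HOL-Analysis.Analysis"
begin

definition unit_square :: "(real \<times> real) set" where
  "unit_square = {0..1} \<times> {0..1}"

definition abs_continuous :: "(real \<Rightarrow> 'a::metric_space) \<Rightarrow> bool" where
  "abs_continuous \<phi> \<longleftrightarrow>
    (\<forall>\<epsilon>>0. \<exists>\<delta>>0. \<forall>(n::nat) a b.
      (\<forall>i<n. 0 \<le> a i \<and> a i \<le> b i \<and> b i \<le> 1) \<longrightarrow>
      (\<forall>i<n. \<forall>j<n. i \<noteq> j \<longrightarrow> {a i<..<b i} \<inter> {a j<..<b j} = {}) \<longrightarrow>
      (\<Sum>i<n. b i - a i) < \<delta> \<longrightarrow>
      (\<Sum>i<n. dist (\<phi> (a i)) (\<phi> (b i))) < \<epsilon>)"

(* Paths are total functions on the real line; only their values on [0,1] matter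
   (derivatives at the two end points concern a null set). *)
definition admissible :: "real \<times> real \<Rightarrow> (real \<Rightarrow> real \<times> real) set" where
  "admissible x = {\<phi>. abs_continuous \<phi> \<and> \<phi> 0 = (0, 0) \<and> \<phi> 1 = x \<and>
     (AE s in lebesgue. s \<in> {0..1} \<longrightarrow>
        (\<exists>d\<ge>0. ((\<lambda>t. fst (\<phi> t)) has_real_derivative d) (at s)) \<and>
        (\<exists>d\<ge>0. ((\<lambda>t. snd (\<phi> t)) has_real_derivative d) (at s)))}"

definition energy :: "(real \<times> real \<Rightarrow> real) \<Rightarrow> (real \<Rightarrow> real \<times> real) \<Rightarrow> real" where
  "energy f \<phi> = (LINT t:{0..1}|lebesgue.
     f (\<phi> t) * sqrt (deriv (\<lambda>s. fst (\<phi> s)) t * deriv (\<lambda>s. snd (\<phi> s)) t))"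

definition value_function :: "(real \<times> real \<Rightarrow> real) \<Rightarrow> real \<times> real \<Rightarrow> real" where
  "value_function f x = (SUP \<phi>\<in>admissible x. energy f \<phi>)"

text \<open>The mesh size is \<open>h = 1/N\<close>; grids, approximations and solutions are indexed by \<open>N\<close>.\<close>

definition grid :: "nat \<Rightarrow> (real \<times> real) set" where
  "grid N = {(real i / real N, real j / real N) | i j. i \<le> N \<and> j \<le> N}"

definition inner_grid :: "nat \<Rightarrow> (real \<times> real) set" where
  "inner_grid N = grid N \<inter> {0<..1} \<times> {0<..1}"

definition cond_A1 :: "(real \<times> real) set \<Rightarrow> bool" where
  "cond_A1 A \<longleftrightarrow> A \<subseteq> {0..} \<times> {0..} \<and> closure (conic hull A) = {0..} \<times> {0..} \<and>
     (INF \<alpha>\<in>A. norm \<alpha>) > 0"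

definition cond_A2 :: "(real \<times> real) set \<Rightarrow> bool" where
  "cond_A2 A \<longleftrightarrow> compact A"

type_synonym approximation =
  "nat \<Rightarrow> real \<times> real \<Rightarrow> real \<times> real \<Rightarrow> (real \<times> real \<Rightarrow> real) \<Rightarrow> real"

(* The function argument of g is total on the plane. Since the comparison below is only on
   the grid, monotonicity (used in both directions) also makes g depend on nothing but the
   grid values of its argument. *)
definition cond_G1 :: "(real \<times> real) set \<Rightarrow> approximation \<Rightarrow> bool" where
  "cond_G1 A g \<longleftrightarrow> (\<forall>N\<ge>1. \<forall>x\<in>grid N. \<forall>\<alpha>\<in>A. \<forall>\<psi> \<xi>.
     (\<forall>y\<in>grid N. \<psi> y \<le> \<xi> y) \<longrightarrow> g N x \<alpha> \<psi> \<le> g N x \<alpha> \<xi>)"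

definition cond_G2 :: "(real \<times> real) set \<Rightarrow> approximation \<Rightarrow> bool" where
  "cond_G2 A g \<longleftrightarrow> (\<exists>C>0. \<forall>N\<ge>1. \<forall>x\<in>grid N. \<forall>\<alpha>\<in>A. \<forall>\<psi> \<xi>.
     (\<forall>y\<in>ball x (C * (1 / real N)) \<inter> unit_square. \<psi> y = \<xi> y) \<longrightarrow> g N x \<alpha> \<psi> = g N x \<alpha> \<xi>)"

definition cond_G3 :: "(real \<times> real) set \<Rightarrow> approximation \<Rightarrow> bool" where
  "cond_G3 A g \<longleftrightarrow> (\<forall>N\<ge>1. \<forall>x\<in>grid N. \<forall>\<alpha>\<in>A. \<forall>c. g N x \<alpha> (\<lambda>_. c) = c)"

primrec C_diff :: "nat \<Rightarrow> (real \<times> real \<Rightarrow> real) \<Rightarrow> bool" where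
  "C_diff 0 \<psi> \<longleftrightarrow> continuous_on UNIV \<psi>"
| "C_diff (Suc k) \<psi> \<longleftrightarrow> (\<exists>\<psi>1 \<psi>2.
     (\<forall>x. (\<psi> has_derivative (\<lambda>v. \<psi>1 x * fst v + \<psi>2 x * snd v)) (at x)) \<and>
     C_diff k \<psi>1 \<and> C_diff k \<psi>2)"

definition C_infinity :: "(real \<times> real \<Rightarrow> real) \<Rightarrow> bool" where
  "C_infinity \<psi> \<longleftrightarrow> (\<forall>k. C_diff k \<psi>)"

definition modulus_of_continuity :: "(real \<Rightarrow> real) \<Rightarrow> bool" where
  "modulus_of_continuity \<omega> \<longleftrightarrow> mono_on {0..} \<omega> \<and> \<omega> 0 = 0 \<and> (\<omega> \<longlongrightarrow> 0) (at_right 0)"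

(* The smooth functions on the closed square are the restrictions of smooth functions on the
   plane, so psi ranges over the latter. The points x are those at which the scheme uses g.
   Together with (G1) the condition forces x - h * alpha to lie in the closed square for all
   of them: psi = fst is nonnegative on the grid, hence g is, so alpha_1 > 1 would leave an
   error of at least alpha_1 - 1 at a point with x_1 = h; likewise for alpha_2. So no value
   of psi outside the square is used. At a grid point with x_1 = 0 (or x_2 = 0) the same
   argument shows that the condition cannot hold for every alpha in A. *)
definition cond_G4 :: "(real \<times> real) set \<Rightarrow> approximation \<Rightarrow> bool" where
  "cond_G4 A g \<longleftrightarrow> (\<forall>\<psi>. C_infinity \<psi> \<longrightarrow> (\<forall>L>0. \<exists>\<omega>. modulus_of_continuity \<omega> \<and>
     (\<forall>N\<ge>1. \<forall>x\<in>inner_grid N. \<forall>\<alpha>\<in>A. \<forall>\<xi>. \<bar>\<xi>\<bar> \<le> L \<longrightarrow>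
        \<bar>(g N x \<alpha> (\<lambda>y. \<psi> y + \<xi>) - \<psi> (x - (1 / real N) *\<^sub>R \<alpha>) - \<xi>) / (1 / real N)\<bar>
          \<le> \<omega> (1 / real N))))"

(* No continuity of g in alpha is assumed, so a maximum over A need not be attained. By (G1)
   and (G3) the supremum is finite for every v, and it is the maximum whenever that exists. *)
definition scheme_solution ::
  "(real \<times> real \<Rightarrow> real) \<Rightarrow> (real \<times> real) set \<Rightarrow> approximation \<Rightarrow> nat \<Rightarrow>
    (real \<times> real \<Rightarrow> real) \<Rightarrow> bool" where
  "scheme_solution f A g N v \<longleftrightarrow>
     (\<forall>x\<in>inner_grid N.
        v x = (SUP \<alpha>\<in>A. g N x \<alpha> v + (1 / real N) * f x * sqrt (fst \<alpha> * snd \<alpha>))) \<and>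
     (\<forall>x\<in>grid N. fst x = 0 \<or> snd x = 0 \<longrightarrow> v x = 0)"

(* "The solution" of the scheme. Solutions are total functions, compared on the grid only.
   As g may be implicit (involve the value at x itself), (G1)-(G4) do not yield uniqueness:
   (G4) controls only bounded shifts, so spurious solutions of size 1/h can coexist. *)
definition unique_scheme_solution ::
  "(real \<times> real \<Rightarrow> real) \<Rightarrow> (real \<times> real) set \<Rightarrow> approximation \<Rightarrow> nat \<Rightarrow>
    (real \<times> real \<Rightarrow> real) \<Rightarrow> bool" where
  "unique_scheme_solution f A g N v \<longleftrightarrow> scheme_solution f A g N v \<and>
     (\<forall>w. scheme_solution f A g N w \<longrightarrow> (\<forall>x\<in>grid N. w x = v x))"

end

theory Submission
  imports Defs
begin

text \<open>By monotonicity and uniqueness the discrete solution lies between any discrete subsolution and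
  any discrete supersolution (Knaster--Tarski), so no viscosity theory is needed: it suffices to
  exhibit smooth strict sub- and supersolutions of the continuous equation close to the value
  function \<open>u\<close>, which are discrete ones for small \<open>h\<close> by consistency.

  For the upper bound, \<open>u (x + v) \<ge> u x + min f * sqrt (v\<^sub>1 v\<^sub>2)\<close>, and this superadditivity survives
  averaging over small squares and polynomial approximation. The same supersolutions bound the
  energy of every admissible path, by integrating their derivative along it.

  The set of subsolutions is not convex, so the lower bound is local instead: \<open>u\<close> is a supremum of
  lower sums along polygonal chains, and a lower bound for \<open>u\<^sub>h\<close> is transported along each segment by
  a polynomial \<open>U(t) - K r\<^sup>2\<close>, where \<open>t\<close> runs along the segment and \<open>r\<close> across it. Outside a thin tube
  it is negative; inside, moving in the direction of the segment shows that it is a subsolution.\<close>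

subsection \<open>Polynomial test functions\<close>

text \<open>The approximations may be implicit, so neither induction over the grid nor a contraction
  is at hand; only the order is. A fixed slack in the continuous inequality survives discretisation
  because it enters the scheme with a factor h, while the consistency error is o(h). The obstacle is
  smoothness: near the axes \<open>u\<close> is in general only Hoelder continuous with exponent
  1/2. For a given direction the supersolution inequality is linear in the gradient, so averaging
  preserves it up to the oscillation of \<open>f\<close>. A subsolution needs just one good
  direction at each point, which may vary and is lost in averages; along a single segment it is
  fixed. Polynomials serve as test functions because they are smooth on the plane, dense, and stable
  under averaging. Discrete solutions and path energies are both compared with the supremum over
  chains, which thereby is identified with \<open>u\<close>. The cost is homogeneous of degree one
  in the velocity, so only the directions of the controls matter, and the parametrisation of a path
  does not.\<close>

lemma real_polynomial_gradient:
  fixes p :: "real \<times> real \<Rightarrow> real"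
  assumes "real_polynomial_function p"
  shows "\<exists>p1 p2. real_polynomial_function p1 \<and> real_polynomial_function p2 \<and>
    (\<forall>x. (p has_derivative (\<lambda>v. p1 x * fst v + p2 x * snd v)) (at x))"
  using assms
proof induction
  case (linear h)
  have "h v = h (1, 0) * fst v + h (0, 1) * snd v" for v
  proof -
    have "h v = h (fst v *\<^sub>R (1, 0) + snd v *\<^sub>R (0, 1))" by simp
    also have "\<dots> = fst v *\<^sub>R h (1, 0) + snd v *\<^sub>R h (0, 1)"
      using linear by (simp only: bounded_linear.linear linear_add linear_scale)
    finally show ?thesis by (simp add: mult.commute)
  qed
  then have "h = (\<lambda>v. h (1, 0) * fst v + h (0, 1) * snd v)" by blast
  moreover have "(h has_derivative h) (at x)" for x
    using linear by (rule bounded_linear_imp_has_derivative)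
  ultimately show ?case
    by (intro exI[of _ "\<lambda>_. h (1, 0)"] exI[of _ "\<lambda>_. h (0, 1)"]) auto
next
  case (const c)
  show ?case by (intro exI[of _ "\<lambda>_. 0"]) auto
next
  case (add f g)
  then obtain f1 f2 g1 g2 where *:
    "real_polynomial_function f1" "real_polynomial_function f2"
    "real_polynomial_function g1" "real_polynomial_function g2"
    "\<And>x. (f has_derivative (\<lambda>v. f1 x * fst v + f2 x * snd v)) (at x)"
    "\<And>x. (g has_derivative (\<lambda>v. g1 x * fst v + g2 x * snd v)) (at x)"
    by blast
  show ?case
    by (intro exI[of _ "\<lambda>x. f1 x + g1 x"] exI[of _ "\<lambda>x. f2 x + g2 x"] conjI allI
        real_polynomial_function.intros(3) * has_derivative_eq_rhs[OF has_derivative_add[OF *(5,6)]])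
      (auto simp: algebra_simps)
next
  case (mult f g)
  then obtain f1 f2 g1 g2 where *:
    "real_polynomial_function f1" "real_polynomial_function f2"
    "real_polynomial_function g1" "real_polynomial_function g2"
    "\<And>x. (f has_derivative (\<lambda>v. f1 x * fst v + f2 x * snd v)) (at x)"
    "\<And>x. (g has_derivative (\<lambda>v. g1 x * fst v + g2 x * snd v)) (at x)"
    by blast
  show ?case
    by (intro exI[of _ "\<lambda>x. f x * g1 x + f1 x * g x"] exI[of _ "\<lambda>x. f x * g2 x + f2 x * g x"]
        conjI allI real_polynomial_function.intros(3,4) mult.hyps *
        has_derivative_eq_rhs[OF has_derivative_mult[OF *(5,6)]])
      (auto simp: algebra_simps)
qed

lemma real_polynomial_continuous:
  fixes p :: "'a::euclidean_space \<Rightarrow> real"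
  shows "real_polynomial_function p \<Longrightarrow> continuous_on S p"
  by (simp add: real_polynomial_function_eq continuous_on_polymonial_function)

lemma real_polynomial_function_C_diff:
  assumes "real_polynomial_function p"
  shows "C_diff k p"
  using assms
proof (induction k arbitrary: p)
  case 0
  then show ?case by (simp add: real_polynomial_continuous)
next
  case (Suc k)
  then show ?case using real_polynomial_gradient[OF Suc.prems] by (simp, blast)
qed

lemma real_polynomial_function_C_infinity:
  "real_polynomial_function p \<Longrightarrow> C_infinity p"
  by (simp add: C_infinity_def real_polynomial_function_C_diff)

lemma compact_unit_square: "compact unit_square"
  unfolding unit_square_def by (intro compact_Times compact_Icc)

lemma norm_unit_square_le: "x \<in> unit_square \<Longrightarrow> norm x \<le> 2"
  using norm_Pair_le[of "fst x" "snd x"] by (auto simp: unit_square_def)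

text \<open>Callers supply the derivative \<open>p'\<close> in whatever form their computation
  yields; uniqueness of derivatives recovers polynomial, hence continuous, coefficients.\<close>

lemma real_polynomial_gradient_continuous:
  fixes p :: "real \<times> real \<Rightarrow> real"
  assumes "real_polynomial_function p" "\<And>x. (p has_derivative p' x) (at x)"
  shows "\<exists>p1 p2. continuous_on UNIV p1 \<and> continuous_on UNIV p2 \<and>
    (\<forall>x v. p' x v = p1 x * fst v + p2 x * snd v)"
proof -
  obtain p1 p2 where p: "real_polynomial_function p1" "real_polynomial_function p2"
    "\<And>x. (p has_derivative (\<lambda>v. p1 x * fst v + p2 x * snd v)) (at x)"
    using real_polynomial_gradient[OF assms(1)] by blast
  have "p' x = (\<lambda>v. p1 x * fst v + p2 x * snd v)" for x
    by (rule has_derivative_unique[OF assms(2) p(3)])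
  then have "\<forall>x v. p' x v = p1 x * fst v + p2 x * snd v" by metis
  then show ?thesis using p(1,2) real_polynomial_continuous by blast
qed

text \<open>The mean value theorem along the segment from \<open>x\<close> to
  \<open>x - h *\<^sub>R \<alpha>\<close> reduces the remainder to the oscillation of the partial
  derivatives, which are uniformly continuous on a ball containing all these segments.\<close>

lemma real_polynomial_uniform_taylor:
  fixes p :: "real \<times> real \<Rightarrow> real"
  assumes p: "real_polynomial_function p" "\<And>x. (p has_derivative p' x) (at x)"
    and A: "bounded A" and \<eta>: "\<eta> > 0"
  shows "\<exists>h0>0. \<forall>h x \<alpha>. 0 < h \<longrightarrow> h \<le> h0 \<longrightarrow> x \<in> unit_square \<longrightarrow> \<alpha> \<in> A \<longrightarrow>
    \<bar>p (x - h *\<^sub>R \<alpha>) - p x + h * p' x \<alpha>\<bar> \<le> \<eta> * h"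
proof -
  obtain p1 p2 where cont: "continuous_on UNIV p1" "continuous_on UNIV p2"
    and p': "\<And>x v. p' x v = p1 x * fst v + p2 x * snd v"
    using real_polynomial_gradient_continuous[OF p] by blast
  obtain R where R: "R > 0" "\<And>\<alpha>. \<alpha> \<in> A \<Longrightarrow> norm \<alpha> \<le> R"
    using A by (auto simp: bounded_pos)
  let ?K = "cball (0::real \<times> real) (2 + R)"
  \<comment> \<open>Each of the two coordinates of a control, at most \<open>R\<close>, contributes
    an error \<open>e * R\<close>.\<close>
  define e where "e = \<eta> / (2 * R)"
  have e: "e > 0" using R \<eta> by (simp add: e_def)
  have uc: "uniformly_continuous_on ?K p1" "uniformly_continuous_on ?K p2"
    using cont by (auto intro!: compact_uniformly_continuous continuous_on_subset[of UNIV])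
  obtain d1 where d1: "d1 > 0" "\<And>x y. x \<in> ?K \<Longrightarrow> y \<in> ?K \<Longrightarrow> dist y x < d1 \<Longrightarrow> dist (p1 y) (p1 x) < e"
    using uc(1) e unfolding uniformly_continuous_on_def by metis
  obtain d2 where d2: "d2 > 0" "\<And>x y. x \<in> ?K \<Longrightarrow> y \<in> ?K \<Longrightarrow> dist y x < d2 \<Longrightarrow> dist (p2 y) (p2 x) < e"
    using uc(2) e unfolding uniformly_continuous_on_def by metis
  \<comment> \<open>The bound 1 keeps the segment in \<open>?K\<close>; the denominator
    \<open>R + 1\<close> instead of \<open>R\<close> makes the displacement strictly smaller than
    \<open>d1\<close> and \<open>d2\<close>.\<close>
  define h0 where "h0 = min 1 (min d1 d2 / (R + 1))"
  have h0: "h0 > 0" using d1 d2 R by (simp add: h0_def)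
  show ?thesis
  proof (intro exI[of _ h0] conjI allI impI h0)
    fix h :: real and x \<alpha> :: "real \<times> real"
    assume h: "0 < h" "h \<le> h0" and x: "x \<in> unit_square" and \<alpha>: "\<alpha> \<in> A"
    have "((\<lambda>s. p (x - s *\<^sub>R \<alpha>)) has_real_derivative - p' (x - s *\<^sub>R \<alpha>) \<alpha>) (at s)" for s
    proof -
      have "((\<lambda>s. x - s *\<^sub>R \<alpha>) has_derivative (\<lambda>s. - s *\<^sub>R \<alpha>)) (at s)"
        by (auto intro!: derivative_eq_intros)
      from has_derivative_compose[OF this p(2)] show ?thesis
        unfolding has_field_derivative_def
        by (rule has_derivative_eq_rhs) (auto simp: p' algebra_simps)
    qed
    then obtain s where s: "0 < s" "s < h"
      "p (x - h *\<^sub>R \<alpha>) - p (x - 0 *\<^sub>R \<alpha>) = (h - 0) * - p' (x - s *\<^sub>R \<alpha>) \<alpha>"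
      using MVT2[of 0 h "\<lambda>s. p (x - s *\<^sub>R \<alpha>)" "\<lambda>s. - p' (x - s *\<^sub>R \<alpha>) \<alpha>"] h by auto
    have n\<alpha>: "norm \<alpha> \<le> R" using R \<alpha> by simp
    have ns: "norm (s *\<^sub>R \<alpha>) \<le> h0 * R"
      using s h n\<alpha> by (simp, intro mult_mono) auto
    have "h0 * R \<le> 1 * R" by (rule mult_right_mono) (use R in \<open>auto simp: h0_def\<close>)
    then have ns1: "norm (s *\<^sub>R \<alpha>) \<le> R" using ns by linarith
    have "h0 * R < h0 * (R + 1)" using h0 by simp
    also have "\<dots> \<le> min d1 d2 / (R + 1) * (R + 1)"
      by (rule mult_right_mono) (use R in \<open>auto simp: h0_def\<close>)
    also have "\<dots> = min d1 d2" using R by simp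
    finally have ns2: "norm (s *\<^sub>R \<alpha>) < min d1 d2" using ns by linarith
    have "norm (x - s *\<^sub>R \<alpha>) \<le> norm x + norm (s *\<^sub>R \<alpha>)" by (rule norm_triangle_ineq4)
    then have K: "x \<in> ?K" "x - s *\<^sub>R \<alpha> \<in> ?K"
      using norm_unit_square_le[OF x] ns1 R by (simp_all add: mem_cball_0)
    have D: "\<bar>p1 (x - s *\<^sub>R \<alpha>) - p1 x\<bar> < e" "\<bar>p2 (x - s *\<^sub>R \<alpha>) - p2 x\<bar> < e"
      using d1(2)[OF K] d2(2)[OF K] ns2 by (auto simp: dist_norm)
    have "p (x - h *\<^sub>R \<alpha>) - p x + h * p' x \<alpha> =
      h * - ((p1 (x - s *\<^sub>R \<alpha>) - p1 x) * fst \<alpha> + (p2 (x - s *\<^sub>R \<alpha>) - p2 x) * snd \<alpha>)"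
      using s(3) by (simp add: p' algebra_simps)
    also have "\<bar>\<dots>\<bar> \<le> h * (e * R + e * R)"
    proof -
      have \<alpha>12: "\<bar>fst \<alpha>\<bar> \<le> R" "\<bar>snd \<alpha>\<bar> \<le> R"
        using n\<alpha> norm_fst_le[of "fst \<alpha>" "snd \<alpha>"] norm_snd_le[of "snd \<alpha>" "fst \<alpha>"]
        unfolding prod.collapse real_norm_def by linarith+
      have "\<bar>(p1 (x - s *\<^sub>R \<alpha>) - p1 x) * fst \<alpha>\<bar> \<le> e * R"
        "\<bar>(p2 (x - s *\<^sub>R \<alpha>) - p2 x) * snd \<alpha>\<bar> \<le> e * R"
        unfolding abs_mult
        by (rule mult_mono[OF less_imp_le[OF D(1)] \<alpha>12(1) less_imp_le[OF e] abs_ge_zero]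
            mult_mono[OF less_imp_le[OF D(2)] \<alpha>12(2) less_imp_le[OF e] abs_ge_zero])+
      then have "\<bar>- ((p1 (x - s *\<^sub>R \<alpha>) - p1 x) * fst \<alpha> +
          (p2 (x - s *\<^sub>R \<alpha>) - p2 x) * snd \<alpha>)\<bar> \<le> e * R + e * R"
        unfolding abs_minus_cancel by (intro order_trans[OF abs_triangle_ineq] add_mono)
      then show ?thesis
        unfolding abs_mult[of h] abs_of_pos[OF h(1)] by (rule mult_left_mono) (use h in simp)
    qed
    also have "\<dots> = \<eta> * h" using R by (simp add: e_def)
    finally show "\<bar>p (x - h *\<^sub>R \<alpha>) - p x + h * p' x \<alpha>\<bar> \<le> \<eta> * h" .
  qed
qed

subsection \<open>The scheme and its comparison principle\<close>

lemma grid_subset_unit_square: "grid N \<subseteq> unit_square"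
  by (auto simp: grid_def unit_square_def divide_simps)

lemma grid_nonneg: "x \<in> grid N \<Longrightarrow> 0 \<le> fst x \<and> 0 \<le> snd x"
  by (auto simp: grid_def)

lemma finite_grid: "finite (grid N)"
proof -
  have "grid N = (\<lambda>(i, j). (real i / real N, real j / real N)) ` ({..N} \<times> {..N})"
    by (auto simp: grid_def)
  then show ?thesis by simp
qed

lemma grid_nonempty: "grid N \<noteq> {}"
  by (auto simp: grid_def)

lemma inner_grid_subset: "inner_grid N \<subseteq> grid N"
  by (auto simp: inner_grid_def)

lemma grid_boundary:
  assumes "x \<in> grid N" "x \<notin> inner_grid N"
  shows "fst x = 0 \<or> snd x = 0"
  using assms grid_subset_unit_square[of N] by (cases x) (force simp: inner_grid_def unit_square_def)

lemma inner_grid_pos: "x \<in> inner_grid N \<Longrightarrow> 0 < fst x \<and> 0 < snd x"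
  by (auto simp: inner_grid_def)

lemma sqrt_mult_le_average:
  fixes a b :: real
  assumes "0 \<le> a" "0 \<le> b"
  shows "sqrt (a * b) \<le> (a + b) / 2"
  using arith_geo_mean_sqrt[OF assms] .

text \<open>The value 0 off \<open>inner_grid\<close> encodes the boundary condition, so that
  solutions are the fixed points, on the grid, of one monotone operator.\<close>

definition scheme_op ::
  "(real \<times> real \<Rightarrow> real) \<Rightarrow> (real \<times> real) set \<Rightarrow> approximation \<Rightarrow> nat \<Rightarrow>
    (real \<times> real \<Rightarrow> real) \<Rightarrow> real \<times> real \<Rightarrow> real" where
  "scheme_op f A g N v x =
     (if x \<in> inner_grid N
      then SUP \<alpha>\<in>A. g N x \<alpha> v + (1 / real N) * f x * sqrt (fst \<alpha> * snd \<alpha>) else 0)"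

lemma scheme_solution_iff:
  "scheme_solution f A g N v \<longleftrightarrow> (\<forall>x\<in>grid N. v x = scheme_op f A g N v x)"
proof -
  have "x \<notin> inner_grid N" if "fst x = 0 \<or> snd x = 0" for x
    using inner_grid_pos[of x N] that by auto
  moreover have "fst x = 0 \<or> snd x = 0" if "x \<in> grid N" "x \<notin> inner_grid N" for x
    using grid_boundary that .
  ultimately show ?thesis
    unfolding scheme_solution_def scheme_op_def
    using inner_grid_subset[of N] by (smt (verit) subsetD)
qed

locale scheme =
  fixes f :: "real \<times> real \<Rightarrow> real" and A :: "(real \<times> real) set" and g :: approximation
  assumes f_cont: "continuous_on unit_square f"
    and f_nonneg: "x \<in> unit_square \<Longrightarrow> 0 \<le> f x"
    and A1: "cond_A1 A" and A2: "cond_A2 A"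
    and G1: "cond_G1 A g" and G3: "cond_G3 A g" and G4: "cond_G4 A g"
begin

lemma A_nonneg: "\<alpha> \<in> A \<Longrightarrow> 0 \<le> fst \<alpha> \<and> 0 \<le> snd \<alpha>"
  using A1 by (auto simp: cond_A1_def)

lemma A_nonempty: "A \<noteq> {}"
proof
  assume "A = {}"
  then have "closure (conic hull A) = {}" by simp
  moreover have "(0, 0) \<in> closure (conic hull A)" using A1 by (auto simp: cond_A1_def)
  ultimately show False by simp
qed

lemma A_bounded: "bounded A"
  using A2 by (simp add: cond_A2_def compact_imp_bounded)

text \<open>The distance of \<open>A\<close> from the origin, in the form that turns slack
  proportional to the coordinate sum into uniform slack.\<close>

lemma A_sum_ge: "\<exists>a0>0. \<forall>\<alpha>\<in>A. a0 \<le> fst \<alpha> + snd \<alpha>"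
proof -
  let ?a = "INF \<alpha>\<in>A. norm \<alpha>"
  have "?a \<le> fst \<alpha> + snd \<alpha>" if "\<alpha> \<in> A" for \<alpha>
  proof -
    have "?a \<le> norm \<alpha>" by (rule cINF_lower) (use that in \<open>auto intro!: bdd_belowI[of _ 0]\<close>)
    also have "\<dots> \<le> fst \<alpha> + snd \<alpha>"
      using norm_Pair_le[of "fst \<alpha>" "snd \<alpha>"] A_nonneg[OF that] by simp
    finally show ?thesis .
  qed
  then show ?thesis using A1 by (auto simp: cond_A1_def)
qed

text \<open>(A1) describes only a closure. Since \<open>A\<close> is compact and stays away from 0,
  the cone it generates is already closed, and every direction of the quadrant is exactly that of
  some control.\<close>

lemma A_cone:
  assumes "0 \<le> d1" "0 \<le> d2" "(d1, d2) \<noteq> (0, 0)"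
  shows "\<exists>c>0. (c * d1, c * d2) \<in> A"
proof -
  obtain R where R: "R > 0" "\<And>\<alpha>. \<alpha> \<in> A \<Longrightarrow> norm \<alpha> \<le> R"
    using A_bounded by (auto simp: bounded_pos)
  obtain a0 where a0: "a0 > 0" "\<And>\<alpha>. \<alpha> \<in> A \<Longrightarrow> a0 \<le> fst \<alpha> + snd \<alpha>"
    using A_sum_ge by blast
  have "(d1, d2) \<in> closure (conic hull A)" using A1 assms by (auto simp: cond_A1_def)
  then obtain z where z: "\<And>n. z n \<in> conic hull A" "z \<longlonglongrightarrow> (d1, d2)"
    by (auto simp: closure_sequential)
  have "\<exists>c \<alpha>. 0 \<le> c \<and> \<alpha> \<in> A \<and> z n = c *\<^sub>R \<alpha>" for n
    using z(1)[of n] by (auto simp: conic_hull_explicit)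
  then obtain c \<alpha> where c: "\<And>n. 0 \<le> c n" "\<And>n. \<alpha> n \<in> A" "\<And>n. z n = c n *\<^sub>R \<alpha> n"
    by metis
  obtain \<beta> r where \<beta>: "\<beta> \<in> A" "strict_mono r" "(\<alpha> \<circ> r) \<longlonglongrightarrow> \<beta>"
    using A2 c(2) unfolding cond_A2_def compact_def by metis
  \<comment> \<open>\<open>S\<close> is linear and positive on \<open>A\<close>; dividing by it
    recovers the scalars \<open>c\<close> from the vectors \<open>z\<close>, which gives their
    convergence along \<open>r\<close>.\<close>
  define S where "S v = fst v + snd v" for v :: "real \<times> real"
  have S\<beta>: "S \<beta> > 0" using a0(1) a0(2)[OF \<beta>(1)] by (simp add: S_def)
  have Sd: "S (d1, d2) > 0" using assms by (auto simp: S_def)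
  have S_lim: "(\<lambda>n. S (z (r n))) \<longlonglongrightarrow> S (d1, d2)" "(\<lambda>n. S (\<alpha> (r n))) \<longlonglongrightarrow> S \<beta>"
    unfolding S_def using LIMSEQ_subseq_LIMSEQ[OF z(2) \<beta>(2)] \<beta>(3)
    by (auto intro!: tendsto_intros simp: o_def dest: tendsto_fst tendsto_snd)
  have ceq: "c (r n) = S (z (r n)) / S (\<alpha> (r n))" for n
  proof -
    have "S (z (r n)) = c (r n) * S (\<alpha> (r n))" by (simp add: c(3) S_def algebra_simps)
    moreover have "S (\<alpha> (r n)) > 0" using a0(2)[OF c(2)[of "r n"]] a0(1) by (simp add: S_def)
    ultimately show ?thesis by (simp add: field_simps)
  qed
  define c0 where "c0 = S (d1, d2) / S \<beta>"
  have "(\<lambda>n. c (r n)) \<longlonglongrightarrow> c0"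
    unfolding ceq c0_def using S_lim S\<beta> by (intro tendsto_divide) auto
  then have "(\<lambda>n. c (r n) *\<^sub>R \<alpha> (r n)) \<longlonglongrightarrow> c0 *\<^sub>R \<beta>"
    using \<beta>(3) by (intro tendsto_scaleR) (auto simp: o_def)
  moreover have "(\<lambda>n. c (r n) *\<^sub>R \<alpha> (r n)) \<longlonglongrightarrow> (d1, d2)"
    using LIMSEQ_subseq_LIMSEQ[OF z(2) \<beta>(2)] by (simp add: o_def c(3)[symmetric])
  ultimately have eq: "(d1, d2) = c0 *\<^sub>R \<beta>" by (metis LIMSEQ_unique)
  have "c0 > 0" using Sd S\<beta> by (simp add: c0_def)
  then have "(1 / c0 * d1, 1 / c0 * d2) = \<beta>" using eq by (cases \<beta>) auto
  then show ?thesis using \<open>c0 > 0\<close> \<beta>(1) by (intro exI[of _ "1 / c0"]) auto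
qed

lemma f_bounded: "\<exists>M>0. \<forall>x\<in>unit_square. f x \<le> M"
proof -
  have "bounded (f ` unit_square)"
    using f_cont compact_unit_square by (intro compact_imp_bounded compact_continuous_image)
  then obtain M where "M > 0" "\<forall>y\<in>f ` unit_square. norm y \<le> M" by (auto simp: bounded_pos)
  then show ?thesis by (intro exI[of _ M]) auto
qed

lemma g_mono:
  assumes "N \<ge> 1" "x \<in> inner_grid N" "\<alpha> \<in> A" "\<And>y. y \<in> grid N \<Longrightarrow> v y \<le> w y"
  shows "g N x \<alpha> v \<le> g N x \<alpha> w"
  using G1 assms inner_grid_subset[of N] unfolding cond_G1_def by (meson subsetD)

lemma g_const:
  assumes "N \<ge> 1" "x \<in> inner_grid N" "\<alpha> \<in> A"
  shows "g N x \<alpha> (\<lambda>_. c) = c"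
  using G3 assms inner_grid_subset[of N] unfolding cond_G3_def by (meson subsetD)

lemma inner_grid_unit_square: "x \<in> inner_grid N \<Longrightarrow> x \<in> unit_square"
  using inner_grid_subset grid_subset_unit_square by blast

text \<open>Without this the supremum in the scheme would be an unspecified value. The comparison
  function is the constant maximum of \<open>v\<close> over the grid, which \<open>g\<close>
  reproduces.\<close>

lemma scheme_term_bdd_above:
  assumes "N \<ge> 1" "x \<in> inner_grid N"
  shows "bdd_above ((\<lambda>\<alpha>. g N x \<alpha> v + (1 / real N) * f x * sqrt (fst \<alpha> * snd \<alpha>)) ` A)"
proof -
  obtain R where R: "R > 0" "\<And>\<alpha>. \<alpha> \<in> A \<Longrightarrow> norm \<alpha> \<le> R"
    using A_bounded by (auto simp: bounded_pos)
  let ?c = "Max (v ` grid N)"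
  have "g N x \<alpha> v + (1 / real N) * f x * sqrt (fst \<alpha> * snd \<alpha>) \<le> ?c + (1 / real N) * f x * R"
    if "\<alpha> \<in> A" for \<alpha>
  proof -
    have "g N x \<alpha> v \<le> g N x \<alpha> (\<lambda>_. ?c)"
      by (rule g_mono) (use assms that finite_grid in auto)
    then have 1: "g N x \<alpha> v \<le> ?c" using g_const assms that by simp
    have "sqrt (fst \<alpha> * snd \<alpha>) \<le> (fst \<alpha> + snd \<alpha>) / 2"
      using A_nonneg[OF that] by (intro sqrt_mult_le_average) auto
    also have "\<dots> \<le> R"
      using R(2)[OF that] norm_fst_le[of "fst \<alpha>" "snd \<alpha>"] norm_snd_le[of "snd \<alpha>" "fst \<alpha>"]
        abs_ge_self[of "fst \<alpha>"] abs_ge_self[of "snd \<alpha>"] R(1)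
      unfolding prod.collapse real_norm_def by argo
    finally have "(1 / real N) * f x * sqrt (fst \<alpha> * snd \<alpha>) \<le> (1 / real N) * f x * R"
      using f_nonneg inner_grid_unit_square assms by (intro mult_left_mono) auto
    with 1 show ?thesis by linarith
  qed
  then show ?thesis by (intro bdd_aboveI2)
qed

lemma scheme_op_upper:
  assumes "N \<ge> 1" "x \<in> inner_grid N" "\<alpha> \<in> A"
  shows "g N x \<alpha> v + (1 / real N) * f x * sqrt (fst \<alpha> * snd \<alpha>) \<le> scheme_op f A g N v x"
  using cSUP_upper[OF assms(3) scheme_term_bdd_above[OF assms(1,2), of v]] assms
  by (simp add: scheme_op_def)

lemma scheme_op_least:
  assumes "x \<in> inner_grid N"
    "\<And>\<alpha>. \<alpha> \<in> A \<Longrightarrow> g N x \<alpha> v + (1 / real N) * f x * sqrt (fst \<alpha> * snd \<alpha>) \<le> c"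
  shows "scheme_op f A g N v x \<le> c"
  using cSUP_least[OF A_nonempty assms(2)] assms by (simp add: scheme_op_def)

lemma scheme_op_mono:
  assumes "N \<ge> 1" "\<And>y. y \<in> grid N \<Longrightarrow> v y \<le> w y"
  shows "scheme_op f A g N v x \<le> scheme_op f A g N w x"
proof (cases "x \<in> inner_grid N")
  case True
  show ?thesis
  proof (rule scheme_op_least[OF True])
    fix \<alpha> assume \<alpha>: "\<alpha> \<in> A"
    have "g N x \<alpha> v \<le> g N x \<alpha> w" by (rule g_mono[OF assms(1) True \<alpha>]) (rule assms(2))
    then show "g N x \<alpha> v + (1 / real N) * f x * sqrt (fst \<alpha> * snd \<alpha>) \<le> scheme_op f A g N w x"
      using scheme_op_upper[OF assms(1) True \<alpha>, of w] by linarith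
  qed
qed (simp add: scheme_op_def)

text \<open>Uniqueness is used only here: by Knaster--Tarski some solution lies between the
  subsolution and the supersolution, and it is \<open>v\<close>.\<close>

lemma solution_between:
  assumes N: "N \<ge> 1" and v: "unique_scheme_solution f A g N v"
    and sub: "\<And>x. x \<in> grid N \<Longrightarrow> w x \<le> scheme_op f A g N w x"
    and super: "\<And>x. x \<in> grid N \<Longrightarrow> scheme_op f A g N S x \<le> S x"
    and le: "\<And>x. x \<in> grid N \<Longrightarrow> w x \<le> S x" and x: "x \<in> grid N"
  shows "w x \<le> v x \<and> v x \<le> S x"
proof -
  let ?T = "scheme_op f A g N"
  define \<W> where "\<W> = {w'. (\<forall>x\<in>grid N. w' x \<le> ?T w' x \<and> w' x \<le> S x)}"
  define V where "V x = (SUP w'\<in>\<W>. w' x)" for x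
  have w: "w \<in> \<W>" using sub le by (simp add: \<W>_def)
  have bdd: "bdd_above ((\<lambda>w'. w' x) ` \<W>)" if "x \<in> grid N" for x
    using that by (auto simp: \<W>_def intro!: bdd_aboveI2[of _ _ "S x"])
  have upper: "w' x \<le> V x" if "w' \<in> \<W>" "x \<in> grid N" for w' x
    unfolding V_def using that bdd by (intro cSUP_upper)
  have V_le: "V x \<le> S x" if "x \<in> grid N" for x
    unfolding V_def using that w by (intro cSUP_least) (auto simp: \<W>_def)
  have V_sub: "V x \<le> ?T V x" if "x \<in> grid N" for x
    unfolding V_def[of x]
  proof (rule cSUP_least)
    show "\<W> \<noteq> {}" using w by blast
    fix w' assume w': "w' \<in> \<W>"
    have "w' x \<le> ?T w' x" using w' that by (simp add: \<W>_def)
    also have "\<dots> \<le> ?T V x" by (rule scheme_op_mono[OF N]) (rule upper[OF w'])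
    finally show "w' x \<le> ?T V x" .
  qed
  \<comment> \<open>Elements of \<open>\<W>\<close> lie below \<open>V\<close> on the grid, so
    membership gives the converse of \<open>V_sub\<close>.\<close>
  have "?T V \<in> \<W>"
    unfolding \<W>_def
  proof (intro CollectI ballI conjI)
    fix x assume x: "x \<in> grid N"
    show "?T V x \<le> ?T (?T V) x" by (rule scheme_op_mono[OF N]) (rule V_sub)
    have "?T V x \<le> ?T S x" by (rule scheme_op_mono[OF N]) (rule V_le)
    also have "\<dots> \<le> S x" by (rule super[OF x])
    finally show "?T V x \<le> S x" .
  qed
  then have "V x = ?T V x" if "x \<in> grid N" for x
    using V_sub[OF that] upper[OF _ that] by (intro antisym)
  then have "scheme_solution f A g N V" by (simp add: scheme_solution_iff)
  then have "V x = v x" using v x by (simp add: unique_scheme_solution_def)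
  then show ?thesis using upper[OF w x] V_le[OF x] by simp
qed

text \<open>Half of \<open>\<eta>\<close> pays for the modulus in (G4), used with shift 0, and half
  for the Taylor remainder.\<close>

lemma consistency:
  assumes p: "real_polynomial_function p" "\<And>x. (p has_derivative p' x) (at x)" and \<eta>: "\<eta> > 0"
  shows "eventually (\<lambda>N. \<forall>x\<in>inner_grid N. \<forall>\<alpha>\<in>A.
    \<bar>g N x \<alpha> p - p x + (1 / real N) * p' x \<alpha>\<bar> \<le> \<eta> * (1 / real N)) sequentially"
proof -
  obtain \<omega> where \<omega>: "modulus_of_continuity \<omega>" and
    "\<forall>N\<ge>1. \<forall>x\<in>inner_grid N. \<forall>\<alpha>\<in>A. \<forall>\<xi>. \<bar>\<xi>\<bar> \<le> 1 \<longrightarrow>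
        \<bar>(g N x \<alpha> (\<lambda>y. p y + \<xi>) - p (x - (1 / real N) *\<^sub>R \<alpha>) - \<xi>) / (1 / real N)\<bar>
          \<le> \<omega> (1 / real N)"
    using G4 real_polynomial_function_C_infinity[OF p(1)] zero_less_one unfolding cond_G4_def by blast
  then have *: "\<bar>(g N x \<alpha> (\<lambda>y. p y + \<xi>) - p (x - (1 / real N) *\<^sub>R \<alpha>) - \<xi>) / (1 / real N)\<bar>
          \<le> \<omega> (1 / real N)" if "N \<ge> 1" "x \<in> inner_grid N" "\<alpha> \<in> A" "\<bar>\<xi>\<bar> \<le> 1" for N x \<alpha> \<xi>
    using that by blast
  have gp: "\<bar>g N x \<alpha> p - p (x - (1 / real N) *\<^sub>R \<alpha>)\<bar> \<le> \<omega> (1 / real N) * (1 / real N)"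
    if "N \<ge> 1" "x \<in> inner_grid N" "\<alpha> \<in> A" for N x \<alpha>
    using *[OF that, of 0] that(1) by (simp add: abs_mult pos_le_divide_eq)
  obtain h0 where h0: "h0 > 0" "\<And>h x \<alpha>. 0 < h \<Longrightarrow> h \<le> h0 \<Longrightarrow> x \<in> unit_square \<Longrightarrow> \<alpha> \<in> A \<Longrightarrow>
    \<bar>p (x - h *\<^sub>R \<alpha>) - p x + h * p' x \<alpha>\<bar> \<le> \<eta> / 2 * h"
    using real_polynomial_uniform_taylor[OF p A_bounded, of "\<eta> / 2"] \<eta> by auto
  have lim: "filterlim (\<lambda>N. 1 / real N) (at_right 0) sequentially"
    unfolding filterlim_at
    using lim_1_over_n[where 'a = real] eventually_gt_at_top[of 0]
    by (auto simp: eventually_mono)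
  have "eventually (\<lambda>h. \<omega> h < \<eta> / 2) (at_right 0)"
    using \<omega> \<eta> unfolding modulus_of_continuity_def by (intro order_tendstoD(2)[of _ 0]) auto
  moreover have "eventually (\<lambda>h. 0 < h \<and> h < h0) (at_right (0::real))"
    using h0(1) by (auto simp: eventually_at_right)
  ultimately have "eventually (\<lambda>N. \<omega> (1 / real N) < \<eta> / 2 \<and> 0 < 1 / real N \<and> 1 / real N < h0) sequentially"
    using filterlim_iff[THEN iffD1, OF lim] by (auto intro: eventually_conj)
  then show ?thesis
  proof eventually_elim
    case (elim N)
    show ?case
    proof (intro ballI)
      fix x \<alpha> assume x: "x \<in> inner_grid N" and \<alpha>: "\<alpha> \<in> A"
      have "N \<ge> 1" using elim by (cases N) auto
      then have "\<bar>g N x \<alpha> p - p (x - (1 / real N) *\<^sub>R \<alpha>)\<bar> \<le> \<omega> (1 / real N) * (1 / real N)"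
        using gp x \<alpha> by blast
      also have "\<dots> \<le> \<eta> / 2 * (1 / real N)" using elim by (intro mult_right_mono) auto
      finally show "\<bar>g N x \<alpha> p - p x + (1 / real N) * p' x \<alpha>\<bar> \<le> \<eta> * (1 / real N)"
        using h0(2)[OF _ _ inner_grid_unit_square[OF x] \<alpha>, of "1 / real N"] elim by linarith
    qed
  qed
qed

text \<open>Multiplied by the mesh size, the slack \<open>\<eta>\<close> equals the consistency
  error allowed for large \<open>N\<close>. At boundary points the operator is 0, whence the sign
  condition on \<open>p\<close>.\<close>

lemma smooth_supersolution:
  assumes p: "real_polynomial_function p" "\<And>x. (p has_derivative p' x) (at x)" and \<eta>: "\<eta> > 0"
    and super: "\<And>x \<alpha>. x \<in> unit_square \<Longrightarrow> \<alpha> \<in> A \<Longrightarrow> f x * sqrt (fst \<alpha> * snd \<alpha>) + \<eta> \<le> p' x \<alpha>"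
    and nonneg: "\<And>x. x \<in> unit_square \<Longrightarrow> 0 \<le> p x"
  shows "eventually (\<lambda>N. \<forall>x\<in>grid N. scheme_op f A g N p x \<le> p x) sequentially"
  using consistency[OF p \<eta>] eventually_ge_at_top[of 1]
proof eventually_elim
  case (elim N)
  show ?case
  proof
    fix x assume x: "x \<in> grid N"
    show "scheme_op f A g N p x \<le> p x"
    proof (cases "x \<in> inner_grid N")
      case True
      show ?thesis
      proof (rule scheme_op_least[OF True])
        fix \<alpha> assume \<alpha>: "\<alpha> \<in> A"
        have "g N x \<alpha> p - p x + (1 / real N) * p' x \<alpha> \<le> \<eta> * (1 / real N)"
          using elim True \<alpha> by force
        moreover have "(1 / real N) * (f x * sqrt (fst \<alpha> * snd \<alpha>) + \<eta>) \<le> (1 / real N) * p' x \<alpha>"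
          using super inner_grid_unit_square True \<alpha> by (intro mult_left_mono) auto
        ultimately show "g N x \<alpha> p + (1 / real N) * f x * sqrt (fst \<alpha> * snd \<alpha>) \<le> p x"
          by (simp add: algebra_simps)
      qed
    next
      case False
      have "x \<in> unit_square" using x grid_subset_unit_square by blast
      then show ?thesis using False nonneg by (simp add: scheme_op_def)
    qed
  qed
qed

text \<open>(G3) and the sign of \<open>f\<close> make zero a subsolution, the lower barrier in
  every upper estimate.\<close>

lemma scheme_op_zero_nonneg:
  assumes "N \<ge> 1"
  shows "0 \<le> scheme_op f A g N (\<lambda>_. 0) x"
proof (cases "x \<in> inner_grid N")
  case True
  obtain \<alpha> where \<alpha>: "\<alpha> \<in> A" using A_nonempty by blast
  have "0 \<le> g N x \<alpha> (\<lambda>_. 0) + (1 / real N) * f x * sqrt (fst \<alpha> * snd \<alpha>)"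
    using g_const[OF assms True \<alpha>] A_nonneg[OF \<alpha>] f_nonneg[OF inner_grid_unit_square[OF True]]
    by simp
  also have "\<dots> \<le> scheme_op f A g N (\<lambda>_. 0) x" by (rule scheme_op_upper[OF assms True \<alpha>])
  finally show ?thesis .
qed (simp add: scheme_op_def)

text \<open>A crude barrier: the fixed point argument needs a supersolution even where only a lower
  bound is wanted. \<open>D\<close> is fixed before \<open>C\<close>, so a constant can be added to
  dominate any given test function.\<close>

lemma affine_supersolution:
  obtains D where "D \<ge> 0" "\<And>C. C \<ge> 0 \<Longrightarrow> eventually (\<lambda>N. \<forall>x\<in>grid N.
     scheme_op f A g N (\<lambda>x. C + D * (fst x + snd x)) x \<le> C + D * (fst x + snd x)) sequentially"
proof -
  obtain M where M: "M > 0" "\<And>x. x \<in> unit_square \<Longrightarrow> f x \<le> M" using f_bounded by blast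
  obtain a0 where a0: "a0 > 0" "\<And>\<alpha>. \<alpha> \<in> A \<Longrightarrow> a0 \<le> fst \<alpha> + snd \<alpha>"
    using A_sum_ge by blast
  \<comment> \<open>\<open>M\<close> covers the running cost, by the arithmetic-geometric mean
    inequality; the extra 1 leaves the slack \<open>a0\<close>.\<close>
  define D where "D = M + 1"
  have D0: "0 \<le> D" using M by (simp add: D_def)
  show ?thesis
  proof (rule that[OF D0])
    fix C :: real assume C: "C \<ge> 0"
    have bl: "bounded_linear (\<lambda>x::real \<times> real. fst x + snd x)"
      by (intro bounded_linear_add bounded_linear_fst bounded_linear_snd)
    show "eventually (\<lambda>N. \<forall>x\<in>grid N. scheme_op f A g N (\<lambda>x. C + D * (fst x + snd x)) x
      \<le> C + D * (fst x + snd x)) sequentially"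
    proof (rule smooth_supersolution[where p' = "\<lambda>x \<alpha>. D * (fst \<alpha> + snd \<alpha>)" and \<eta> = a0])
      show "real_polynomial_function (\<lambda>x::real \<times> real. C + D * (fst x + snd x))"
        by (intro real_polynomial_function.intros(3)[OF real_polynomial_function.intros(2)]
            real_polynomial_function.intros(4)[OF real_polynomial_function.intros(2)]
            real_polynomial_function.intros(1)[OF bl])
      show "((\<lambda>x. C + D * (fst x + snd x)) has_derivative (\<lambda>\<alpha>. D * (fst \<alpha> + snd \<alpha>))) (at x)"
        for x :: "real \<times> real"
        by (auto intro!: derivative_eq_intros)
      fix x \<alpha> :: "real \<times> real" assume x: "x \<in> unit_square" and \<alpha>: "\<alpha> \<in> A"
      have "f x * sqrt (fst \<alpha> * snd \<alpha>) \<le> M * (fst \<alpha> + snd \<alpha>)"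
        using sqrt_mult_le_average[of "fst \<alpha>" "snd \<alpha>"] A_nonneg[OF \<alpha>] M x f_nonneg[OF x]
        by (intro mult_mono) auto
      then show "f x * sqrt (fst \<alpha> * snd \<alpha>) + a0 \<le> D * (fst \<alpha> + snd \<alpha>)"
        using a0(2)[OF \<alpha>] by (simp add: D_def algebra_simps)
    next
      fix x :: "real \<times> real" assume "x \<in> unit_square"
      then show "0 \<le> C + D * (fst x + snd x)"
        using C D0 by (auto simp: unit_square_def)
    qed (use a0 in auto)
  qed
qed

end

section \<open>Barriers for the discrete solutions at small mesh sizes\<close>

locale scheme_limit = scheme +
  fixes uh :: "nat \<Rightarrow> real \<times> real \<Rightarrow> real"
  assumes uh: "N \<ge> 1 \<Longrightarrow> unique_scheme_solution f A g N (uh N)"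
begin

lemma uh_upper_bound:
  assumes p: "real_polynomial_function p" "\<And>x. (p has_derivative p' x) (at x)" and \<eta>: "\<eta> > 0"
    and super: "\<And>x \<alpha>. x \<in> unit_square \<Longrightarrow> \<alpha> \<in> A \<Longrightarrow> f x * sqrt (fst \<alpha> * snd \<alpha>) + \<eta> \<le> p' x \<alpha>"
    and nonneg: "\<And>x. x \<in> unit_square \<Longrightarrow> 0 \<le> p x"
  shows "eventually (\<lambda>N. \<forall>x\<in>grid N. 0 \<le> uh N x \<and> uh N x \<le> p x) sequentially"
proof -
  have "eventually (\<lambda>N. \<forall>x\<in>grid N. scheme_op f A g N p x \<le> p x) sequentially"
    by (rule smooth_supersolution[OF p \<eta> super nonneg])
  then show ?thesis using eventually_ge_at_top[of 1]
  proof eventually_elim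
    case (elim N)
    have "0 \<le> uh N x \<and> uh N x \<le> p x" if "x \<in> grid N" for x
    proof (rule solution_between[OF elim(2) uh[OF elim(2)]])
      show "0 \<le> p x" if "x \<in> grid N" for x
        using nonneg grid_subset_unit_square that by blast
    qed (use elim(1) that scheme_op_zero_nonneg[OF elim(2)] in auto)
    then show ?case by blast
  qed
qed

lemma uh_nonneg: "eventually (\<lambda>N. \<forall>x\<in>grid N. 0 \<le> uh N x) sequentially"
proof -
  obtain D where D: "D \<ge> 0" "\<And>C. C \<ge> 0 \<Longrightarrow> eventually (\<lambda>N. \<forall>x\<in>grid N.
     scheme_op f A g N (\<lambda>x. C + D * (fst x + snd x)) x \<le> C + D * (fst x + snd x)) sequentially"
    by (rule affine_supersolution, rule that)
  show ?thesis
    using D(2)[OF order_refl] eventually_ge_at_top[of 1]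
  proof eventually_elim
    case (elim N)
    have "0 \<le> 0 + D * (fst x + snd x)" if "x \<in> grid N" for x
      using grid_nonneg[OF that] D(1) by simp
    then have "0 \<le> uh N x \<and> uh N x \<le> 0 + D * (fst x + snd x)" if "x \<in> grid N" for x
      by (intro solution_between[OF elim(2) uh[OF elim(2)]])
        (use elim(1) that scheme_op_zero_nonneg[OF elim(2)] in auto)
    then show ?case by blast
  qed
qed

text \<open>The maximum of the discrete solution and \<open>s\<close> is a subsolution: where
  \<open>s\<close> is below the solution this follows from monotonicity, elsewhere from the strict
  inequality for \<open>s\<close>. Comparison forces the maximum below the solution. The estimate is
  thus local: nothing is asked of \<open>s\<close> where the bound already holds.\<close>

lemma uh_lower_bound:
  assumes s: "real_polynomial_function s" "\<And>x. (s has_derivative s' x) (at x)" and \<eta>: "\<eta> > 0"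
    and sub: "eventually (\<lambda>N. \<forall>z\<in>grid N. s z \<le> uh N z \<or>
      z \<in> inner_grid N \<and> (\<exists>\<alpha>\<in>A. s' z \<alpha> + \<eta> \<le> f z * sqrt (fst \<alpha> * snd \<alpha>))) sequentially"
  shows "eventually (\<lambda>N. \<forall>z\<in>grid N. s z \<le> uh N z) sequentially"
proof -
  obtain D where D: "D \<ge> 0" "\<And>C. C \<ge> 0 \<Longrightarrow> eventually (\<lambda>N. \<forall>x\<in>grid N.
     scheme_op f A g N (\<lambda>x. C + D * (fst x + snd x)) x \<le> C + D * (fst x + snd x)) sequentially"
    by (rule affine_supersolution, rule that)
  have "bounded (s ` unit_square)"
    using real_polynomial_continuous[OF s(1)] compact_unit_square
    by (intro compact_imp_bounded compact_continuous_image)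
  then obtain C where C: "C > 0" "\<forall>y\<in>s ` unit_square. norm y \<le> C" by (auto simp: bounded_pos)
  then have sC: "s x \<le> C" if "x \<in> unit_square" for x using that by force
  have C0: "C \<ge> 0" using C by simp
  have D0: "0 \<le> D * (fst x + snd x)" if "x \<in> grid N" for x N
    using grid_nonneg[OF that] D(1) by simp
  show ?thesis
    using sub D(2)[OF order_refl] D(2)[OF C0] consistency[OF s \<eta>] eventually_ge_at_top[of 1]
  proof eventually_elim
    case (elim N)
    let ?T = "scheme_op f A g N"
    define w where "w z = max (uh N z) (s z)" for z
    \<comment> \<open>The barrier must lie above the maximum \<open>w\<close>, not only above
      \<open>s\<close>, so the discrete solution is bounded first.\<close>
    have uh_le: "uh N x \<le> 0 + D * (fst x + snd x)" if "x \<in> grid N" for x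
    proof -
      have "0 \<le> uh N x \<and> uh N x \<le> 0 + D * (fst x + snd x)"
        by (rule solution_between[OF elim(5) uh[OF elim(5)]])
          (use elim(2) that D0 scheme_op_zero_nonneg[OF elim(5)] in auto)
      then show ?thesis by blast
    qed
    have fix_uh: "uh N x = ?T (uh N) x" if "x \<in> grid N" for x
      using uh[OF elim(5)] that unfolding unique_scheme_solution_def scheme_solution_iff by blast
    have "w x \<le> ?T w x" if x: "x \<in> grid N" for x
    proof (cases "s x \<le> uh N x")
      case True
      then have "w x = ?T (uh N) x" using fix_uh[OF x] by (simp add: w_def)
      also have "\<dots> \<le> ?T w x" by (rule scheme_op_mono[OF elim(5)]) (simp add: w_def)
      finally show ?thesis .
    next
      case False
      then obtain \<alpha> where xi: "x \<in> inner_grid N" and \<alpha>: "\<alpha> \<in> A"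
        "s' x \<alpha> + \<eta> \<le> f x * sqrt (fst \<alpha> * snd \<alpha>)"
        using elim(1) x by blast
      have "(1 / real N) * (s' x \<alpha> + \<eta>) \<le> (1 / real N) * (f x * sqrt (fst \<alpha> * snd \<alpha>))"
        using \<alpha> by (intro mult_left_mono) auto
      moreover have "\<bar>g N x \<alpha> s - s x + (1 / real N) * s' x \<alpha>\<bar> \<le> \<eta> * (1 / real N)"
        using elim(4) xi \<alpha>(1) by blast
      ultimately have "s x \<le> g N x \<alpha> s + (1 / real N) * f x * sqrt (fst \<alpha> * snd \<alpha>)"
        unfolding abs_le_iff by (simp add: algebra_simps)
      also have "\<dots> \<le> ?T s x" by (rule scheme_op_upper[OF elim(5) xi \<alpha>(1)])
      also have "\<dots> \<le> ?T w x" by (rule scheme_op_mono[OF elim(5)]) (simp add: w_def)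
      finally show ?thesis using False by (simp add: w_def)
    qed
    moreover have "w x \<le> C + D * (fst x + snd x)" if "x \<in> grid N" for x
    proof -
      have "x \<in> unit_square" using that grid_subset_unit_square by blast
      then show ?thesis using uh_le[OF that] sC[of x] D0[OF that] C0 by (simp add: w_def)
    qed
    ultimately have "w x \<le> uh N x \<and> uh N x \<le> C + D * (fst x + snd x)" if "x \<in> grid N" for x
      by (intro solution_between[OF elim(5) uh[OF elim(5)]]) (use elim(3) that in auto)
    then show ?case by (auto simp: w_def)
  qed
qed

end

subsection \<open>Lower sums along monotone chains\<close>

text \<open>The last argument is a lower sum of the energy along a monotone chain of boxes.\<close>

inductive chain_value :: "(real \<times> real \<Rightarrow> real) \<Rightarrow> real \<Rightarrow> real \<Rightarrow> real \<Rightarrow> bool"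
  for F :: "real \<times> real \<Rightarrow> real" where
  origin: "chain_value F 0 0 0"
| step: "chain_value F x1 x2 a \<Longrightarrow> x1 \<le> y1 \<Longrightarrow> x2 \<le> y2 \<Longrightarrow> 0 \<le> m \<Longrightarrow>
    (\<And>z1 z2. x1 \<le> z1 \<Longrightarrow> z1 \<le> y1 \<Longrightarrow> x2 \<le> z2 \<Longrightarrow> z2 \<le> y2 \<Longrightarrow> m \<le> F (z1, z2)) \<Longrightarrow>
    chain_value F y1 y2 (a + m * sqrt ((y1 - x1) * (y2 - x2)))"

lemma chain_value_nonneg: "chain_value F x1 x2 a \<Longrightarrow> 0 \<le> x1 \<and> 0 \<le> x2 \<and> 0 \<le> a"
  by (induction rule: chain_value.induct) auto

text \<open>Reflection in the diagonal, by which estimates in the first coordinate carry over to the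
  second.\<close>

lemma chain_value_swap:
  "chain_value F x1 x2 a \<Longrightarrow> chain_value (\<lambda>z. F (snd z, fst z)) x2 x1 a"
proof (induction rule: chain_value.induct)
  case origin
  show ?case by (rule chain_value.origin)
next
  case (step x1 x2 a y1 y2 m)
  have "chain_value (\<lambda>z. F (snd z, fst z)) y2 y1 (a + m * sqrt ((y2 - x2) * (y1 - x1)))"
    by (rule chain_value.step[OF step.IH]) (use step.hyps in auto)
  then show ?case by (simp add: mult.commute)
qed

text \<open>After squaring, the cross term is twice the geometric mean of \<open>a * d\<close> and
  \<open>c * b\<close>, at most their sum. In bounds, consecutive boxes can therefore be merged into
  one.\<close>

lemma sqrt_cauchy_schwarz:
  fixes a b c d :: real
  assumes "0 \<le> a" "0 \<le> b" "0 \<le> c" "0 \<le> d"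
  shows "sqrt (a * b) + sqrt (c * d) \<le> sqrt ((a + c) * (b + d))"
proof (rule real_le_rsqrt)
  have "2 * (sqrt (a * d) * sqrt (c * b)) \<le> a * d + c * b"
    using sqrt_mult_le_average[of "a * d" "c * b"] assms by (simp add: real_sqrt_mult)
  moreover have "sqrt (a * b) * sqrt (c * d) = sqrt (a * d) * sqrt (c * b)"
    by (simp add: real_sqrt_mult)
  moreover have "(sqrt (a * b))\<^sup>2 = a * b" "(sqrt (c * d))\<^sup>2 = c * d"
    using assms by simp_all
  ultimately show "(sqrt (a * b) + sqrt (c * d))\<^sup>2 \<le> (a + c) * (b + d)"
    by (simp add: power2_sum algebra_simps)
qed

lemma sqrt_mult_add_le:
  fixes a b c :: real
  assumes "0 \<le> a" "0 \<le> b" "0 \<le> c"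
  shows "sqrt ((a + b) * c) \<le> sqrt (a * c) + sqrt (b * c)"
  using sqrt_add_le_add_sqrt[of "a * c" "b * c"] assms by (simp add: algebra_simps)

text \<open>The cost is defined on the whole plane because averages and enlarged boxes reach beyond
  the unit square.\<close>

locale running_cost =
  fixes F :: "real \<times> real \<Rightarrow> real" and M :: real
  assumes F_nonneg: "0 \<le> F z" and F_le: "F z \<le> M"
begin

lemma M_nonneg: "0 \<le> M"
  using F_nonneg F_le order_trans by blast

text \<open>With \<open>m \<le> M\<close> in every box, superadditivity of the geometric mean merges
  the chain into the single box that starts at the origin. In particular, nothing is collected on
  the axes.\<close>

lemma chain_value_le: "chain_value F x1 x2 a \<Longrightarrow> a \<le> M * sqrt (x1 * x2)"
proof (induction rule: chain_value.induct)
  case (step x1 x2 a y1 y2 m)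
  have "m \<le> M"
    using order_trans[OF step.hyps(5)[OF order_refl step.hyps(2) order_refl step.hyps(3)] F_le] .
  have "a + m * sqrt ((y1 - x1) * (y2 - x2))
    \<le> M * sqrt (x1 * x2) + M * sqrt ((y1 - x1) * (y2 - x2))"
    using step \<open>m \<le> M\<close> by (intro add_mono mult_right_mono) auto
  also have "\<dots> \<le> M * sqrt (y1 * y2)"
    using mult_left_mono[OF sqrt_cauchy_schwarz[of x1 x2 "y1 - x1" "y2 - x2"] M_nonneg]
      chain_value_nonneg[OF step.hyps(1)] step.hyps by (simp add: algebra_simps)
  finally show ?case .
qed simp

lemma chain_value_mono:
  assumes "chain_value F x1 x2 a" "x1 \<le> y1" "x2 \<le> y2"
  shows "chain_value F y1 y2 a"
  using chain_value.step[OF assms, of 0] F_nonneg by auto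

lemma chain_value_zero: "0 \<le> x1 \<Longrightarrow> 0 \<le> x2 \<Longrightarrow> chain_value F x1 x2 0"
  by (rule chain_value_mono[OF chain_value.origin])

text \<open>The part of a chain beyond \<open>x1\<close> lies in a thin strip, where Cauchy--Schwarz bounds what it
  collects; this gives continuity of the supremum.\<close>

lemma chain_value_truncate:
  assumes "chain_value F y1 y2 a" "0 \<le> x1"
  shows "\<exists>a'. chain_value F (min y1 x1) y2 a' \<and> a \<le> a' + M * sqrt (max 0 (y1 - x1) * y2)"
  using assms
proof (induction rule: chain_value.induct)
  case origin
  then show ?case using chain_value.origin by (intro exI[of _ 0]) auto
next
  case (step u1 u2 a y1 y2 m)
  note hyp = step.hyps
  have u: "0 \<le> u1" "0 \<le> u2" using chain_value_nonneg[OF hyp(1)] by auto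
  have mM: "m \<le> M" 
    using order_trans[OF hyp(5)[OF order_refl hyp(2) order_refl hyp(3)] F_le] .
  obtain a' where a': "chain_value F (min u1 x1) u2 a'"
    "a \<le> a' + M * sqrt (max 0 (u1 - x1) * u2)"
    using step.IH \<open>0 \<le> x1\<close> by blast
  \<comment> \<open>The new box ends before the cut, is crossed by it, or starts beyond it. A
    crossed box is divided at \<open>x1\<close>, and then nothing was lost earlier.\<close>
  consider "y1 \<le> x1" | "u1 \<le> x1" "x1 < y1" | "x1 < u1" by linarith
  then show ?case
  proof cases
    case 1
    have "chain_value F y1 y2 (a + m * sqrt ((y1 - u1) * (y2 - u2)))"
      by (rule chain_value.step[OF hyp])
    then show ?thesis using 1 by (intro exI[of _ "a + m * sqrt ((y1 - u1) * (y2 - u2))"]) auto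
  next
    case 2
    let ?a = "a' + m * sqrt ((x1 - u1) * (y2 - u2))"
    have "chain_value F x1 y2 ?a"
      by (rule chain_value.step) (use a'(1) 2 hyp in \<open>auto simp: min_def\<close>)
    moreover have "a + m * sqrt ((y1 - u1) * (y2 - u2)) \<le> ?a + M * sqrt ((y1 - x1) * y2)"
    proof -
      have "sqrt ((y1 - u1) * (y2 - u2)) \<le> sqrt ((x1 - u1) * (y2 - u2)) + sqrt ((y1 - x1) * (y2 - u2))"
        using sqrt_mult_add_le[of "x1 - u1" "y1 - x1" "y2 - u2"] 2 hyp by simp
      then have "m * sqrt ((y1 - u1) * (y2 - u2))
        \<le> m * sqrt ((x1 - u1) * (y2 - u2)) + m * sqrt ((y1 - x1) * (y2 - u2))"
        using hyp(4) by (metis distrib_left mult_left_mono)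
      moreover have "m * sqrt ((y1 - x1) * (y2 - u2)) \<le> M * sqrt ((y1 - x1) * y2)"
        using mM 2 hyp u by (intro mult_mono real_sqrt_le_mono mult_left_mono) auto
      moreover have "max 0 (u1 - x1) = 0" using 2 by simp
      then have "a \<le> a'" using a'(2) by simp
      ultimately show ?thesis by linarith
    qed
    ultimately show ?thesis using 2 by (intro exI[of _ ?a]) (auto simp: min_def max_def)
  next
    \<comment> \<open>The earlier loss and the value of the new box are merged by Cauchy--Schwarz,
      so the error stays that of a single strip.\<close>
    case 3
    have "chain_value F x1 y2 a'"
      by (rule chain_value_mono) (use a'(1) 3 hyp in \<open>auto simp: min_def\<close>)
    moreover have "a + m * sqrt ((y1 - u1) * (y2 - u2)) \<le> a' + M * sqrt ((y1 - x1) * y2)"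
    proof -
      have "a \<le> a' + M * sqrt ((u1 - x1) * u2)" using a'(2) 3 by (simp add: max_def)
      moreover have "m * sqrt ((y1 - u1) * (y2 - u2)) \<le> M * sqrt ((y1 - u1) * (y2 - u2))"
        using mM hyp by (intro mult_right_mono) auto
      moreover have "M * (sqrt ((u1 - x1) * u2) + sqrt ((y1 - u1) * (y2 - u2)))
        \<le> M * sqrt ((y1 - x1) * y2)"
        using mult_left_mono[OF sqrt_cauchy_schwarz[of "u1 - x1" u2 "y1 - u1" "y2 - u2"] M_nonneg]
          3 hyp u by simp
      ultimately show ?thesis by (simp add: distrib_left)
    qed
    ultimately show ?thesis using 3 hyp by (intro exI[of _ a']) (auto simp: min_def max_def)
  qed
qed

section \<open>The supremum over chains and its modulus of continuity\<close>

definition chain_sup :: "real \<Rightarrow> real \<Rightarrow> real" where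
  "chain_sup x1 x2 = Sup {a. chain_value F x1 x2 a}"

lemma chain_sup_upper: "chain_value F x1 x2 a \<Longrightarrow> a \<le> chain_sup x1 x2"
  unfolding chain_sup_def
  by (rule cSup_upper) (auto intro!: bdd_aboveI[of _ "M * sqrt (x1 * x2)"] chain_value_le)

lemma chain_sup_least:
  assumes "0 \<le> x1" "0 \<le> x2" "\<And>a. chain_value F x1 x2 a \<Longrightarrow> a \<le> c"
  shows "chain_sup x1 x2 \<le> c"
  unfolding chain_sup_def using assms chain_value_zero[of x1 x2] by (intro cSup_least) auto

lemma chain_sup_nonneg: "0 \<le> x1 \<Longrightarrow> 0 \<le> x2 \<Longrightarrow> 0 \<le> chain_sup x1 x2"
  by (rule chain_sup_upper[OF chain_value_zero])

lemma chain_sup_superadditive: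
  assumes "0 \<le> x1" "0 \<le> x2" "x1 \<le> y1" "x2 \<le> y2" "0 \<le> m"
    "\<And>z1 z2. x1 \<le> z1 \<Longrightarrow> z1 \<le> y1 \<Longrightarrow> x2 \<le> z2 \<Longrightarrow> z2 \<le> y2 \<Longrightarrow> m \<le> F (z1, z2)"
  shows "chain_sup x1 x2 + m * sqrt ((y1 - x1) * (y2 - x2)) \<le> chain_sup y1 y2"
proof -
  have "chain_sup x1 x2 \<le> chain_sup y1 y2 - m * sqrt ((y1 - x1) * (y2 - x2))"
  proof (rule chain_sup_least[OF assms(1,2)])
    fix a assume "chain_value F x1 x2 a"
    from chain_sup_upper[OF chain_value.step[OF this assms(3-)]]
    show "a \<le> chain_sup y1 y2 - m * sqrt ((y1 - x1) * (y2 - x2))" by simp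
  qed
  then show ?thesis by simp
qed

lemma chain_sup_mono:
  assumes "0 \<le> x1" "0 \<le> x2" "x1 \<le> y1" "x2 \<le> y2"
  shows "chain_sup x1 x2 \<le> chain_sup y1 y2"
  using chain_sup_superadditive[OF assms, of 0] F_nonneg by simp

lemma chain_sup_le_fst:
  assumes "0 \<le> x1" "x1 \<le> y1" "0 \<le> x2"
  shows "chain_sup y1 x2 \<le> chain_sup x1 x2 + M * sqrt ((y1 - x1) * x2)"
proof (rule chain_sup_least)
  fix a assume "chain_value F y1 x2 a"
  then obtain a' where "chain_value F x1 x2 a'" "a \<le> a' + M * sqrt ((y1 - x1) * x2)"
    using chain_value_truncate[of y1 x2 a x1] assms by (auto simp: min_def max_def split: if_splits)
  then show "a \<le> chain_sup x1 x2 + M * sqrt ((y1 - x1) * x2)"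
    using chain_sup_upper by fastforce
qed (use assms in auto)

end

lemma (in running_cost) chain_sup_le_snd:
  assumes "0 \<le> x1" "0 \<le> x2" "x2 \<le> y2"
  shows "chain_sup x1 y2 \<le> chain_sup x1 x2 + M * sqrt ((y2 - x2) * x1)"
proof -
  interpret swap: running_cost "\<lambda>z. F (snd z, fst z)" M
    by unfold_locales (auto intro: F_nonneg F_le)
  have "chain_value F a b c \<longleftrightarrow> chain_value (\<lambda>z. F (snd z, fst z)) b a c" for a b c
    using chain_value_swap[of F a b c] chain_value_swap[of "\<lambda>z. F (snd z, fst z)" b a c] by auto
  then have "chain_sup a b = swap.chain_sup b a" for a b
    by (simp add: chain_sup_def swap.chain_sup_def)
  then show ?thesis using swap.chain_sup_le_fst[of x2 y2 x1] assms by simp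
qed

context running_cost
begin

text \<open>The two points are compared through their componentwise maximum: monotonicity leads up
  to it, and then one coordinate at a time is lowered. The modulus is Hoelder with exponent 1/2,
  uniformly up to the axes.\<close>

lemma chain_sup_le_add:
  assumes "0 \<le> x1" "0 \<le> x2" "x1 \<le> R" "x2 \<le> R" "0 \<le> y1" "0 \<le> y2" "y1 \<le> R" "y2 \<le> R"
  shows "chain_sup y1 y2 \<le> chain_sup x1 x2 + (M * sqrt (R * \<bar>y1 - x1\<bar>) + M * sqrt (R * \<bar>y2 - x2\<bar>))"
proof -
  have "chain_sup y1 y2 \<le> chain_sup (max x1 y1) (max x2 y2)"
    using assms by (intro chain_sup_mono) auto
  also have "\<dots> \<le> chain_sup x1 (max x2 y2) + M * sqrt ((max x1 y1 - x1) * max x2 y2)"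
    using assms by (intro chain_sup_le_fst) auto
  also have "M * sqrt ((max x1 y1 - x1) * max x2 y2) \<le> M * sqrt (\<bar>y1 - x1\<bar> * R)"
    using assms M_nonneg by (intro mult_left_mono real_sqrt_le_mono mult_mono) auto
  also have "chain_sup x1 (max x2 y2) \<le> chain_sup x1 x2 + M * sqrt ((max x2 y2 - x2) * x1)"
    using assms by (intro chain_sup_le_snd) auto
  also have "M * sqrt ((max x2 y2 - x2) * x1) \<le> M * sqrt (\<bar>y2 - x2\<bar> * R)"
    using assms M_nonneg by (intro mult_left_mono real_sqrt_le_mono mult_mono) auto
  finally show ?thesis by (simp add: mult.commute)
qed

text \<open>Clamping yields a continuous function on the plane. The bound is 2 because a shift
  within a window of side at most 1/2, followed by a displacement of at most as much, must lead from
  the unit square only to points where clamping changes nothing.\<close>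

definition clamped_sup :: "real \<times> real \<Rightarrow> real" where
  "clamped_sup x = chain_sup (max 0 (min 2 (fst x))) (max 0 (min 2 (snd x)))"

lemma clamped_sup_le_add:
  "clamped_sup y \<le> clamped_sup x + (M * sqrt (2 * \<bar>fst y - fst x\<bar>) + M * sqrt (2 * \<bar>snd y - snd x\<bar>))"
proof -
  let ?c = "\<lambda>t::real. max 0 (min 2 t)"
  have "clamped_sup y \<le> clamped_sup x + (M * sqrt (2 * \<bar>?c (fst y) - ?c (fst x)\<bar>) + M * sqrt (2 * \<bar>?c (snd y) - ?c (snd x)\<bar>))"
    unfolding clamped_sup_def by (rule chain_sup_le_add) auto
  also have "M * sqrt (2 * \<bar>?c (fst y) - ?c (fst x)\<bar>) \<le> M * sqrt (2 * \<bar>fst y - fst x\<bar>)"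
    using M_nonneg by (intro mult_left_mono real_sqrt_le_mono) auto
  also have "M * sqrt (2 * \<bar>?c (snd y) - ?c (snd x)\<bar>) \<le> M * sqrt (2 * \<bar>snd y - snd x\<bar>)"
    using M_nonneg by (intro mult_left_mono real_sqrt_le_mono) auto
  finally show ?thesis by simp
qed

lemma clamped_sup_continuous: "continuous_on UNIV clamped_sup"
proof -
  have "(clamped_sup \<longlongrightarrow> clamped_sup x) (at x)" for x
  proof (rule LIM_zero_cancel, rule Lim_null_comparison)
    show "eventually (\<lambda>y. norm (clamped_sup y - clamped_sup x)
      \<le> M * sqrt (2 * \<bar>fst y - fst x\<bar>) + M * sqrt (2 * \<bar>snd y - snd x\<bar>)) (at x)"
      using clamped_sup_le_add[of _ x] clamped_sup_le_add[of x]
      by (intro always_eventually allI) (simp add: abs_le_iff abs_minus_commute algebra_simps)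
    show "((\<lambda>y. M * sqrt (2 * \<bar>fst y - fst x\<bar>) + M * sqrt (2 * \<bar>snd y - snd x\<bar>)) \<longlongrightarrow> 0) (at x)"
      by (auto intro!: tendsto_eq_intros)
  qed
  then show ?thesis by (simp add: continuous_on_eq_continuous_at isCont_def)
qed

lemma clamped_sup_nonneg: "0 \<le> clamped_sup x"
  unfolding clamped_sup_def by (intro chain_sup_nonneg) auto

end

subsection \<open>Absolutely continuous paths\<close>

text \<open>The tagged-division argument makes do without differentiating monotone functions: tags in
  the exceptional null set are paid for by absolute continuity, all others by the derivative.\<close>

lemma abs_continuous_integral_le:
  fixes G e :: "real \<Rightarrow> real"
  assumes G: "abs_continuous G" and ab: "0 \<le> a" "a \<le> b" "b \<le> 1"
    and e: "(e has_integral I) {a..b}" and N: "negligible N"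
    and deriv: "\<And>t. t \<in> {a..b} - N \<Longrightarrow> \<exists>d. (G has_real_derivative d) (at t) \<and> e t \<le> d"
  shows "I \<le> G b - G a"
proof (rule field_le_epsilon)
  fix \<epsilon> :: real assume "\<epsilon> > 0"
  \<comment> \<open>Three errors: the Riemann sum, the derivative estimates, and the intervals with
    exceptional tags.\<close>
  define \<epsilon>' where "\<epsilon>' = \<epsilon> / 3"
  have \<epsilon>': "\<epsilon>' > 0" using \<open>\<epsilon> > 0\<close> by (simp add: \<epsilon>'_def)
  define \<kappa> where "\<kappa> = \<epsilon>' / (b - a + 1)"
  have \<kappa>: "\<kappa> > 0" using \<epsilon>' ab by (simp add: \<kappa>_def)
  have \<kappa>_le: "\<kappa> * (b - a) \<le> \<epsilon>'"
    using \<epsilon>' ab by (simp add: \<kappa>_def divide_simps algebra_simps)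
  \<comment> \<open>Zeroing the integrand on \<open>N\<close> removes the terms with tags in
    \<open>N\<close> from the Riemann sum, whatever the size of \<open>e\<close> there.\<close>
  define e0 where "e0 t = (if t \<in> N then 0 else e t)" for t
  have "(e0 has_integral I) {a..b}"
    by (rule has_integral_spike[OF N _ e]) (simp add: e0_def)
  from has_integral_real[THEN iffD1, rule_format, OF this \<epsilon>']
  obtain \<gamma>1 where "gauge \<gamma>1 \<and> (\<forall>p. p tagged_division_of {a..b} \<and> \<gamma>1 fine p \<longrightarrow>
      norm (sum (\<lambda>(x,k). measure lborel k *\<^sub>R e0 x) p - I) < \<epsilon>')" ..
  then have \<gamma>1: "gauge \<gamma>1" "\<And>p. p tagged_division_of {a..b} \<Longrightarrow> \<gamma>1 fine p \<Longrightarrow>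
      norm (sum (\<lambda>(x,k). measure lborel k *\<^sub>R e0 x) p - I) < \<epsilon>'"
    by simp_all
  obtain \<delta> where \<delta>: "\<delta> > 0" "\<forall>(n::nat) a b.
      (\<forall>i<n. 0 \<le> a i \<and> a i \<le> b i \<and> b i \<le> 1) \<longrightarrow>
      (\<forall>i<n. \<forall>j<n. i \<noteq> j \<longrightarrow> {a i<..<b i} \<inter> {a j<..<b j} = {}) \<longrightarrow>
      (\<Sum>i<n. b i - a i) < \<delta> \<longrightarrow> (\<Sum>i<n. dist (G (a i)) (G (b i))) < \<epsilon>'"
    using G[unfolded abs_continuous_def, rule_format, OF \<epsilon>'] by (elim exE conjE)
  have Ns: "N \<in> sets lebesgue" using N by (rule negligible_imp_sets)
  obtain T where T: "open T" "N \<subseteq> T" "T - N \<in> lmeasurable" "emeasure lebesgue (T - N) < ennreal \<delta>"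
    using sets_lebesgue_outer_open[OF Ns \<delta>(1)] by blast
  have N_null: "N \<in> null_sets lebesgue" using N by (simp add: negligible_iff_null_sets)
  have T_sets: "T \<in> sets lebesgue" using T(1) by (auto intro: borel_open)
  have "emeasure lebesgue T = emeasure lebesgue (T - N)"
    using emeasure_Diff_null_set[OF N_null T_sets] by simp
  then have T_em: "emeasure lebesgue T < ennreal \<delta>" using T(4) by simp
  then have T_meas: "T \<in> lmeasurable"
    using T_sets by (auto simp: fmeasurable_def intro: less_trans)
  have T_less: "measure lebesgue T < \<delta>"
    using T_em emeasure_eq_measure2[OF T_meas] \<delta>(1) by (simp add: ennreal_less_iff)
  have "\<exists>d r. e t \<le> d \<and> r > 0 \<and> (\<forall>s. \<bar>s - t\<bar> < r \<longrightarrow> \<bar>G s - G t - d * (s - t)\<bar> \<le> \<kappa> * \<bar>s - t\<bar>)"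
    if t: "t \<in> {a..b} - N" for t
  proof -
    obtain d where "(G has_real_derivative d) (at t)" "e t \<le> d" using deriv[OF t] by blast
    moreover from this(1) obtain r where "r > 0"
      "\<forall>s. norm (s - t) < r \<longrightarrow> norm (G s - G t - d * (s - t)) \<le> \<kappa> * norm (s - t)"
      unfolding has_field_derivative_def has_derivative_at_alt using \<kappa> by blast
    ultimately show ?thesis by (intro exI[of _ d] exI[of _ r]) auto
  qed
  then obtain d r where dr: "\<And>t. t \<in> {a..b} - N \<Longrightarrow> e t \<le> d t"
    "\<And>t. t \<in> {a..b} - N \<Longrightarrow> r t > 0"
    "\<And>t s. t \<in> {a..b} - N \<Longrightarrow> \<bar>s - t\<bar> < r t \<Longrightarrow> \<bar>G s - G t - d t * (s - t)\<bar> \<le> \<kappa> * \<bar>s - t\<bar>"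
    by metis
  \<comment> \<open>Intervals tagged in \<open>N\<close> are forced into \<open>T\<close>, so their
    total length is below \<open>\<delta>\<close>; the others are short enough for the derivative
    estimate at their tag.\<close>
  define \<gamma>2 where "\<gamma>2 t = (if t \<in> N then T else if t \<in> {a..b} then ball t (r t) else UNIV)" for t
  have "gauge \<gamma>2"
    unfolding gauge_def \<gamma>2_def using T(1,2) dr(2) by auto
  then have "gauge (\<lambda>t. \<gamma>1 t \<inter> \<gamma>2 t)" using \<gamma>1(1) by (intro gauge_Int)
  then obtain p where p: "p tagged_division_of {a..b}" "(\<lambda>t. \<gamma>1 t \<inter> \<gamma>2 t) fine p"
    using fine_division_exists_real by blast
  have fine: "\<gamma>1 fine p" "\<gamma>2 fine p" using p(2) by (auto simp: fine_Int)
  note pD = tagged_division_ofD[OF p(1)]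
  define \<Delta> where "\<Delta> K = G (Sup K) - G (Inf K)" for K
  have K_Icc: "\<exists>u v. K = {u..v} \<and> u \<le> x \<and> x \<le> v \<and> a \<le> u \<and> v \<le> b" if xK: "(x, K) \<in> p" for x K
  proof -
    obtain u v where K: "K = cbox u v" using pD(4)[OF xK] by blast
    moreover have "x \<in> K" "K \<subseteq> {a..b}" using pD(2,3)[OF xK] by auto
    ultimately show ?thesis by (intro exI[of _ u] exI[of _ v]) (auto simp: subset_iff)
  qed
  have local: "measure lborel K *\<^sub>R e0 x \<le> \<Delta> K + \<kappa> * measure lborel K + (if x \<in> N then \<bar>\<Delta> K\<bar> else 0)"
    if xK: "(x, K) \<in> p" for x K
  proof -
    obtain u v where K: "K = {u..v}" "u \<le> x" "x \<le> v" "a \<le> u" "v \<le> b" using K_Icc[OF xK] by blast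
    have content: "measure lborel K = v - u" using K by simp
    show ?thesis
    proof (cases "x \<in> N")
      case True
      have "0 \<le> \<kappa> * measure lborel K" using \<kappa> by simp
      then show ?thesis using True by (simp add: e0_def)
    next
      case False
      then have x: "x \<in> {a..b} - N" using K by auto
      have "K \<subseteq> ball x (r x)"
        using fine(2) xK False x unfolding fine_def \<gamma>2_def by force
      moreover have "u \<in> K" "v \<in> K" using K by simp_all
      ultimately have "u \<in> ball x (r x)" "v \<in> ball x (r x)" by blast+
      then have "\<bar>u - x\<bar> < r x" "\<bar>v - x\<bar> < r x" by (simp_all add: dist_real_def abs_minus_commute)
      then have "\<bar>G u - G x - d x * (u - x)\<bar> \<le> \<kappa> * (x - u)" "\<bar>G v - G x - d x * (v - x)\<bar> \<le> \<kappa> * (v - x)"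
        using dr(3)[OF x, of u] dr(3)[OF x, of v] K by simp_all
      \<comment> \<open>The tag lies between \<open>u\<close> and \<open>v\<close>, so the two
        errors add up to \<open>\<kappa> * (v - u)\<close>.\<close>
      then have "d x * (v - u) \<le> G v - G u + \<kappa> * (v - u)"
        unfolding abs_le_iff by (simp add: algebra_simps)
      moreover have "(v - u) * e x \<le> (v - u) * d x"
        using dr(1)[OF x] K by (intro mult_left_mono) auto
      moreover have "\<Delta> K = G v - G u" using K by (simp add: \<Delta>_def)
      ultimately show ?thesis using False by (simp add: e0_def content mult.commute)
    qed
  qed
  define B where "B = {(x, K) \<in> p. x \<in> N}"
  have fB: "finite B" using pD(1) by (auto simp: B_def intro: finite_subset[of _ p])
  have bad: "(\<Sum>(x, K)\<in>B. \<bar>\<Delta> K\<bar>) < \<epsilon>'"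
  proof -
    \<comment> \<open>Absolute continuity is stated for families indexed by natural numbers, hence
      the enumeration.\<close>
    obtain h where h: "bij_betw h {..<card B} B"
      using ex_bij_betw_nat_finite[OF fB] by (auto simp: atLeast0LessThan)
    define l u where "l i = Inf (snd (h i))" and "u i = Sup (snd (h i))" for i
    have hB: "h i \<in> p \<and> fst (h i) \<in> N" if "i < card B" for i
      using bij_betwE[OF h] that by (force simp: B_def)
    have lu: "snd (h i) = {l i..u i} \<and> a \<le> l i \<and> l i \<le> u i \<and> u i \<le> b" if "i < card B" for i
      using K_Icc[of "fst (h i)" "snd (h i)"] hB[OF that] by (force simp: l_def u_def)
    have disj: "{l i<..<u i} \<inter> {l j<..<u j} = {}" if "i < card B" "j < card B" "i \<noteq> j" for i j
    proof -
      have "h i \<noteq> h j" using h that unfolding bij_betw_def inj_on_def by auto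
      then have "interior (snd (h i)) \<inter> interior (snd (h j)) = {}"
        using pD(5)[of "fst (h i)" "snd (h i)" "fst (h j)" "snd (h j)"] hB that by simp
      then show ?thesis using lu[OF that(1)] lu[OF that(2)] by simp
    qed
    have sub: "{l i<..<u i} \<subseteq> T" if "i < card B" for i
    proof -
      have "snd (h i) \<subseteq> \<gamma>2 (fst (h i))"
        using fineD[OF fine(2), of "fst (h i)" "snd (h i)"] hB[OF that] by simp
      then show ?thesis using lu[OF that] hB[OF that] by (force simp: \<gamma>2_def)
    qed
    have "(\<Sum>i<card B. u i - l i) = (\<Sum>i<card B. measure lebesgue {l i<..<u i})"
      using lu by (intro sum.cong) auto
    also have "\<dots> = measure lebesgue (\<Union>i<card B. {l i<..<u i})"
      by (rule measure_finite_Union[symmetric])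
        (use disj lu in \<open>auto simp: disjoint_family_on_def\<close>)
    also have "\<dots> \<le> measure lebesgue T"
      by (rule measure_mono_fmeasurable) (use sub T_meas in auto)
    finally have "(\<Sum>i<card B. u i - l i) < \<delta>" using T_less by linarith
    moreover have "\<forall>i<card B. 0 \<le> l i \<and> l i \<le> u i \<and> u i \<le> 1"
      using lu ab by (meson order_trans)
    moreover have "\<forall>i<card B. \<forall>j<card B. i \<noteq> j \<longrightarrow> {l i<..<u i} \<inter> {l j<..<u j} = {}"
      using disj by simp
    ultimately have "(\<Sum>i<card B. dist (G (l i)) (G (u i))) < \<epsilon>'"
      using \<delta>(2) by simp
    moreover have "(\<Sum>(x, K)\<in>B. \<bar>\<Delta> K\<bar>) = (\<Sum>i<card B. dist (G (l i)) (G (u i)))"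
      unfolding sum.reindex_bij_betw[OF h, symmetric]
      by (intro sum.cong) (auto simp: \<Delta>_def l_def u_def dist_real_def case_prod_beta abs_minus_commute)
    ultimately show ?thesis by simp
  qed
  have "I - \<epsilon>' \<le> (\<Sum>(x, K)\<in>p. measure lborel K *\<^sub>R e0 x)"
    using \<gamma>1(2)[OF p(1) fine(1)] by (simp add: abs_le_iff abs_less_iff)
  also have "\<dots> \<le> (\<Sum>(x, K)\<in>p. \<Delta> K + \<kappa> * measure lborel K + (if x \<in> N then \<bar>\<Delta> K\<bar> else 0))"
    using local by (intro sum_mono) auto
  also have "\<dots> = (\<Sum>(x, K)\<in>p. \<Delta> K) + \<kappa> * (\<Sum>(x, K)\<in>p. measure lborel K)
      + (\<Sum>(x, K)\<in>p. if x \<in> N then \<bar>\<Delta> K\<bar> else 0)"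
    by (simp add: case_prod_beta sum.distrib sum_distrib_left)
  also have "(\<Sum>(x, K)\<in>p. \<Delta> K) = G b - G a"
    unfolding \<Delta>_def by (rule additive_tagged_division_1[OF ab(2) p(1)])
  also have "(\<Sum>(x, K)\<in>p. measure lborel K) = b - a"
    using additive_content_tagged_division[of p a b] p(1) ab by simp
  also have "(\<Sum>(x, K)\<in>p. if x \<in> N then \<bar>\<Delta> K\<bar> else 0) = (\<Sum>(x, K)\<in>B. \<bar>\<Delta> K\<bar>)"
    unfolding B_def case_prod_beta
    using sum.inter_filter[OF pD(1), of "\<lambda>z. \<bar>\<Delta> (snd z)\<bar>" "\<lambda>z. fst z \<in> N"] by simp
  finally show "I \<le> G b - G a + \<epsilon>"
    using bad \<kappa>_le by (simp add: \<epsilon>'_def)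
qed

text \<open>The case of the zero integrand; it confines admissible paths to the square.\<close>

lemma abs_continuous_mono:
  fixes G :: "real \<Rightarrow> real"
  assumes "abs_continuous G" "0 \<le> a" "a \<le> b" "b \<le> 1" "negligible N"
    "\<And>t. t \<in> {0..1} - N \<Longrightarrow> \<exists>d\<ge>0. (G has_real_derivative d) (at t)"
  shows "G a \<le> G b"
proof -
  have "\<exists>d. (G has_real_derivative d) (at t) \<and> 0 \<le> d" if "t \<in> {a..b} - N" for t
    using assms(6)[of t] that assms(2,4) by (force simp: Bex_def)
  then have "0 \<le> G b - G a"
    by (rule abs_continuous_integral_le[OF assms(1-4) has_integral_0 assms(5)])
  then show ?thesis by simp
qed

lemma abs_continuous_lipschitz_compose:
  assumes \<phi>: "abs_continuous \<phi>" and L: "L-lipschitz_on S p"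
    and S: "\<And>t. 0 \<le> t \<Longrightarrow> t \<le> 1 \<Longrightarrow> \<phi> t \<in> S"
  shows "abs_continuous (\<lambda>t. p (\<phi> t))"
  unfolding abs_continuous_def
proof (intro allI impI)
  fix \<epsilon> :: real assume "\<epsilon> > 0"
  have L0: "L \<ge> 0" using L by (rule lipschitz_on_nonneg)
  \<comment> \<open>\<open>L + 1\<close> avoids a division by zero when
    \<open>L = 0\<close>.\<close>
  then have \<epsilon>L: "\<epsilon> / (L + 1) > 0" using \<open>\<epsilon> > 0\<close> by simp
  obtain \<delta> where \<delta>: "\<delta> > 0" "\<forall>(n::nat) a b.
      (\<forall>i<n. 0 \<le> a i \<and> a i \<le> b i \<and> b i \<le> 1) \<longrightarrow>
      (\<forall>i<n. \<forall>j<n. i \<noteq> j \<longrightarrow> {a i<..<b i} \<inter> {a j<..<b j} = {}) \<longrightarrow>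
      (\<Sum>i<n. b i - a i) < \<delta> \<longrightarrow> (\<Sum>i<n. dist (\<phi> (a i)) (\<phi> (b i))) < \<epsilon> / (L + 1)"
    using \<phi>[unfolded abs_continuous_def, rule_format, OF \<epsilon>L] by (elim exE conjE)
  show "\<exists>\<delta>>0. \<forall>(n::nat) a b.
      (\<forall>i<n. 0 \<le> a i \<and> a i \<le> b i \<and> b i \<le> 1) \<longrightarrow>
      (\<forall>i<n. \<forall>j<n. i \<noteq> j \<longrightarrow> {a i<..<b i} \<inter> {a j<..<b j} = {}) \<longrightarrow>
      (\<Sum>i<n. b i - a i) < \<delta> \<longrightarrow> (\<Sum>i<n. dist (p (\<phi> (a i))) (p (\<phi> (b i)))) < \<epsilon>"
  proof (intro exI[of _ \<delta>] conjI allI impI \<delta>(1))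
    fix n :: nat and a b
    assume *: "\<forall>i<n. 0 \<le> a i \<and> a i \<le> b i \<and> b i \<le> 1"
      "\<forall>i<n. \<forall>j<n. i \<noteq> j \<longrightarrow> {a i<..<b i} \<inter> {a j<..<b j} = {}" "(\<Sum>i<n. b i - a i) < \<delta>"
    have "(\<Sum>i<n. dist (p (\<phi> (a i))) (p (\<phi> (b i)))) \<le> (\<Sum>i<n. L * dist (\<phi> (a i)) (\<phi> (b i)))"
    proof (intro sum_mono lipschitz_onD[OF L] S)
      fix i assume "i \<in> {..<n}"
      then have "0 \<le> a i \<and> a i \<le> b i \<and> b i \<le> 1" using *(1) by blast
      then show "0 \<le> a i" "a i \<le> 1" "0 \<le> b i" "b i \<le> 1" by auto
    qed
    also have "\<dots> = L * (\<Sum>i<n. dist (\<phi> (a i)) (\<phi> (b i)))" by (simp add: sum_distrib_left)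
    also have "\<dots> \<le> (L + 1) * (\<Sum>i<n. dist (\<phi> (a i)) (\<phi> (b i)))"
      by (intro mult_right_mono sum_nonneg) auto
    also have "\<dots> < (L + 1) * (\<epsilon> / (L + 1))"
      using \<delta>(2)[THEN spec, THEN spec, THEN spec, THEN mp, THEN mp, THEN mp, OF *] L0
      by (intro mult_strict_left_mono) auto
    also have "\<dots> = \<epsilon>" using L0 by simp
    finally show "(\<Sum>i<n. dist (p (\<phi> (a i))) (p (\<phi> (b i)))) < \<epsilon>" .
  qed
qed

lemma admissible_null_set:
  assumes "\<phi> \<in> admissible x"
  shows "\<exists>N. negligible N \<and> (\<forall>t\<in>{0..1} - N.
    (\<exists>d\<ge>0. ((\<lambda>t. fst (\<phi> t)) has_real_derivative d) (at t)) \<and>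
    (\<exists>d\<ge>0. ((\<lambda>t. snd (\<phi> t)) has_real_derivative d) (at t)))"
proof -
  have "AE s in lebesgue. s \<in> {0..1} \<longrightarrow>
        (\<exists>d\<ge>0. ((\<lambda>t. fst (\<phi> t)) has_real_derivative d) (at s)) \<and>
        (\<exists>d\<ge>0. ((\<lambda>t. snd (\<phi> t)) has_real_derivative d) (at s))"
    using assms by (simp add: admissible_def)
  from AE_E3[OF this] obtain N where N: "N \<in> null_sets lebesgue" "\<And>s. s \<in> space lebesgue - N \<Longrightarrow>
      s \<in> {0..1} \<longrightarrow> (\<exists>d\<ge>0. ((\<lambda>t. fst (\<phi> t)) has_real_derivative d) (at s)) \<and>
        (\<exists>d\<ge>0. ((\<lambda>t. snd (\<phi> t)) has_real_derivative d) (at s))"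
    by metis
  then show ?thesis by (intro exI[of _ N]) (simp add: negligible_iff_null_sets)
qed

lemma abs_continuous_fst:
  assumes "abs_continuous \<phi>"
  shows "abs_continuous (\<lambda>t. fst (\<phi> t))"
proof (rule abs_continuous_lipschitz_compose[OF assms])
  show "1-lipschitz_on UNIV fst" by (rule lipschitz_onI) (simp_all add: dist_fst_le)
qed simp

lemma abs_continuous_snd:
  assumes "abs_continuous \<phi>"
  shows "abs_continuous (\<lambda>t. snd (\<phi> t))"
proof (rule abs_continuous_lipschitz_compose[OF assms])
  show "1-lipschitz_on UNIV snd" by (rule lipschitz_onI) (simp_all add: dist_snd_le)
qed simp

lemma admissible_in_unit_square:
  assumes \<phi>: "\<phi> \<in> admissible x" and x: "x \<in> unit_square" and t: "0 \<le> t" "t \<le> 1"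
  shows "\<phi> t \<in> unit_square"
proof -
  from admissible_null_set[OF \<phi>] obtain N where "negligible N \<and> (\<forall>t\<in>{0..1} - N.
    (\<exists>d\<ge>0. ((\<lambda>t. fst (\<phi> t)) has_real_derivative d) (at t)) \<and>
    (\<exists>d\<ge>0. ((\<lambda>t. snd (\<phi> t)) has_real_derivative d) (at t)))" ..
  then have N: "negligible N"
    "\<And>t. t \<in> {0..1} - N \<Longrightarrow> \<exists>d\<ge>0. ((\<lambda>t. fst (\<phi> t)) has_real_derivative d) (at t)"
    "\<And>t. t \<in> {0..1} - N \<Longrightarrow> \<exists>d\<ge>0. ((\<lambda>t. snd (\<phi> t)) has_real_derivative d) (at t)"
    by simp_all
  have ends: "\<phi> 0 = (0, 0)" "\<phi> 1 = x" and ac: "abs_continuous \<phi>"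
    using \<phi> by (auto simp: admissible_def)
  note mono = abs_continuous_mono[OF abs_continuous_fst[OF ac] _ _ _ N(1,2)]
    abs_continuous_mono[OF abs_continuous_snd[OF ac] _ _ _ N(1,3)]
  have "fst (\<phi> 0) \<le> fst (\<phi> t)" "fst (\<phi> t) \<le> fst (\<phi> 1)"
    "snd (\<phi> 0) \<le> snd (\<phi> t)" "snd (\<phi> t) \<le> snd (\<phi> 1)"
    using t by (auto intro!: mono)
  then show ?thesis using x ends by (cases "\<phi> t") (auto simp: unit_square_def)
qed

lemma convex_unit_square: "convex unit_square"
  unfolding unit_square_def by (intro convex_Times) auto

lemma real_polynomial_lipschitz:
  fixes p :: "real \<times> real \<Rightarrow> real"
  assumes p: "real_polynomial_function p"
  shows "\<exists>L. L-lipschitz_on unit_square p"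
proof -
  obtain p1 p2 where g: "real_polynomial_function p1" "real_polynomial_function p2"
    "\<And>x. (p has_derivative (\<lambda>v. p1 x * fst v + p2 x * snd v)) (at x)"
    using real_polynomial_gradient[OF p] by blast
  have "bounded (p1 ` unit_square)" "bounded (p2 ` unit_square)"
    using g compact_unit_square
    by (auto intro!: compact_imp_bounded compact_continuous_image real_polynomial_continuous)
  then obtain B1 B2 where B: "B1 > 0" "\<And>x. x \<in> unit_square \<Longrightarrow> \<bar>p1 x\<bar> \<le> B1"
    "B2 > 0" "\<And>x. x \<in> unit_square \<Longrightarrow> \<bar>p2 x\<bar> \<le> B2"
    unfolding bounded_pos by auto
  have "norm (p x - p y) \<le> (B1 + B2) * norm (x - y)" if "x \<in> unit_square" "y \<in> unit_square" for x y
  proof (rule differentiable_bound[OF convex_unit_square _ _ that])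
    show "(p has_derivative (\<lambda>v. p1 x * fst v + p2 x * snd v)) (at x within unit_square)" for x
      using g(3) by (rule has_derivative_at_withinI)
    fix x assume x: "x \<in> unit_square"
    show "onorm (\<lambda>v. p1 x * fst v + p2 x * snd v) \<le> B1 + B2"
    proof (rule onorm_le)
      fix v :: "real \<times> real"
      have "\<bar>p1 x * fst v + p2 x * snd v\<bar> \<le> \<bar>p1 x\<bar> * \<bar>fst v\<bar> + \<bar>p2 x\<bar> * \<bar>snd v\<bar>"
        by (metis abs_mult abs_triangle_ineq)
      also have "\<dots> \<le> B1 * norm v + B2 * norm v"
        using B x norm_fst_le[of "fst v" "snd v"] norm_snd_le[of "snd v" "fst v"]
        by (intro add_mono mult_mono) auto
      finally show "norm (p1 x * fst v + p2 x * snd v) \<le> (B1 + B2) * norm v"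
        by (simp add: algebra_simps)
    qed
  qed
  then show ?thesis
    using B by (intro exI[of _ "B1 + B2"] lipschitz_onI) (auto simp: dist_norm)
qed

text \<open>By the chain rule the derivative of \<open>p\<close> along the path dominates the energy
  density almost everywhere. Absolute continuity of \<open>p\<close> along the path allows this to
  be integrated, and \<open>p (0, 0) \<ge> 0\<close> disposes of the start.\<close>

lemma energy_le_supersolution:
  assumes \<phi>: "\<phi> \<in> admissible x" and x: "x \<in> unit_square"
    and p: "real_polynomial_function p" "\<And>z. (p has_derivative p' z) (at z)"
    and super: "\<And>z v. z \<in> unit_square \<Longrightarrow> 0 \<le> fst v \<Longrightarrow> 0 \<le> snd v \<Longrightarrow>
      f z * sqrt (fst v * snd v) \<le> p' z v"
    and nonneg: "\<And>z. z \<in> unit_square \<Longrightarrow> 0 \<le> p z"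
  shows "energy f \<phi> \<le> p x"
proof -
  let ?e = "\<lambda>t. f (\<phi> t) * sqrt (deriv (\<lambda>s. fst (\<phi> s)) t * deriv (\<lambda>s. snd (\<phi> s)) t)"
  show ?thesis
  proof (cases "set_integrable lebesgue {0..1} ?e")
    \<comment> \<open>The energy is a Lebesgue integral, which is 0 by convention for a density that
      is not integrable.\<close>
    case False
    then have "energy f \<phi> = 0"
      unfolding energy_def set_lebesgue_integral_def set_integrable_def
      by (rule not_integrable_integral_eq)
    then show ?thesis using nonneg[OF x] by simp
  next
    case True
    have int: "(?e has_integral energy f \<phi>) {0..1}"
      using has_integral_set_lebesgue[OF True] by (simp add: energy_def)
    from admissible_null_set[OF \<phi>] obtain N where "negligible N \<and> (\<forall>t\<in>{0..1} - N.
      (\<exists>d\<ge>0. ((\<lambda>t. fst (\<phi> t)) has_real_derivative d) (at t)) \<and>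
      (\<exists>d\<ge>0. ((\<lambda>t. snd (\<phi> t)) has_real_derivative d) (at t)))" ..
    then have N: "negligible N"
      "\<And>t. t \<in> {0..1} - N \<Longrightarrow> \<exists>d\<ge>0. ((\<lambda>t. fst (\<phi> t)) has_real_derivative d) (at t)"
      "\<And>t. t \<in> {0..1} - N \<Longrightarrow> \<exists>d\<ge>0. ((\<lambda>t. snd (\<phi> t)) has_real_derivative d) (at t)"
      by simp_all
    have ends: "\<phi> 0 = (0, 0)" "\<phi> 1 = x" and ac: "abs_continuous \<phi>"
      using \<phi> by (auto simp: admissible_def)
    obtain L where "L-lipschitz_on unit_square p" using real_polynomial_lipschitz[OF p(1)] by blast
    then have acp: "abs_continuous (\<lambda>t. p (\<phi> t))"
      by (rule abs_continuous_lipschitz_compose[OF ac]) (rule admissible_in_unit_square[OF \<phi> x])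
    have "\<exists>d. ((\<lambda>t. p (\<phi> t)) has_real_derivative d) (at t) \<and> ?e t \<le> d" if t: "t \<in> {0..1} - N" for t
    proof -
      obtain d1 d2 where d: "d1 \<ge> 0" "((\<lambda>t. fst (\<phi> t)) has_real_derivative d1) (at t)"
        "d2 \<ge> 0" "((\<lambda>t. snd (\<phi> t)) has_real_derivative d2) (at t)"
        using N(2,3)[OF t] by blast
      interpret lin: bounded_linear "p' (\<phi> t)" using p(2) by (rule has_derivative_bounded_linear)
      have "((\<lambda>t. (fst (\<phi> t), snd (\<phi> t))) has_derivative (\<lambda>h. (d1 * h, d2 * h))) (at t)"
        using d(2,4) unfolding has_field_derivative_def by (rule has_derivative_Pair)
      then have "(\<phi> has_derivative (\<lambda>h. h *\<^sub>R (d1, d2))) (at t)" by (simp add: mult.commute)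
      from has_derivative_compose[OF this p(2)]
      have "((\<lambda>t. p (\<phi> t)) has_derivative (\<lambda>h. h * p' (\<phi> t) (d1, d2))) (at t)"
        by (simp only: lin.scaleR real_scaleR_def)
      then have "((\<lambda>t. p (\<phi> t)) has_real_derivative p' (\<phi> t) (d1, d2)) (at t)"
        by (simp add: has_field_derivative_def mult.commute[of _ "p' (\<phi> t) (d1, d2)"])
      moreover have "?e t \<le> p' (\<phi> t) (d1, d2)"
        using super[of "\<phi> t" "(d1, d2)"] d admissible_in_unit_square[OF \<phi> x, of t] t
        by (simp add: DERIV_imp_deriv)
      ultimately show ?thesis by blast
    qed
    then have "energy f \<phi> \<le> p (\<phi> 1) - p (\<phi> 0)"
      by (intro abs_continuous_integral_le[OF acp _ _ _ int N(1)]) auto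
    moreover have "0 \<le> p (0, 0)" by (rule nonneg) (simp add: unit_square_def)
    ultimately show ?thesis by (simp add: ends)
  qed
qed

text \<open>The chain is traversed by straight segments, each in unit time, so \<open>T\<close>
  grows with the chain, and \<open>S\<close> collects the break points. The empty chain rests at the
  origin for time 1, which keeps \<open>T > 0\<close> for the later rescaling.\<close>

lemma chain_value_path:
  assumes F: "continuous_on UNIV F" "\<And>z. 0 \<le> F z"
  assumes "chain_value F y1 y2 a"
  shows "\<exists>T \<phi> D S L I. T > 0 \<and> finite S \<and> L-lipschitz_on {0..T} \<phi> \<and>
    \<phi> 0 = (0, 0) \<and> \<phi> T = (y1, y2) \<and>
    (\<forall>t\<in>{0..T} - S. (\<phi> has_vector_derivative D t) (at t) \<and> 0 \<le> fst (D t) \<and> 0 \<le> snd (D t)) \<and>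
    ((\<lambda>t. F (\<phi> t) * sqrt (fst (D t) * snd (D t))) has_integral I) {0..T} \<and> a \<le> I"
  using assms(3)
proof (induction rule: chain_value.induct)
  case origin
  show ?case
    by (rule exI[of _ 1], rule exI[of _ "\<lambda>_. (0, 0)"], rule exI[of _ "\<lambda>_. (0, 0)"],
        rule exI[of _ "{}"], rule exI[of _ 0], rule exI[of _ 0])
      (auto intro!: lipschitz_onI simp flip: zero_prod_def)
next
  case (step x1 x2 a y1 y2 m)
  then obtain T \<phi> D S L I where IH: "T > 0" "finite S" "L-lipschitz_on {0..T} \<phi>"
    "\<phi> 0 = (0, 0)" "\<phi> T = (x1, x2)"
    "\<forall>t\<in>{0..T} - S. (\<phi> has_vector_derivative D t) (at t) \<and> 0 \<le> fst (D t) \<and> 0 \<le> snd (D t)"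
    "((\<lambda>t. F (\<phi> t) * sqrt (fst (D t) * snd (D t))) has_integral I) {0..T}" "a \<le> I"
    by blast
  define d where "d = (y1 - x1, y2 - x2)"
  define seg where "seg t = (x1, x2) + (t - T) *\<^sub>R d" for t
  define \<phi>' where "\<phi>' t = (if t \<le> T then \<phi> t else seg t)" for t
  define D' where "D' t = (if t \<le> T then D t else d)" for t
  define S' where "S' = insert T S"
  have d: "0 \<le> fst d" "0 \<le> snd d" using step.hyps by (auto simp: d_def)
  have "(norm d)-lipschitz_on {T..T + 1} seg"
  proof (rule lipschitz_onI)
    show "dist (seg s) (seg t) \<le> norm d * dist s t" for s t
    proof -
      have "seg s - seg t = (s - t) *\<^sub>R d" by (simp add: seg_def algebra_simps)
      then show ?thesis by (simp add: dist_norm mult.commute)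
    qed
  qed simp
  then have lip: "(max L (norm d))-lipschitz_on {0..T + 1} \<phi>'"
    unfolding \<phi>'_def using IH(5) by (intro lipschitz_on_concat_max IH(3)) (auto simp: seg_def)
  have deriv: "(\<phi>' has_vector_derivative D' t) (at t) \<and> 0 \<le> fst (D' t) \<and> 0 \<le> snd (D' t)"
    if t: "t \<in> {0..T + 1} - S'" for t
  proof (cases "t < T")
    case True
    then have "t \<in> {0..T} - S" using t by (auto simp: S'_def)
    note IHt = bspec[OF IH(6) this]
    have "(\<phi>' has_vector_derivative D t) (at t)"
      by (rule has_vector_derivative_transform_within_open[OF _ open_lessThan[of T]])
        (use IHt True in \<open>auto simp: \<phi>'_def\<close>)
    then show ?thesis using IHt True by (simp add: D'_def)
  next
    case False
    then have T: "T < t" using t by (auto simp: S'_def)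
    have "(seg has_vector_derivative d) (at t)"
      unfolding seg_def by (auto intro!: derivative_eq_intros)
    then have "(\<phi>' has_vector_derivative d) (at t)"
      by (rule has_vector_derivative_transform_within_open[OF _ open_greaterThan[of T]])
        (use T in \<open>auto simp: \<phi>'_def\<close>)
    then show ?thesis using T d by (simp add: D'_def)
  qed
  let ?e = "\<lambda>t. F (\<phi>' t) * sqrt (fst (D' t) * snd (D' t))"
  let ?es = "\<lambda>t. F (seg t) * sqrt (fst d * snd d)"
  have "continuous_on {T..T + 1} ?es"
    unfolding seg_def by (intro continuous_intros continuous_on_compose2[OF F(1)]) auto
  then have es: "(?es has_integral integral {T..T + 1} ?es) {T..T + 1}"
    by (intro integrable_integral integrable_continuous_real)
  have "((\<lambda>_. m * sqrt (fst d * snd d)) has_integral m * sqrt (fst d * snd d)) {T..T + 1}"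
    using has_integral_const_real[of "m * sqrt (fst d * snd d)" T "T + 1"] by simp
  then have le: "m * sqrt (fst d * snd d) \<le> integral {T..T + 1} ?es"
  proof (rule has_integral_le[OF _ es])
    fix t assume t: "t \<in> {T..T + 1}"
    have "(t - T) * (y1 - x1) \<le> 1 * (y1 - x1)" "(t - T) * (y2 - x2) \<le> 1 * (y2 - x2)"
      using t step.hyps by (intro mult_right_mono; simp)+
    moreover have "0 \<le> (t - T) * (y1 - x1)" "0 \<le> (t - T) * (y2 - x2)"
      using t step.hyps by auto
    ultimately have "m \<le> F (seg t)"
      unfolding seg_def d_def by (auto intro!: step.hyps(5))
    then show "m * sqrt (fst d * snd d) \<le> ?es t" using d by (intro mult_right_mono) auto
  qed
  have "(?e has_integral I) {0..T}"
    by (rule has_integral_spike_finite[OF finite.emptyI _ IH(7)]) (auto simp: \<phi>'_def D'_def)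
  \<comment> \<open>At \<open>t = T\<close> the definitions by cases still follow the old path,
    hence the one exceptional point.\<close>
  moreover have "(?e has_integral integral {T..T + 1} ?es) {T..T + 1}"
    by (rule has_integral_spike_finite[of "{T}", OF _ _ es]) (auto simp: \<phi>'_def D'_def)
  ultimately have int: "(?e has_integral I + integral {T..T + 1} ?es) {0..T + 1}"
    using IH(1) by (intro has_integral_combine[where c = T]) auto
  have "a + m * sqrt ((y1 - x1) * (y2 - x2)) \<le> I + integral {T..T + 1} ?es"
    using le IH(8) by (simp add: d_def)
  moreover have "\<phi>' 0 = (0, 0)" "\<phi>' (T + 1) = (y1, y2)"
    using IH(1,4) by (auto simp: \<phi>'_def seg_def d_def)
  moreover have "T + 1 > 0" "finite S'" using IH(1,2) by (auto simp: S'_def)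
  ultimately show ?case using lip deriv int by blast
qed

lemma abs_continuous_lipschitz:
  assumes "L-lipschitz_on {0..1} \<phi>"
  shows "abs_continuous \<phi>"
proof -
  have "abs_continuous (\<lambda>t::real. t)"
    unfolding abs_continuous_def dist_real_def
  proof (intro allI impI)
    fix \<epsilon> :: real assume "\<epsilon> > 0"
    show "\<exists>\<delta>>0. \<forall>(n::nat) a b.
      (\<forall>i<n. 0 \<le> a i \<and> a i \<le> b i \<and> b i \<le> 1) \<longrightarrow>
      (\<forall>i<n. \<forall>j<n. i \<noteq> j \<longrightarrow> {a i<..<b i} \<inter> {a j<..<b j} = {}) \<longrightarrow>
      (\<Sum>i<n. b i - a i) < \<delta> \<longrightarrow> (\<Sum>i<n. \<bar>a i - b i\<bar>) < \<epsilon>"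
    proof (intro exI[of _ \<epsilon>] conjI allI impI \<open>\<epsilon> > 0\<close>)
      fix n :: nat and a b :: "nat \<Rightarrow> real"
      assume *: "\<forall>i<n. 0 \<le> a i \<and> a i \<le> b i \<and> b i \<le> 1" "(\<Sum>i<n. b i - a i) < \<epsilon>"
      have "(\<Sum>i<n. \<bar>a i - b i\<bar>) = (\<Sum>i<n. b i - a i)"
        using *(1) by (intro sum.cong) auto
      then show "(\<Sum>i<n. \<bar>a i - b i\<bar>) < \<epsilon>" using *(2) by simp
    qed
  qed
  from abs_continuous_lipschitz_compose[OF this assms] show ?thesis by simp
qed

text \<open>Rescaling time to the unit interval leaves the energy unchanged: the density is
  homogeneous of degree one in the velocity, and the factor \<open>T\<close> gained there cancels
  the one lost in the integration variable.\<close>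

lemma chain_value_admissible_path:
  assumes F: "continuous_on UNIV F" "\<And>z. 0 \<le> F z" "\<And>z. z \<in> unit_square \<Longrightarrow> F z = f z"
    and y: "(y1, y2) \<in> unit_square" and a: "chain_value F y1 y2 a"
  shows "\<exists>\<phi>\<in>admissible (y1, y2). a \<le> energy f \<phi>"
proof -
  obtain T \<phi> D S L I where *: "T > 0" "finite S" "L-lipschitz_on {0..T} \<phi>"
    "\<phi> 0 = (0, 0)" "\<phi> T = (y1, y2)"
    "\<forall>t\<in>{0..T} - S. (\<phi> has_vector_derivative D t) (at t) \<and> 0 \<le> fst (D t) \<and> 0 \<le> snd (D t)"
    "((\<lambda>t. F (\<phi> t) * sqrt (fst (D t) * snd (D t))) has_integral I) {0..T}" "a \<le> I"
    using chain_value_path[OF F(1,2) a] by blast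
  define \<psi> where "\<psi> s = \<phi> (T * s)" for s
  define S' where "S' = (\<lambda>t. t / T) ` S"
  have fS': "finite S'" using *(2) by (simp add: S'_def)
  have in_T: "T * s \<in> {0..T}" if "s \<in> {0..1}" for s
    using that *(1) by (auto simp: mult_le_cancel_left1)
  have der: "((\<lambda>t. fst (\<psi> t)) has_real_derivative T * fst (D (T * s))) (at s) \<and>
      ((\<lambda>t. snd (\<psi> t)) has_real_derivative T * snd (D (T * s))) (at s) \<and>
      0 \<le> fst (D (T * s)) \<and> 0 \<le> snd (D (T * s))"
    if s: "s \<in> {0..1} - S'" for s
  proof -
    have "T * s \<notin> S" using s *(1) by (force simp: S'_def image_iff)
    then have D: "(\<phi> has_vector_derivative D (T * s)) (at (T * s))"
      "0 \<le> fst (D (T * s)) \<and> 0 \<le> snd (D (T * s))"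
      using bspec[OF *(6), of "T * s"] in_T s by auto
    have "((\<lambda>s. T * s) has_derivative (\<lambda>h. T * h)) (at s)"
      by (auto intro!: derivative_eq_intros)
    from has_derivative_compose[OF this D(1)[unfolded has_vector_derivative_def]]
    have \<psi>: "(\<psi> has_derivative (\<lambda>h. (T * h) *\<^sub>R D (T * s))) (at s)"
      by (simp add: \<psi>_def[abs_def])
    have "((\<lambda>t. fst (\<psi> t)) has_derivative (*) (T * fst (D (T * s)))) (at s)"
      by (rule has_derivative_eq_rhs[OF has_derivative_fst[OF \<psi>]]) (auto simp: mult_ac)
    moreover have "((\<lambda>t. snd (\<psi> t)) has_derivative (*) (T * snd (D (T * s)))) (at s)"
      by (rule has_derivative_eq_rhs[OF has_derivative_snd[OF \<psi>]]) (auto simp: mult_ac)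
    ultimately show ?thesis using D(2) by (simp add: has_field_derivative_def)
  qed
  have "(L * T)-lipschitz_on {0..1} \<psi>"
  proof (rule lipschitz_onI)
    fix s t :: real assume st: "s \<in> {0..1}" "t \<in> {0..1}"
    have "dist (\<psi> s) (\<psi> t) \<le> L * dist (T * s) (T * t)"
      unfolding \<psi>_def by (rule lipschitz_onD[OF *(3)]) (use in_T st in auto)
    also have "dist (T * s) (T * t) = T * dist s t"
      using *(1) by (simp add: dist_real_def abs_mult flip: right_diff_distrib)
    finally show "dist (\<psi> s) (\<psi> t) \<le> L * T * dist s t" by (simp add: mult.assoc)
  qed (use *(1) lipschitz_on_nonneg[OF *(3)] in simp)
  then have "abs_continuous \<psi>" by (rule abs_continuous_lipschitz)
  moreover have "AE s in lebesgue. s \<in> {0..1} \<longrightarrow>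
        (\<exists>d\<ge>0. ((\<lambda>t. fst (\<psi> t)) has_real_derivative d) (at s)) \<and>
        (\<exists>d\<ge>0. ((\<lambda>t. snd (\<psi> t)) has_real_derivative d) (at s))"
  proof (rule AE_I'[of S'])
    show "S' \<in> null_sets lebesgue"
      using fS' by (simp add: negligible_finite flip: negligible_iff_null_sets)
    show "{s \<in> space lebesgue. \<not> (s \<in> {0..1} \<longrightarrow>
        (\<exists>d\<ge>0. ((\<lambda>t. fst (\<psi> t)) has_real_derivative d) (at s)) \<and>
        (\<exists>d\<ge>0. ((\<lambda>t. snd (\<psi> t)) has_real_derivative d) (at s)))} \<subseteq> S'"
    proof clarify
      fix s assume "s \<in> {0..1}" "s \<notin> S'"
      then have "s \<in> {0..1} - S'" by simp
      note d = der[OF this]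
      have "0 \<le> T * fst (D (T * s))" "0 \<le> T * snd (D (T * s))" using d *(1) by auto
      then show "(\<exists>d\<ge>0. ((\<lambda>t. fst (\<psi> t)) has_real_derivative d) (at s)) \<and>
        (\<exists>d\<ge>0. ((\<lambda>t. snd (\<psi> t)) has_real_derivative d) (at s))"
        using d by blast
    qed
  qed
  ultimately have adm: "\<psi> \<in> admissible (y1, y2)"
    using *(4,5) by (simp add: admissible_def \<psi>_def)
  let ?e = "\<lambda>t. f (\<psi> t) * sqrt (deriv (\<lambda>s. fst (\<psi> s)) t * deriv (\<lambda>s. snd (\<psi> s)) t)"
  let ?h = "\<lambda>s. F (\<phi> (T * s)) * sqrt (fst (D (T * s)) * snd (D (T * s)))"
  have "(\<lambda>x. x / T) ` {0..T} = {0..1}" using *(1) by (simp add: image_divide_atLeastAtMost)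
  with has_integral_stretch_real[OF *(7), of T] *(1)
  have "(?h has_integral (1 / T) * I) {0..1}" by simp
  from has_integral_mult_right[OF this, of T] *(1)
  have h: "((\<lambda>s. T * ?h s) has_integral I) {0..1}" by simp
  define e0 where "e0 s = (if s \<in> S' then 0 else T * ?h s)" for s
  have e0: "(e0 has_integral I) {0..1}"
    by (rule has_integral_spike_finite[OF fS' _ h]) (simp add: e0_def)
  have e_eq: "?e s = e0 s" if s: "s \<in> {0..1} - S'" for s
  proof -
    note d = der[OF s]
    have "f (\<psi> s) = F (\<phi> (T * s))"
      using F(3) admissible_in_unit_square[OF adm y, of s] s by (simp add: \<psi>_def)
    moreover have "sqrt ((T * fst (D (T * s))) * (T * snd (D (T * s)))) =
        T * sqrt (fst (D (T * s)) * snd (D (T * s)))"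
      using *(1) by (simp add: real_sqrt_mult mult_ac)
    moreover have "deriv (\<lambda>s. fst (\<psi> s)) s = T * fst (D (T * s))"
      "deriv (\<lambda>s. snd (\<psi> s)) s = T * snd (D (T * s))"
      using d by (simp_all add: DERIV_imp_deriv)
    ultimately show ?thesis using s by (simp add: e0_def)
  qed
  \<comment> \<open>Nonnegativity upgrades gauge integrability to Lebesgue integrability, in terms
    of which the energy is defined.\<close>
  have "e0 absolutely_integrable_on {0..1}"
  proof (rule nonnegative_absolutely_integrable_1)
    show "e0 integrable_on {0..1}" using e0 by blast
    show "0 \<le> e0 s" if "s \<in> {0..1}" for s
      using that der[of s] F(2) *(1) by (auto simp: e0_def)
  qed
  then have "?e absolutely_integrable_on {0..1}"
    by (rule absolutely_integrable_spike[OF _ negligible_finite[OF fS']]) (rule e_eq)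
  then have "energy f \<psi> = integral {0..1} ?e"
    unfolding energy_def by (rule set_lebesgue_integral_eq_integral)
  also have "\<dots> = integral {0..1} e0"
    by (rule integral_spike[OF negligible_finite[OF fS']]) (use e_eq in auto)
  also have "\<dots> = I" using e0 by (rule integral_unique)
  finally show ?thesis using adm *(8) by auto
qed

subsection \<open>Polynomial supersolutions\<close>

text \<open>An iterated integral, so that the one-dimensional fundamental theorem applies in either
  coordinate once the order of integration is swapped.\<close>

definition square_integral :: "real \<Rightarrow> (real \<times> real \<Rightarrow> real) \<Rightarrow> real" where
  "square_integral \<delta> h = integral {0..\<delta>} (\<lambda>s. integral {0..\<delta>} (\<lambda>t. h (s, t)))"

lemma continuous_on_integral_section:
  fixes h :: "real \<times> real \<Rightarrow> real"
  assumes "continuous_on UNIV h"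
  shows "continuous_on S (\<lambda>x. integral {0..\<delta>} (\<lambda>t. h (fst x, snd x + t)))"
    and "continuous_on S (\<lambda>x. integral {0..\<delta>} (\<lambda>s. h (fst x + s, snd x)))"
proof -
  have "continuous_on (S \<times> cbox 0 \<delta>) (\<lambda>(x, t). h (fst x, snd x + t))"
    "continuous_on (S \<times> cbox 0 \<delta>) (\<lambda>(x, t). h (fst x + t, snd x))"
    unfolding case_prod_beta by (intro continuous_on_compose2[OF assms] continuous_intros; simp)+
  from this[THEN integral_continuous_on_param]
  show "continuous_on S (\<lambda>x. integral {0..\<delta>} (\<lambda>t. h (fst x, snd x + t)))"
    "continuous_on S (\<lambda>x. integral {0..\<delta>} (\<lambda>s. h (fst x + s, snd x)))"
    by simp_all
qed

lemma square_integral_integrable: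
  fixes h :: "real \<times> real \<Rightarrow> real"
  assumes "continuous_on UNIV h"
  shows "(\<lambda>t. h (s, t)) integrable_on {0..\<delta>}"
    and "(\<lambda>s. integral {0..\<delta>} (\<lambda>t. h (s, t))) integrable_on {0..\<delta>}"
proof -
  have "continuous_on {0..\<delta>} (\<lambda>t. h (s, t))"
    by (intro continuous_on_compose2[OF assms] continuous_intros) auto
  then show "(\<lambda>t. h (s, t)) integrable_on {0..\<delta>}" by (rule integrable_continuous_real)
  have "continuous_on {0..\<delta>} (\<lambda>s. integral {0..\<delta>} (\<lambda>t. h (fst (s, 0::real), snd (s, 0::real) + t)))"
    by (rule continuous_on_compose2[OF continuous_on_integral_section(1)[OF assms, of UNIV]])
      (auto intro!: continuous_intros)
  then show "(\<lambda>s. integral {0..\<delta>} (\<lambda>t. h (s, t))) integrable_on {0..\<delta>}"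
    by (simp add: integrable_continuous_real)
qed

lemma square_integral_add:
  assumes "continuous_on UNIV h" "continuous_on UNIV k"
  shows "square_integral \<delta> (\<lambda>z. h z + k z) = square_integral \<delta> h + square_integral \<delta> k"
  unfolding square_integral_def
  by (simp add: integral_add square_integral_integrable assms)

lemma square_integral_cmult: "square_integral \<delta> (\<lambda>z. c * h z) = c * square_integral \<delta> h"
  unfolding square_integral_def by simp

lemma square_integral_const: "\<delta> \<ge> 0 \<Longrightarrow> square_integral \<delta> (\<lambda>_. c) = \<delta>\<^sup>2 * c"
  unfolding square_integral_def by (simp add: power2_eq_square)

lemma square_integral_mono:
  assumes "continuous_on UNIV h" "continuous_on UNIV k"
    "\<And>s t. 0 \<le> s \<Longrightarrow> s \<le> \<delta> \<Longrightarrow> 0 \<le> t \<Longrightarrow> t \<le> \<delta> \<Longrightarrow> h (s, t) \<le> k (s, t)"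
  shows "square_integral \<delta> h \<le> square_integral \<delta> k"
  unfolding square_integral_def
  by (intro integral_le square_integral_integrable assms) (use assms in auto)

lemma square_integral_swap:
  assumes "continuous_on UNIV h"
  shows "square_integral \<delta> h = integral {0..\<delta>} (\<lambda>t. integral {0..\<delta>} (\<lambda>s. h (s, t)))"
  unfolding square_integral_def
  using integral_swap_continuous[of 0 0 \<delta> \<delta> "\<lambda>s t. h (s, t)"] continuous_on_subset[OF assms]
  by simp

text \<open>Separating \<open>x\<close> from \<open>z\<close> turns an integral over
  \<open>z\<close> into a combination, with constant coefficients, of polynomials in
  \<open>x\<close>.\<close>

lemma real_polynomial_shift_decomposition:
  fixes p :: "'a::real_normed_vector \<Rightarrow> real"
  assumes "real_polynomial_function p"
  shows "\<exists>cs. (\<forall>(c, d)\<in>set cs. real_polynomial_function c \<and> real_polynomial_function d) \<and>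
    (\<forall>x z. p (x + z) = (\<Sum>(c, d)\<leftarrow>cs. c x * d z))"
  using assms
proof induction
  case (linear h)
  have "h (x + z) = h x + h z" for x z
    using linear by (simp add: bounded_linear.linear linear_add)
  then show ?case
    using linear by (intro exI[of _ "[(h, \<lambda>_. 1), (\<lambda>_. 1, h)]"]) auto
next
  case (const c)
  show ?case by (intro exI[of _ "[(\<lambda>_. c, \<lambda>_. 1)]"]) auto
next
  case (add f g)
  then obtain cs ds where
    "\<forall>(c, d)\<in>set cs. real_polynomial_function c \<and> real_polynomial_function d"
    "\<forall>x z. f (x + z) = (\<Sum>(c, d)\<leftarrow>cs. c x * d z)"
    "\<forall>(c, d)\<in>set ds. real_polynomial_function c \<and> real_polynomial_function d"
    "\<forall>x z. g (x + z) = (\<Sum>(c, d)\<leftarrow>ds. c x * d z)"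
    by blast
  then show ?case by (intro exI[of _ "cs @ ds"]) auto
next
  case (mult f g)
  then obtain cs ds where *:
    "\<forall>(c, d)\<in>set cs. real_polynomial_function c \<and> real_polynomial_function d"
    "\<forall>x z. f (x + z) = (\<Sum>(c, d)\<leftarrow>cs. c x * d z)"
    "\<forall>(c, d)\<in>set ds. real_polynomial_function c \<and> real_polynomial_function d"
    "\<forall>x z. g (x + z) = (\<Sum>(c, d)\<leftarrow>ds. c x * d z)"
    by blast
  define es where "es = concat (map (\<lambda>(c, d). map (\<lambda>(c', d').
    (\<lambda>x. c x * c' x, \<lambda>z. d z * d' z)) ds) cs)"
  have "(\<Sum>(c, d)\<leftarrow>es. c x * d z) = (\<Sum>(c, d)\<leftarrow>cs. c x * d z) * (\<Sum>(c, d)\<leftarrow>ds. c x * d z)" for x z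
    unfolding es_def
  proof (induction cs)
    case (Cons a cs)
    have "(\<Sum>b\<leftarrow>ds. fst a x * fst b x * (snd a z * snd b z)) =
      fst a x * snd a z * (\<Sum>b\<leftarrow>ds. fst b x * snd b z)"
      by (induction ds) (auto simp: algebra_simps)
    with Cons show ?case
      by (simp add: case_prod_beta o_def distrib_right)
  qed simp
  moreover have "\<forall>(c, d)\<in>set es. real_polynomial_function c \<and> real_polynomial_function d"
    using *(1,3) by (fastforce simp: es_def intro: real_polynomial_function.intros(4))
  ultimately show ?case using *(2,4) by (intro exI[of _ es]) simp
qed

text \<open>The window lies above and to the right of \<open>x\<close>, so for \<open>x\<close> in
  the unit square it never involves negative coordinates, where clamping can destroy
  superadditivity.\<close>

definition box_integral :: "real \<Rightarrow> (real \<times> real \<Rightarrow> real) \<Rightarrow> real \<times> real \<Rightarrow> real" where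
  "box_integral \<delta> G x = square_integral \<delta> (\<lambda>z. G (x + z))"

lemma real_polynomial_box_integral:
  assumes "real_polynomial_function p"
  shows "real_polynomial_function (box_integral \<delta> p)"
proof -
  obtain cs where cs: "\<forall>(c, d)\<in>set cs. real_polynomial_function c \<and> real_polynomial_function d"
    "\<forall>x z. p (x + z) = (\<Sum>(c, d)\<leftarrow>cs. c x * d z)"
    using real_polynomial_shift_decomposition[OF assms] by blast
  have cont: "continuous_on UNIV (\<lambda>z. \<Sum>(c, d)\<leftarrow>ds. c x * d z)"
    if "\<forall>(c, d)\<in>set ds. real_polynomial_function c \<and> real_polynomial_function d"
    for ds :: "((real \<times> real \<Rightarrow> real) \<times> (real \<times> real \<Rightarrow> real)) list" and x
    using that
  proof (induction ds)
    case (Cons a ds)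
    then have "continuous_on UNIV (\<lambda>z. fst a x * snd a z)"
      by (intro continuous_on_mult_left real_polynomial_continuous) auto
    with Cons show ?case
      using continuous_on_add[of UNIV "\<lambda>z. fst a x * snd a z" "\<lambda>z. \<Sum>b\<leftarrow>ds. fst b x * snd b z"]
      by (simp add: case_prod_beta)
  qed simp
  have "real_polynomial_function (\<lambda>x. square_integral \<delta> (\<lambda>z. \<Sum>(c, d)\<leftarrow>cs. c x * d z))"
    using cs(1)
  proof (induction cs)
    case Nil
    have "square_integral \<delta> (\<lambda>z. 0) = 0" by (simp add: square_integral_def)
    then show ?case by (simp add: real_polynomial_function.intros(2))
  next
    case (Cons a ds)
    obtain c d where a: "a = (c, d)" by fastforce
    have rp: "real_polynomial_function c" "real_polynomial_function d"
      "\<forall>(c, d)\<in>set ds. real_polynomial_function c \<and> real_polynomial_function d"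
      using Cons.prems a by auto
    have "square_integral \<delta> (\<lambda>z. \<Sum>(c, d)\<leftarrow>a # ds. c x * d z) =
      c x * square_integral \<delta> d + square_integral \<delta> (\<lambda>z. \<Sum>(c, d)\<leftarrow>ds. c x * d z)" for x
      using square_integral_add[of "\<lambda>z. c x * d z" "\<lambda>z. \<Sum>(c, d)\<leftarrow>ds. c x * d z" \<delta>] cont[OF rp(3), of x] rp(2)
      by (simp add: a square_integral_cmult real_polynomial_continuous continuous_on_mult_left)
    moreover have "real_polynomial_function (\<lambda>x. c x * square_integral \<delta> d +
        square_integral \<delta> (\<lambda>z. \<Sum>(c, d)\<leftarrow>ds. c x * d z))"
      using rp Cons.IH by (intro real_polynomial_function.intros(3,4)) auto
    ultimately show ?case by presburger
  qed
  then show ?thesis by (simp only: box_integral_def[abs_def] cs(2)[rule_format])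
qed

lemma sliding_integral_derivative:
  fixes h :: "real \<Rightarrow> real"
  assumes h: "continuous_on UNIV h" and \<delta>: "\<delta> \<ge> 0"
  shows "((\<lambda>x. integral {0..\<delta>} (\<lambda>s. h (x + s))) has_real_derivative h (x + \<delta>) - h x) (at x)"
proof -
  \<comment> \<open>The base point \<open>x - 1\<close> makes \<open>P\<close> an antiderivative on
    a whole neighbourhood of \<open>x\<close>.\<close>
  define P where "P y = integral {x - 1..y} h" for y
  have P: "(P has_real_derivative h y) (at y)" if "x - 1 < y" for y
  proof -
    have "(P has_real_derivative h y) (at y within {x - 1..y + 1})"
      unfolding P_def using that
      by (intro integral_has_real_derivative continuous_on_subset[OF h]) auto
    then show ?thesis
      using that by (simp add: at_within_Icc_at)
  qed
  have eq: "integral {0..\<delta>} (\<lambda>s. h (y + s)) = P (y + \<delta>) - P y" if "x - 1 < y" for y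
  proof (rule integral_unique)
    have "((\<lambda>s. h (y + s)) has_integral P (y + \<delta>) - P (y + 0)) {0..\<delta>}"
    proof (rule fundamental_theorem_of_calculus[OF \<delta>])
      fix s assume s: "s \<in> {0..\<delta>}"
      have "((\<lambda>s. P (y + s)) has_real_derivative h (y + s) * 1) (at s)"
        by (rule DERIV_chain2[OF P]) (use s that in \<open>auto intro!: derivative_eq_intros\<close>)
      then show "((\<lambda>s. P (y + s)) has_vector_derivative h (y + s)) (at s within {0..\<delta>})"
        by (simp add: has_real_derivative_iff_has_vector_derivative has_vector_derivative_at_within)
    qed
    then show "((\<lambda>s. h (y + s)) has_integral P (y + \<delta>) - P y) {0..\<delta>}" by simp
  qed
  have "((\<lambda>y. P (y + \<delta>)) has_real_derivative h (x + \<delta>) * 1) (at x)"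
    by (rule DERIV_chain2[OF P]) (use \<delta> in \<open>auto intro!: derivative_eq_intros\<close>)
  then have "((\<lambda>y. P (y + \<delta>) - P y) has_real_derivative h (x + \<delta>) - h x) (at x)"
    using P[of x] by (intro DERIV_diff) auto
  then show ?thesis
    by (rule has_field_derivative_transform_within_open[OF _ open_greaterThan[of "x - 1"]])
      (simp_all add: eq)
qed

text \<open>Averaging over a square makes a continuous function differentiable, and the derivative
  involves the values of the function only.\<close>

definition box_gradient ::
  "real \<Rightarrow> (real \<times> real \<Rightarrow> real) \<Rightarrow> real \<times> real \<Rightarrow> real \<times> real \<Rightarrow> real" where
  "box_gradient \<delta> G x v =
    fst v * (integral {0..\<delta>} (\<lambda>t. G (fst x + \<delta>, snd x + t)) - integral {0..\<delta>} (\<lambda>t. G (fst x, snd x + t))) +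
    snd v * (integral {0..\<delta>} (\<lambda>s. G (fst x + s, snd x + \<delta>)) - integral {0..\<delta>} (\<lambda>s. G (fst x + s, snd x)))"

text \<open>In each coordinate the box integral is a sliding integral of a continuous edge integral,
  in the second after swapping the order. Existence of both partial derivatives and continuity of
  one give total differentiability.\<close>

lemma box_integral_has_derivative:
  assumes G: "continuous_on UNIV G" and \<delta>: "\<delta> \<ge> 0"
  shows "(box_integral \<delta> G has_derivative box_gradient \<delta> G x) (at x)"
proof -
  define K1 where "K1 a b = integral {0..\<delta>} (\<lambda>t. G (a, b + t))" for a b
  define K2 where "K2 a b = integral {0..\<delta>} (\<lambda>s. G (a + s, b))" for a b
  define V where "V a b = box_integral \<delta> G (a, b)" for a b
  have K: "continuous_on UNIV (\<lambda>z. K1 (fst z) (snd z))" "continuous_on UNIV (\<lambda>z. K2 (fst z) (snd z))"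
    unfolding K1_def K2_def using continuous_on_integral_section[OF G] by blast+
  have shift: "continuous_on UNIV (\<lambda>z. G (x + z))" for x
    by (intro continuous_on_compose2[OF G] continuous_intros) auto
  have V1: "V a b = integral {0..\<delta>} (\<lambda>s. K1 (a + s) b)" for a b
    by (simp add: V_def box_integral_def square_integral_def K1_def)
  have V2: "V a b = integral {0..\<delta>} (\<lambda>t. K2 a (b + t))" for a b
    unfolding V_def box_integral_def square_integral_swap[OF shift] by (simp add: K2_def)
  have d1: "((\<lambda>a. V a b) has_derivative (*) (K1 (a + \<delta>) b - K1 a b)) (at a)" for a b
  proof -
    have "continuous_on UNIV (\<lambda>a. K1 a b)"
      using continuous_on_compose2[OF K(1), of UNIV "\<lambda>a. (a, b)"] by (simp add: continuous_intros)
    from sliding_integral_derivative[OF this \<delta>] show ?thesis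
      by (simp add: V1 has_field_derivative_def)
  qed
  have d2: "((\<lambda>b. V a b) has_derivative (*) (K2 a (b + \<delta>) - K2 a b)) (at b)" for a b
  proof -
    have "continuous_on UNIV (\<lambda>b. K2 a b)"
      using continuous_on_compose2[OF K(2), of UNIV "\<lambda>b. (a, b)"] by (simp add: continuous_intros)
    from sliding_integral_derivative[OF this \<delta>] show ?thesis
      by (simp add: V2 has_field_derivative_def)
  qed
  \<comment> \<open>The differentiability criterion asks for this partial derivative as a continuous
    map into bounded linear operators.\<close>
  define fy where "fy a b = (K2 a (b + \<delta>) - K2 a b) *\<^sub>R (id_blinfun :: real \<Rightarrow>\<^sub>L real)" for a b
  have K2': "continuous_on UNIV (\<lambda>z. K2 (fst z) (snd z + \<delta>))"
    using continuous_on_compose2[OF K(2), of UNIV "\<lambda>z. (fst z, snd z + \<delta>)"] by (simp add: continuous_intros)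
  have "continuous_on UNIV (\<lambda>(a, b). fy a b)"
    unfolding fy_def case_prod_beta by (intro continuous_intros K(2) K2')
  then have "continuous (at z) (\<lambda>(a, b). fy a b)" for z
    unfolding continuous_on_eq_continuous_at[OF open_UNIV] by blast
  then have "((\<lambda>(a, b). V a b) has_derivative
    (\<lambda>(ta, tb). (K1 (fst x + \<delta>) (snd x) - K1 (fst x) (snd x)) * ta + fy (fst x) (snd x) tb))
      (at (fst x, snd x) within UNIV \<times> UNIV)"
  proof (intro has_derivative_partialsI d1)
    show "((\<lambda>b. V a b) has_derivative blinfun_apply (fy a b)) (at b)" for a b
      by (rule has_derivative_eq_rhs[OF d2]) (auto simp: fy_def blinfun.scaleR_left)
  qed auto
  moreover have "(\<lambda>(a, b). V a b) = box_integral \<delta> G" by (auto simp: V_def)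
  moreover have "(\<lambda>(ta, tb). (K1 (fst x + \<delta>) (snd x) - K1 (fst x) (snd x)) * ta +
      fy (fst x) (snd x) tb) = box_gradient \<delta> G x"
    by (auto simp: box_gradient_def K1_def K2_def fy_def blinfun.scaleR_left fun_eq_iff)
  ultimately show ?thesis by simp
qed

lemma directional_derivative_ge:
  assumes V: "(V has_derivative V') (at x)" and \<kappa>0: "\<kappa>0 > 0"
    and le: "\<And>\<kappa>. 0 < \<kappa> \<Longrightarrow> \<kappa> < \<kappa>0 \<Longrightarrow> V x + \<kappa> * c \<le> V (x + \<kappa> *\<^sub>R v)"
  shows "c \<le> V' v"
proof (rule ccontr)
  assume "\<not> c \<le> V' v"
  interpret lin: bounded_linear V' using V by (rule has_derivative_bounded_linear)
  have 1: "((\<lambda>\<kappa>. x + \<kappa> *\<^sub>R v) has_derivative (\<lambda>\<kappa>. \<kappa> *\<^sub>R v)) (at (0::real))"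
    by (auto intro!: derivative_eq_intros)
  have "(V has_derivative V') (at (x + 0 *\<^sub>R v))" using V by simp
  from has_derivative_compose[OF 1 this]
  have "((\<lambda>\<kappa>. V (x + \<kappa> *\<^sub>R v)) has_real_derivative V' v) (at 0)"
    by (simp add: has_field_derivative_def lin.scaleR mult.commute[of _ "V' v"])
  then have "((\<lambda>\<kappa>. V (x + \<kappa> *\<^sub>R v) - \<kappa> * c) has_real_derivative V' v - 1 * c) (at 0)"
    by (auto intro!: derivative_eq_intros)
  moreover have "V' v - 1 * c < 0" using \<open>\<not> c \<le> V' v\<close> by simp
  ultimately obtain d where d: "d > 0" "\<And>h. 0 < h \<Longrightarrow> h < d \<Longrightarrow>
      V (x + (0 + h) *\<^sub>R v) - (0 + h) * c < V (x + 0 *\<^sub>R v) - 0 * c"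
    using DERIV_neg_dec_right[of "\<lambda>\<kappa>. V (x + \<kappa> *\<^sub>R v) - \<kappa> * c" "V' v - 1 * c" 0] by blast
  define h where "h = min d \<kappa>0 / 2"
  have "0 < h" "h < d" "h < \<kappa>0" using d(1) \<kappa>0 by (auto simp: h_def min_def)
  then show False using d(2)[of h] le[of h] by simp
qed

text \<open>Only values on the edges of the window enter the gradient, so uniform closeness
  suffices: every edge integral changes by at most \<open>\<delta> * \<eta>\<close>, and each
  coordinate involves two edges.\<close>

lemma box_gradient_close:
  assumes G: "continuous_on UNIV G" and H: "continuous_on UNIV H" and \<delta>: "0 \<le> \<delta>" "\<delta> \<le> 1"
    and close: "\<And>z. z \<in> {0..2} \<times> {0..2} \<Longrightarrow> \<bar>G z - H z\<bar> \<le> \<eta>"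
    and x: "x \<in> unit_square" and v: "0 \<le> fst v" "0 \<le> snd v"
  shows "box_gradient \<delta> H x v - (fst v + snd v) * (2 * \<delta> * \<eta>) \<le> box_gradient \<delta> G x v"
proof -
  have edge: "\<bar>integral {0..\<delta>} (\<lambda>t. G (p t)) - integral {0..\<delta>} (\<lambda>t. H (p t))\<bar> \<le> \<delta> * \<eta>"
    if p: "continuous_on UNIV p" "\<And>t. t \<in> {0..\<delta>} \<Longrightarrow> p t \<in> {0..2} \<times> {0..2}" for p
  proof -
    have int: "(\<lambda>t. G (p t)) integrable_on {0..\<delta>}" "(\<lambda>t. H (p t)) integrable_on {0..\<delta>}"
      by (intro integrable_continuous_real continuous_on_compose2[OF G] continuous_on_compose2[OF H]
          continuous_on_subset[OF p(1)]; simp)+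
    have "norm (integral {0..\<delta>} (\<lambda>t. G (p t) - H (p t))) \<le> \<eta> * (\<delta> - 0)"
      by (rule integral_bound) (use \<delta> close p in \<open>auto intro!: continuous_intros
        continuous_on_compose2[OF G] continuous_on_compose2[OF H] continuous_on_subset[OF p(1)]\<close>)
    then show ?thesis using int by (simp add: integral_diff mult.commute)
  qed
  have x': "0 \<le> fst x" "fst x \<le> 1" "0 \<le> snd x" "snd x \<le> 1" using x by (auto simp: unit_square_def)
  let ?E1 = "\<lambda>G. integral {0..\<delta>} (\<lambda>t. G (fst x + \<delta>, snd x + t)) - integral {0..\<delta>} (\<lambda>t. G (fst x, snd x + t))"
  let ?E2 = "\<lambda>G. integral {0..\<delta>} (\<lambda>s. G (fst x + s, snd x + \<delta>)) - integral {0..\<delta>} (\<lambda>s. G (fst x + s, snd x))"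
  have "?E1 H - 2 * \<delta> * \<eta> \<le> ?E1 G"
    using edge[of "\<lambda>t. (fst x + \<delta>, snd x + t)"] edge[of "\<lambda>t. (fst x, snd x + t)"] x' \<delta>
    by (auto simp: continuous_intros abs_le_iff)
  moreover have "?E2 H - 2 * \<delta> * \<eta> \<le> ?E2 G"
    using edge[of "\<lambda>t. (fst x + t, snd x + \<delta>)"] edge[of "\<lambda>t. (fst x + t, snd x)"] x' \<delta>
    by (auto simp: continuous_intros abs_le_iff)
  ultimately have "fst v * (?E1 H - 2 * \<delta> * \<eta>) + snd v * (?E2 H - 2 * \<delta> * \<eta>) \<le> fst v * ?E1 G + snd v * ?E2 G"
    using v by (intro add_mono mult_left_mono)
  then show ?thesis unfolding box_gradient_def by (simp add: algebra_simps)
qed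

context running_cost
begin

lemma clamped_sup_superadditive:
  assumes "0 \<le> fst x" "0 \<le> snd x" "0 \<le> fst v" "0 \<le> snd v" "fst x + fst v \<le> 2" "snd x + snd v \<le> 2" "0 \<le> m"
    and "\<And>z1 z2. fst x \<le> z1 \<Longrightarrow> z1 \<le> fst x + fst v \<Longrightarrow> snd x \<le> z2 \<Longrightarrow> z2 \<le> snd x + snd v \<Longrightarrow> m \<le> F (z1, z2)"
  shows "clamped_sup x + m * sqrt (fst v * snd v) \<le> clamped_sup (x + v)"
proof -
  have "min 2 (fst x) = fst x" "min 2 (snd x) = snd x" using assms by auto
  then show ?thesis
    using chain_sup_superadditive[of "fst x" "snd x" "fst x + fst v" "snd x + snd v" m] assms
    by (simp add: clamped_sup_def)
qed

text \<open>Superadditivity holds for every shift in the window, hence for the integral, and the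
  difference quotient passes it on to the derivative. The margin \<open>2 * \<delta>\<close> for
  \<open>F\<close> allows for the shift and for the displacement
  \<open>\<kappa> *\<^sub>R v\<close>, each at most \<open>\<delta>\<close> per coordinate.\<close>

lemma box_gradient_clamped_sup_ge:
  assumes x: "x \<in> unit_square" and v: "0 \<le> fst v" "0 \<le> snd v" and \<delta>: "0 < \<delta>" "\<delta> \<le> 1 / 2" and m: "0 \<le> m"
    and F: "\<And>z. fst x \<le> fst z \<Longrightarrow> fst z \<le> fst x + 2 * \<delta> \<Longrightarrow> snd x \<le> snd z \<Longrightarrow> snd z \<le> snd x + 2 * \<delta> \<Longrightarrow> m \<le> F z"
  shows "\<delta>\<^sup>2 * (m * sqrt (fst v * snd v)) \<le> box_gradient \<delta> clamped_sup x v"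
proof (rule directional_derivative_ge[where V = "box_integral \<delta> clamped_sup" and x = x])
  show "(box_integral \<delta> clamped_sup has_derivative box_gradient \<delta> clamped_sup x) (at x)"
    using \<delta> by (intro box_integral_has_derivative clamped_sup_continuous) auto
  define \<kappa>0 where "\<kappa>0 = \<delta> / (fst v + snd v + 1)"
  show "\<kappa>0 > 0" using \<delta> v by (simp add: \<kappa>0_def)
  fix \<kappa> assume \<kappa>: "0 < \<kappa>" "\<kappa> < \<kappa>0"
  have "\<kappa> * (fst v + snd v + 1) < \<delta>" using \<kappa>(2) v by (simp add: \<kappa>0_def pos_less_divide_eq)
  moreover have "0 \<le> \<kappa> * fst v" "0 \<le> \<kappa> * snd v" using \<kappa> v by auto
  ultimately have \<kappa>v: "\<kappa> * fst v \<le> \<delta>" "\<kappa> * snd v \<le> \<delta>" "0 \<le> \<kappa> * fst v" "0 \<le> \<kappa> * snd v"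
    using \<kappa>(1) by (simp_all add: algebra_simps)
  have x': "0 \<le> fst x" "fst x \<le> 1" "0 \<le> snd x" "snd x \<le> 1" using x by (auto simp: unit_square_def)
  have shift: "continuous_on UNIV (\<lambda>z. clamped_sup (y + z))" for y
    by (intro continuous_on_compose2[OF clamped_sup_continuous] continuous_intros) auto
  have sq: "sqrt ((\<kappa> * fst v) * (\<kappa> * snd v)) = \<kappa> * sqrt (fst v * snd v)"
    using \<kappa>(1) by (simp add: real_sqrt_mult mult_ac)
  have "square_integral \<delta> (\<lambda>z. clamped_sup (x + z) + m * (\<kappa> * sqrt (fst v * snd v)))
    \<le> square_integral \<delta> (\<lambda>z. clamped_sup (x + \<kappa> *\<^sub>R v + z))"
  proof (rule square_integral_mono)
    show "continuous_on UNIV (\<lambda>z. clamped_sup (x + z) + m * (\<kappa> * sqrt (fst v * snd v)))"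
      by (intro continuous_intros shift)
    fix s t assume st: "0 \<le> s" "s \<le> \<delta>" "0 \<le> t" "t \<le> \<delta>"
    have "clamped_sup (x + (s, t)) + m * sqrt (fst (\<kappa> *\<^sub>R v) * snd (\<kappa> *\<^sub>R v))
      \<le> clamped_sup (x + (s, t) + \<kappa> *\<^sub>R v)"
      by (rule clamped_sup_superadditive) (use st \<kappa>v x' \<delta> m in \<open>auto intro!: F\<close>)
    then show "clamped_sup (x + (s, t)) + m * (\<kappa> * sqrt (fst v * snd v)) \<le> clamped_sup (x + \<kappa> *\<^sub>R v + (s, t))"
      by (simp add: sq add_ac)
  qed (rule shift)
  then show "box_integral \<delta> clamped_sup x + \<kappa> * (\<delta>\<^sup>2 * (m * sqrt (fst v * snd v)))
    \<le> box_integral \<delta> clamped_sup (x + \<kappa> *\<^sub>R v)"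
    using \<delta>(1) square_integral_add[OF shift[of x] continuous_on_const, of \<delta> "m * (\<kappa> * sqrt (fst v * snd v))"]
    by (simp add: box_integral_def square_integral_const mult_ac)
qed

text \<open>Approximating first and averaging afterwards keeps the function polynomial, while
  uniform closeness still controls its gradient. A linear term repairs the errors in the inequality
  and leaves slack.\<close>

lemma polynomial_supersolution:
  assumes F_cont: "continuous_on UNIV F" and \<epsilon>: "\<epsilon> > 0"
  shows "\<exists>p p' \<eta>. real_polynomial_function p \<and> (\<forall>x. (p has_derivative p' x) (at x)) \<and> \<eta> > 0 \<and>
    (\<forall>x\<in>unit_square. \<forall>v. 0 \<le> fst v \<longrightarrow> 0 \<le> snd v \<longrightarrow>
      F x * sqrt (fst v * snd v) + \<eta> * (fst v + snd v) \<le> p' x v) \<and>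
    (\<forall>x\<in>unit_square. 0 \<le> p x \<and> p x \<le> chain_sup (fst x) (snd x) + \<epsilon>)"
proof -
  \<comment> \<open>The excess over \<open>chain_sup\<close> on the square is at most
    \<open>2 * e\<close> from averaging and approximation, \<open>6 * e\<close> from the linear term
    and \<open>e\<close> from the constant.\<close>
  define e where "e = \<epsilon> / 9"
  have e: "e > 0" using \<epsilon> by (simp add: e_def)
  let ?Q = "cbox (0::real, 0::real) (2, 2)"
  have Q: "?Q = {0..2} \<times> {0..2}" by (simp add: cbox_Pair_eq)
  have "uniformly_continuous_on ?Q F"
    using continuous_on_subset[OF F_cont] by (intro compact_uniformly_continuous compact_cbox) auto
  then obtain d where d: "d > 0" "\<And>x y. x \<in> ?Q \<Longrightarrow> y \<in> ?Q \<Longrightarrow> dist y x < d \<Longrightarrow> dist (F y) (F x) < e"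
    using e unfolding uniformly_continuous_on_def by metis
  \<comment> \<open>Chosen so that \<open>M * sqrt (2 * \<rho>) \<le> e / 2\<close>; moving within
    the window then raises \<open>clamped_sup\<close> by at most \<open>e\<close>.\<close>
  define \<rho> where "\<rho> = (e / (2 * (M + 1)))\<^sup>2 / 2"
  have \<rho>: "\<rho> > 0" using e M_nonneg by (simp add: \<rho>_def)
  define \<delta> where "\<delta> = min (1 / 2) (min (d / 8) \<rho>)"
  have \<delta>: "0 < \<delta>" "\<delta> \<le> 1 / 2" "\<delta> \<le> d / 8" "\<delta> \<le> \<rho>" using d(1) \<rho> by (auto simp: \<delta>_def)
  have M\<delta>: "M * sqrt (2 * \<delta>) \<le> e / 2"
  proof -
    have "sqrt (2 * \<delta>) \<le> sqrt ((e / (2 * (M + 1)))\<^sup>2)"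
      using \<delta>(4) by (intro real_sqrt_le_mono) (simp add: \<rho>_def)
    also have "\<dots> = e / (2 * (M + 1))" using e M_nonneg by simp
    finally have "M * sqrt (2 * \<delta>) \<le> (M + 1) * (e / (2 * (M + 1)))"
      using M_nonneg e \<delta> by (intro mult_mono) auto
    also have "\<dots> = e / 2" using M_nonneg by (simp add: divide_simps)
    finally show ?thesis .
  qed
  \<comment> \<open>Normalising by \<open>\<delta>\<^sup>2\<close> turns the gradient error
    \<open>2 * \<delta> * \<eta>\<close> into \<open>e\<close>.\<close>
  define \<eta> where "\<eta> = e * \<delta> / 2"
  have \<eta>: "\<eta> > 0" "\<eta> \<le> e" using e \<delta> by (auto simp: \<eta>_def mult_le_cancel_left1)
  obtain w where w: "real_polynomial_function w" "\<And>x. x \<in> ?Q \<Longrightarrow> \<bar>clamped_sup x - w x\<bar> < \<eta>"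
    using Stone_Weierstrass_real_polynomial_function[of ?Q clamped_sup \<eta>] \<eta>(1)
      continuous_on_subset[OF clamped_sup_continuous] by (metis compact_cbox subset_UNIV)
  have wc: "continuous_on UNIV w" using w(1) by (rule real_polynomial_continuous)
  \<comment> \<open>Of the coefficient \<open>3 * e\<close>, one \<open>e\<close> covers the
    oscillation of \<open>F\<close>, one the gradient error, and one is left as slack. The constant
    \<open>e\<close> restores nonnegativity.\<close>
  define p where "p x = (1 / \<delta>\<^sup>2) * box_integral \<delta> w x + (3 * e * (fst x + snd x) + e)" for x
  define p' where "p' x v = (1 / \<delta>\<^sup>2) * box_gradient \<delta> w x v + 3 * e * (fst v + snd v)" for x v
  have bl: "bounded_linear (\<lambda>x::real \<times> real. fst x + snd x)"
    by (intro bounded_linear_add bounded_linear_fst bounded_linear_snd)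
  have "real_polynomial_function p"
    unfolding p_def[abs_def]
    by (intro real_polynomial_function.intros(3) real_polynomial_function.intros(2)
        real_polynomial_function.intros(4)[OF real_polynomial_function.intros(2)]
        real_polynomial_box_integral[OF w(1)] real_polynomial_function.intros(1)[OF bl])
  moreover have "(p has_derivative p' x) (at x)" for x
    unfolding p_def[abs_def] p'_def[abs_def]
  proof (rule has_derivative_add)
    show "((\<lambda>x. 1 / \<delta>\<^sup>2 * box_integral \<delta> w x) has_derivative (\<lambda>v. 1 / \<delta>\<^sup>2 * box_gradient \<delta> w x v)) (at x)"
      using \<delta>(1) by (intro has_derivative_mult_right box_integral_has_derivative[OF wc]) auto
    show "((\<lambda>x. 3 * e * (fst x + snd x) + e) has_derivative (\<lambda>v. 3 * e * (fst v + snd v))) (at x)"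
      by (auto intro!: derivative_eq_intros)
  qed
  moreover have "F x * sqrt (fst v * snd v) + e * (fst v + snd v) \<le> p' x v"
    if x: "x \<in> unit_square" and v: "0 \<le> fst v" "0 \<le> snd v" for x v
  proof -
    define m where "m = max 0 (F x - e)"
    have x': "0 \<le> fst x" "fst x \<le> 1" "0 \<le> snd x" "snd x \<le> 1" using x by (auto simp: unit_square_def)
    have mF: "m \<le> F z" if z: "fst x \<le> fst z" "fst z \<le> fst x + 2 * \<delta>" "snd x \<le> snd z" "snd z \<le> snd x + 2 * \<delta>" for z
    proof -
      have "dist z x \<le> \<bar>fst z - fst x\<bar> + \<bar>snd z - snd x\<bar>"
        using norm_Pair_le[of "fst z - fst x" "snd z - snd x"]
        by (simp add: dist_norm minus_prod_def)
      also have "\<dots> < d" using z \<delta> d(1) by linarith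
      finally have "dist (F z) (F x) < e"
        using z \<delta> x' by (intro d(2)) (auto simp: Q mem_Times_iff)
      then show ?thesis using F_nonneg[of z] by (auto simp: m_def dist_real_def)
    qed
    have "\<delta>\<^sup>2 * (m * sqrt (fst v * snd v)) \<le> box_gradient \<delta> clamped_sup x v"
      using box_gradient_clamped_sup_ge[OF x v \<delta>(1,2) _ mF] by (simp add: m_def)
    moreover have "box_gradient \<delta> clamped_sup x v - (fst v + snd v) * (2 * \<delta> * \<eta>) \<le> box_gradient \<delta> w x v"
    proof (rule box_gradient_close[OF wc clamped_sup_continuous _ _ _ x v])
      fix z :: "real \<times> real" assume "z \<in> {0..2} \<times> {0..2}"
      then show "\<bar>w z - clamped_sup z\<bar> \<le> \<eta>" using w(2)[of z] by (simp add: Q abs_minus_commute)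
    qed (use \<delta> in auto)
    ultimately have "\<delta>\<^sup>2 * (m * sqrt (fst v * snd v) - (fst v + snd v) * e) \<le> box_gradient \<delta> w x v"
      by (simp add: \<eta>_def power2_eq_square algebra_simps)
    then have "m * sqrt (fst v * snd v) - (fst v + snd v) * e \<le> (1 / \<delta>\<^sup>2) * box_gradient \<delta> w x v"
      using \<delta>(1) by (simp add: pos_le_divide_eq mult.commute)
    moreover have "(F x - e) * sqrt (fst v * snd v) \<le> m * sqrt (fst v * snd v)"
      using v by (intro mult_right_mono) (auto simp: m_def)
    moreover have "e * sqrt (fst v * snd v) \<le> e * (fst v + snd v)"
      using sqrt_mult_le_average[OF v] e v by (intro mult_left_mono) auto
    ultimately show ?thesis unfolding p'_def by (simp add: algebra_simps)
  qed
  moreover have "0 \<le> p x \<and> p x \<le> chain_sup (fst x) (snd x) + \<epsilon>" if x: "x \<in> unit_square" for x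
  proof -
    have x': "0 \<le> fst x" "fst x \<le> 1" "0 \<le> snd x" "snd x \<le> 1" using x by (auto simp: unit_square_def)
    have cs: "clamped_sup x = chain_sup (fst x) (snd x)"
      using x' by (simp add: clamped_sup_def max_def min_def)
    have shift: "continuous_on UNIV (\<lambda>z. w (x + z))"
      by (intro continuous_on_compose2[OF wc] continuous_intros) auto
    have near: "\<bar>clamped_sup (x + (s, t)) - w (x + (s, t))\<bar> < \<eta>"
      if "0 \<le> s" "s \<le> \<delta>" "0 \<le> t" "t \<le> \<delta>" for s t
      using that \<delta> x' by (intro w(2)) (auto simp: Q mem_Times_iff)
    have "square_integral \<delta> (\<lambda>_. - e) \<le> box_integral \<delta> w x"
      unfolding box_integral_def
    proof (rule square_integral_mono[OF continuous_on_const shift])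
      fix s t assume st: "0 \<le> s" "s \<le> \<delta>" "0 \<le> t" "t \<le> \<delta>"
      show "- e \<le> w (x + (s, t))"
        using near[OF st] clamped_sup_nonneg[of "x + (s, t)"] \<eta>(2) by linarith
    qed
    then have "- e \<le> (1 / \<delta>\<^sup>2) * box_integral \<delta> w x"
      using \<delta>(1) by (simp add: square_integral_const pos_le_divide_eq mult.commute)
    moreover have "box_integral \<delta> w x \<le> square_integral \<delta> (\<lambda>_. clamped_sup x + 2 * e)"
      unfolding box_integral_def
    proof (rule square_integral_mono[OF shift continuous_on_const])
      fix s t assume st: "0 \<le> s" "s \<le> \<delta>" "0 \<le> t" "t \<le> \<delta>"
      have "clamped_sup (x + (s, t)) \<le> clamped_sup x + (M * sqrt (2 * s) + M * sqrt (2 * t))"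
        using clamped_sup_le_add[of "x + (s, t)" x] st by simp
      also have "\<dots> \<le> clamped_sup x + (M * sqrt (2 * \<delta>) + M * sqrt (2 * \<delta>))"
        using st M_nonneg by (intro add_mono mult_left_mono) auto
      finally show "w (x + (s, t)) \<le> clamped_sup x + 2 * e"
        using near[OF st] \<eta>(2) M\<delta> by linarith
    qed
    then have "(1 / \<delta>\<^sup>2) * box_integral \<delta> w x \<le> clamped_sup x + 2 * e"
      using \<delta>(1) by (simp add: square_integral_const pos_divide_le_eq mult.commute)
    moreover have "0 \<le> 3 * e * (fst x + snd x)" "3 * e * (fst x + snd x) \<le> 3 * e * 2"
      using e x' by (auto intro!: mult_left_mono)
    ultimately show ?thesis unfolding p_def cs by (simp add: e_def)
  qed
  ultimately show ?thesis using e by blast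
qed

end

subsection \<open>Subsolutions along segments\<close>

text \<open>The profile of a subsolution along a segment, in the parameter \<open>t\<close> that runs over
  \<open>[0, 1]\<close>: up to small errors it is \<open>a + \<mu> t\<close> there, and the large even power makes it
  nonpositive soon before and soon after the segment.\<close>

definition profile :: "real \<Rightarrow> real \<Rightarrow> real \<Rightarrow> nat \<Rightarrow> real \<Rightarrow> real" where
  "profile a \<mu> e n t = a - e + (\<mu> - e) * t - e * (2 * t - 1) ^ Suc n"

definition profile_deriv :: "real \<Rightarrow> real \<Rightarrow> nat \<Rightarrow> real \<Rightarrow> real" where
  "profile_deriv \<mu> e n t = \<mu> - e - e * (2 * real (Suc n) * (2 * t - 1) ^ n)"

lemma profile_has_derivative:
  "(profile a \<mu> e n has_real_derivative profile_deriv \<mu> e n t) (at t)"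
proof -
  have "((\<lambda>t. 2 * t - 1) has_real_derivative 2) (at t)"
    by (auto intro!: derivative_eq_intros)
  from DERIV_cmult[OF DERIV_power_Suc[OF this, of n], of e]
  have "((\<lambda>t. e * (2 * t - 1) ^ Suc n) has_real_derivative
    e * ((1 + real n) * (2 * (2 * t - 1) ^ n))) (at t)" by simp
  moreover have "((\<lambda>t. a - e + (\<mu> - e) * t) has_real_derivative \<mu> - e) (at t)"
    by (auto intro!: derivative_eq_intros)
  ultimately have "((\<lambda>t. a - e + (\<mu> - e) * t - e * (2 * t - 1) ^ Suc n) has_real_derivative
    \<mu> - e - e * ((1 + real n) * (2 * (2 * t - 1) ^ n))) (at t)"
    by (intro DERIV_diff)
  moreover have "\<mu> - e - e * ((1 + real n) * (2 * (2 * t - 1) ^ n)) = profile_deriv \<mu> e n t"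
    by (simp add: profile_deriv_def algebra_simps)
  ultimately show ?thesis unfolding profile_def[abs_def] by (simp only:)
qed

text \<open>A large odd \<open>n\<close> meets both demands. Beyond the margin \<open>\<tau>\<close>
  the base of the even power exceeds 1 in modulus, and the power swamps the affine part. For
  \<open>t \<ge> \<tau>\<close> the derivative of the penalty is nonnegative from the midpoint on,
  and before it is small because \<open>n * (1 - 2 * \<tau>) ^ n\<close> tends to 0.\<close>

lemma profile_exists:
  assumes a: "0 \<le> a" and \<mu>: "0 \<le> \<mu>" and e: "0 < e" and \<tau>: "0 < \<tau>" "\<tau> \<le> 1 / 4"
  shows "\<exists>n. odd n \<and> (\<forall>t. t \<le> - \<tau> \<or> 1 + \<tau> \<le> t \<longrightarrow> profile a \<mu> e n t \<le> 0) \<and>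
    (\<forall>t\<ge>\<tau>. profile_deriv \<mu> e n t \<le> \<mu> - e / 2)"
proof -
  \<comment> \<open>Makes \<open>e * (B * q)\<close> equal to \<open>(a + \<mu> + e) * q\<close>,
    which dominates the affine part as soon as \<open>q\<close> is at least 1 and at least the
    modulus of \<open>t\<close>.\<close>
  define B where "B = (a + \<mu> + e) / e"
  obtain n1 where n1: "B < (1 + 2 * \<tau>) ^ n1"
    using real_arch_pow[of "1 + 2 * \<tau>" B] \<tau> by auto
  have "eventually (\<lambda>n. B \<le> (1 + 2 * \<tau>) ^ n) sequentially"
    using eventually_ge_at_top[of n1]
  proof eventually_elim
    case (elim n)
    have "(1 + 2 * \<tau>) ^ n1 \<le> (1 + 2 * \<tau>) ^ n" using elim \<tau> by (intro power_increasing) auto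
    then show ?case using n1 by linarith
  qed
  moreover have "(\<lambda>n. real n * (1 - 2 * \<tau>) ^ n) \<longlonglongrightarrow> 0"
    using powser_times_n_limit_0[of "1 - 2 * \<tau>"] \<tau> by simp
  then have "eventually (\<lambda>n. real n * (1 - 2 * \<tau>) ^ n < 1 / 8) sequentially"
    by (rule order_tendstoD(2)) simp
  ultimately have "eventually (\<lambda>n. B \<le> (1 + 2 * \<tau>) ^ n \<and> real n * (1 - 2 * \<tau>) ^ n < 1 / 8) sequentially"
    by (rule eventually_conj)
  then obtain n0 where n0: "\<And>n. n \<ge> n0 \<Longrightarrow> B \<le> (1 + 2 * \<tau>) ^ n \<and> real n * (1 - 2 * \<tau>) ^ n < 1 / 8"
    by (auto simp: eventually_sequentially)
  define n where "n = 2 * n0 + 1"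
  have n: "odd n" "B \<le> (1 + 2 * \<tau>) ^ n" "real n * (1 - 2 * \<tau>) ^ n < 1 / 8"
    using n0[of n] by (auto simp: n_def)
  have "profile a \<mu> e n t \<le> 0" if t: "t \<le> - \<tau> \<or> 1 + \<tau> \<le> t" for t
  proof -
    define q where "q = \<bar>2 * t - 1\<bar>"
    have q: "1 + 2 * \<tau> \<le> q" "\<bar>t\<bar> \<le> q" using t \<tau> by (auto simp: q_def)
    have "B * q \<le> q ^ n * q"
      using n(2) power_mono[OF q(1), of n] \<tau> q by (intro mult_right_mono) auto
    also have "\<dots> = q ^ Suc n" by simp
    also have "\<dots> = (2 * t - 1) ^ Suc n"
      unfolding q_def by (rule power_even_abs) (use n(1) in simp)
    finally have "e * (B * q) \<le> e * (2 * t - 1) ^ Suc n" using e by (intro mult_left_mono) auto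
    moreover have "e * (B * q) = (a + \<mu> + e) * q" using e by (simp add: B_def)
    moreover have "(\<mu> - e) * t \<le> (\<mu> + e) * q"
    proof -
      have "(\<mu> - e) * t \<le> \<bar>\<mu> - e\<bar> * \<bar>t\<bar>" by (metis abs_ge_self abs_mult)
      also have "\<dots> \<le> (\<mu> + e) * q" using q \<mu> e by (intro mult_mono) auto
      finally show ?thesis .
    qed
    moreover have "a * 1 \<le> a * q" using a q \<tau> by (intro mult_left_mono) auto
    ultimately show ?thesis using e by (simp add: profile_def algebra_simps)
  qed
  moreover have "profile_deriv \<mu> e n t \<le> \<mu> - e / 2" if t: "t \<ge> \<tau>" for t
  proof -
    have "- (1 / 2) \<le> 2 * real (Suc n) * (2 * t - 1) ^ n"
    proof (cases "t \<le> 1 / 2")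
      case True
      have "2 * real (Suc n) \<le> 4 * real n" by (simp add: n_def)
      moreover have "(1 - 2 * t) ^ n \<le> (1 - 2 * \<tau>) ^ n" using True t by (intro power_mono) auto
      ultimately have "2 * real (Suc n) * (1 - 2 * t) ^ n \<le> 4 * real n * (1 - 2 * \<tau>) ^ n"
        by (rule mult_mono) (use True in auto)
      also have "\<dots> \<le> 1 / 2" using n(3) by simp
      finally have "2 * real (Suc n) * (1 - 2 * t) ^ n \<le> 1 / 2" .
      moreover have "(2 * t - 1) ^ n = - ((1 - 2 * t) ^ n)"
        using power_minus_odd[OF n(1), of "1 - 2 * t"] by simp
      ultimately show ?thesis by simp
    next
      case False
      then have "0 \<le> 2 * real (Suc n) * (2 * t - 1) ^ n" by simp
      then show ?thesis by linarith
    qed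
    then have "e * - (1 / 2) \<le> e * (2 * real (Suc n) * (2 * t - 1) ^ n)"
      using e by (intro mult_left_mono) auto
    then show ?thesis by (simp add: profile_deriv_def)
  qed
  ultimately show ?thesis using n(1) by blast
qed

text \<open>The even power is dropped. \<open>T = 2\<close> covers the whole tube,
  \<open>T = \<tau>\<close> its beginning.\<close>

lemma profile_le:
  assumes "odd n" "0 \<le> \<mu>" "0 < e" "\<bar>t\<bar> \<le> T"
  shows "profile a \<mu> e n t \<le> a - e + (\<mu> + e) * T"
proof -
  have "(\<mu> - e) * t \<le> \<bar>\<mu> - e\<bar> * \<bar>t\<bar>" by (metis abs_ge_self abs_mult)
  also have "\<dots> \<le> (\<mu> + e) * T" using assms by (intro mult_mono) auto
  finally have "(\<mu> - e) * t \<le> (\<mu> + e) * T" .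
  moreover have "0 \<le> (2 * t - 1) ^ Suc n" using assms(1) by (intro zero_le_even_power) simp
  then have "0 \<le> e * (2 * t - 1) ^ Suc n" using assms by (intro mult_nonneg_nonneg) auto
  ultimately show ?thesis unfolding profile_def by linarith
qed

context scheme_limit
begin

text \<open>Besides the outside of the tube and the part where the subsolution inequality holds
  there is the beginning of the tube, where \<open>start\<close> gives the bound. Along the segment
  \<open>r\<close> is constant, so the penalty does not enter the derivative in that direction, and
  \<open>K\<close> may be as large as a thin tube requires. Hypothesis and conclusion have the same
  form, so segments can be joined.\<close>

lemma uh_lower_bound_segment:
  assumes x: "0 \<le> x1" "0 \<le> x2" and xy: "x1 \<le> y1" "x2 \<le> y2" "(x1, x2) \<noteq> (y1, y2)"
    and y: "0 < y1" "y1 \<le> 1" "0 < y2" "y2 \<le> 1" and m: "0 \<le> m"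
    and f_ge: "\<And>z1 z2. x1 \<le> z1 \<Longrightarrow> z1 \<le> y1 \<Longrightarrow> x2 \<le> z2 \<Longrightarrow> z2 \<le> y2 \<Longrightarrow> m \<le> f (z1, z2)"
    and a: "0 \<le> a"
    and start: "\<And>\<epsilon>. \<epsilon> > 0 \<Longrightarrow> \<exists>\<delta>>0. eventually (\<lambda>N. \<forall>z\<in>grid N. dist z (x1, x2) < \<delta> \<longrightarrow> a - \<epsilon> \<le> uh N z) sequentially"
    and \<epsilon>: "\<epsilon> > 0"
  shows "\<exists>\<delta>>0. eventually (\<lambda>N. \<forall>z\<in>grid N. dist z (y1, y2) < \<delta> \<longrightarrow>
    a + m * sqrt ((y1 - x1) * (y2 - x2)) - \<epsilon> \<le> uh N z) sequentially"
proof -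
  \<comment> \<open>At the end point \<open>s\<close> falls short of the target by
    \<open>3 * e\<close>; its continuity costs one more \<open>e\<close>.\<close>
  define e where "e = \<epsilon> / 4"
  have e: "e > 0" using \<epsilon> by (simp add: e_def)
  define d1 d2 where "d1 = y1 - x1" and "d2 = y2 - x2"
  have d: "0 \<le> d1" "d1 \<le> 1" "0 \<le> d2" "d2 \<le> 1" "(d1, d2) \<noteq> (0, 0)"
    using x xy y by (auto simp: d1_def d2_def)
  define D where "D = d1\<^sup>2 + d2\<^sup>2"
  have D: "D > 0" using d by (auto simp: D_def sum_power2_gt_zero_iff)
  define \<sigma> where "\<sigma> = sqrt (d1 * d2)"
  have \<sigma>: "0 \<le> \<sigma>" using d by (simp add: \<sigma>_def)
  define \<mu> where "\<mu> = m * \<sigma>"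
  have \<mu>: "0 \<le> \<mu>" using m \<sigma> by (simp add: \<mu>_def)
  obtain c where c: "c > 0" "(c * d1, c * d2) \<in> A" using A_cone[OF d(1,3,5)] by blast
  obtain \<delta>x where \<delta>x: "\<delta>x > 0"
    "eventually (\<lambda>N. \<forall>z\<in>grid N. dist z (x1, x2) < \<delta>x \<longrightarrow> a - e / 2 \<le> uh N z) sequentially"
    using start[of "e / 2"] e by auto
  define e2 where "e2 = e / (4 * (\<sigma> + 1))"
  have e2: "e2 > 0" "e2 * \<sigma> \<le> e / 4"
    using e \<sigma> by (auto simp: e2_def divide_simps)
  have "uniformly_continuous_on unit_square f"
    using f_cont compact_unit_square by (rule compact_uniformly_continuous)
  then obtain \<rho>0 where \<rho>0: "\<rho>0 > 0" "\<And>p z. p \<in> unit_square \<Longrightarrow> z \<in> unit_square \<Longrightarrow>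
      dist z p < \<rho>0 \<Longrightarrow> dist (f z) (f p) < e2"
    using e2(1) unfolding uniformly_continuous_on_def by metis
  \<comment> \<open>The four bounds serve the existence of the profile, the distance of the
    beginning of the tube from the start, the uniform continuity of \<open>f\<close> across the
    tube, and a growth of the profile by at most \<open>e / 2\<close> up to
    \<open>t = \<tau>\<close>.\<close>
  define \<tau> where "\<tau> = min (1 / 4) (min (\<delta>x / 8) (min (\<rho>0 / 8) (e / (2 * (\<mu> + e)))))"
  have \<tau>: "0 < \<tau>" "\<tau> \<le> 1 / 4" "8 * \<tau> \<le> \<delta>x" "8 * \<tau> \<le> \<rho>0" "\<tau> \<le> e / (2 * (\<mu> + e))"
  proof -
    show "0 < \<tau>" using \<delta>x(1) \<rho>0(1) e \<mu> by (simp add: \<tau>_def)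
    have "\<tau> \<le> \<delta>x / 8" "\<tau> \<le> \<rho>0 / 8" unfolding \<tau>_def min_le_iff_disj by blast+
    then show "8 * \<tau> \<le> \<delta>x" "8 * \<tau> \<le> \<rho>0" by simp_all
    show "\<tau> \<le> 1 / 4" "\<tau> \<le> e / (2 * (\<mu> + e))" unfolding \<tau>_def min_le_iff_disj by blast+
  qed
  have \<tau>': "(\<mu> + e) * \<tau> \<le> e / 2"
    using \<tau>(5) e \<mu> by (simp add: pos_le_divide_eq algebra_simps)
  \<comment> \<open>For \<open>t z \<ge> \<tau>\<close> the axis of the tube has coordinates at
    least \<open>\<tau> * y1\<close> and \<open>\<tau> * y2\<close>. A smaller radius keeps such
    grid points off the coordinate axes, where no control acts.\<close>
  define \<rho> where "\<rho> = \<tau> * min y1 y2 / 2"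
  have \<rho>: "0 < \<rho>" "\<rho> < \<tau> * y1" "\<rho> < \<tau> * y2" "\<rho> \<le> \<tau>"
  proof -
    have "0 < \<tau> * min y1 y2" "\<tau> * min y1 y2 \<le> \<tau> * y1" "\<tau> * min y1 y2 \<le> \<tau> * y2" "\<tau> * min y1 y2 \<le> \<tau> * 1"
      using \<tau>(1) y by (auto intro!: mult_left_mono)
    then show "0 < \<rho>" "\<rho> < \<tau> * y1" "\<rho> < \<tau> * y2" "\<rho> \<le> \<tau>" unfolding \<rho>_def by linarith+
  qed
  obtain n where n: "odd n" "\<And>t. t \<le> - \<tau> \<or> 1 + \<tau> \<le> t \<Longrightarrow> profile a \<mu> e n t \<le> 0"
    "\<And>t. \<tau> \<le> t \<Longrightarrow> profile_deriv \<mu> e n t \<le> \<mu> - e / 2"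
    using profile_exists[OF a \<mu> e \<tau>(1,2)] by blast
  \<comment> \<open>At \<open>r z = \<rho>\<close> the penalty consumes the upper bound of the
    profile for \<open>t z\<close> of modulus at most 2.\<close>
  define K where "K = (a + (\<mu> + e) * 2) / \<rho>\<^sup>2"
  have K: "0 \<le> K" "K * \<rho>\<^sup>2 = a + (\<mu> + e) * 2" using a \<mu> e \<rho>(1) by (auto simp: K_def)
  \<comment> \<open>Orthogonal coordinates adapted to the segment: \<open>z\<close> is
    \<open>(x1, x2)\<close> plus \<open>t z\<close> times \<open>(d1, d2)\<close> plus
    \<open>r z\<close> times \<open>(d2, - d1)\<close>.\<close>
  define t where "t z = (d1 / D) * (fst z - x1) + (d2 / D) * (snd z - x2)" for z
  define r where "r z = (d2 / D) * (fst z - x1) - (d1 / D) * (snd z - x2)" for z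
  define s where "s z = profile a \<mu> e n (t z) - K * (r z)\<^sup>2" for z
  define s' where "s' z v = profile_deriv \<mu> e n (t z) * ((d1 / D) * fst v + (d2 / D) * snd v)
    - K * (2 * r z * ((d2 / D) * fst v - (d1 / D) * snd v))" for z v
  have D_self: "(d1 * d1 + d2 * d2) / D = 1"
    using D unfolding D_def power2_eq_square by (metis divide_self less_irrefl)
  have coords: "fst z = x1 + t z * d1 + r z * d2" "snd z = x2 + t z * d2 - r z * d1" for z
  proof -
    from D_self have DD: "(d1 / D) * d1 + (d2 / D) * d2 = 1" by (simp add: add_divide_distrib)
    have swap: "(d1 / D) * d2 = (d2 / D) * d1" by simp
    have "(b1 * w1 + b2 * w2) * d1 + (b2 * w1 - b1 * w2) * d2 = (b1 * d1 + b2 * d2) * w1"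
      "(b1 * w1 + b2 * w2) * d2 - (b2 * w1 - b1 * w2) * d1 = (b1 * d1 + b2 * d2) * w2"
      if "b1 * d2 = b2 * d1" for b1 b2 w1 w2
      using that by algebra+
    from this[OF swap, of "fst z - x1" "snd z - x2", folded t_def r_def]
    have "t z * d1 + r z * d2 = fst z - x1" "t z * d2 - r z * d1 = snd z - x2"
      unfolding DD by simp_all
    then show "fst z = x1 + t z * d1 + r z * d2" "snd z = x2 + t z * d2 - r z * d1"
      by simp_all
  qed
  have poly_t: "real_polynomial_function t" and poly_r: "real_polynomial_function r"
    unfolding t_def[abs_def] r_def[abs_def]
    by (intro real_polynomial_function.intros(3) real_polynomial_function_diff
        real_polynomial_function.intros(4)[OF real_polynomial_function.intros(2)]
        real_polynomial_function.intros(2) real_polynomial_function.intros(1)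
        bounded_linear_fst bounded_linear_snd)+
  have poly_s: "real_polynomial_function s"
    unfolding s_def[abs_def] profile_def
    by (intro real_polynomial_function.intros(3) real_polynomial_function_diff
        real_polynomial_function.intros(4)[OF real_polynomial_function.intros(2)]
        real_polynomial_function_power poly_t poly_r real_polynomial_function.intros(2))
  have der_t: "(t has_derivative (\<lambda>v. (d1 / D) * fst v + (d2 / D) * snd v)) (at z)" for z
    unfolding t_def[abs_def] using D by (auto intro!: derivative_eq_intros)
  have der_r: "(r has_derivative (\<lambda>v. (d2 / D) * fst v - (d1 / D) * snd v)) (at z)" for z
    unfolding r_def[abs_def] using D by (auto intro!: derivative_eq_intros)
  have der_s: "(s has_derivative s' z) (at z)" for z
    unfolding s_def[abs_def] s'_def[abs_def]
  proof (rule has_derivative_diff)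
    show "((\<lambda>z. profile a \<mu> e n (t z)) has_derivative
      (\<lambda>v. profile_deriv \<mu> e n (t z) * ((d1 / D) * fst v + (d2 / D) * snd v))) (at z)"
      by (rule has_derivative_compose[OF der_t profile_has_derivative[unfolded has_field_derivative_def]])
    have "((\<lambda>z. (r z)\<^sup>2) has_derivative (\<lambda>v. 2 * r z * ((d2 / D) * fst v - (d1 / D) * snd v))) (at z)"
      by (rule has_derivative_eq_rhs[OF has_derivative_power[OF der_r]]) (auto simp: algebra_simps)
    then show "((\<lambda>z. K * (r z)\<^sup>2) has_derivative
      (\<lambda>v. K * (2 * r z * ((d2 / D) * fst v - (d1 / D) * snd v)))) (at z)"
      by (rule has_derivative_mult_right)
  qed
  define \<alpha> where "\<alpha> = (c * d1, c * d2)"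
  have s'\<alpha>: "s' z \<alpha> = c * profile_deriv \<mu> e n (t z)" for z
  proof -
    have "(d1 / D) * (c * d1) + (d2 / D) * (c * d2) = c * ((d1 * d1 + d2 * d2) / D)"
      by (simp add: algebra_simps add_divide_distrib)
    also have "\<dots> = c" by (simp add: D_self)
    finally show ?thesis by (simp add: s'_def \<alpha>_def)
  qed
  have sqrt_\<alpha>: "sqrt (fst \<alpha> * snd \<alpha>) = c * \<sigma>"
  proof -
    have "fst \<alpha> * snd \<alpha> = c\<^sup>2 * (d1 * d2)" by (simp add: \<alpha>_def power2_eq_square)
    then show ?thesis using c(1) by (simp add: \<sigma>_def real_sqrt_mult)
  qed
  have ev: "eventually (\<lambda>N. \<forall>z\<in>grid N. s z \<le> uh N z) sequentially"
  proof (rule uh_lower_bound[OF poly_s der_s, of "c * (e / 4)"])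
    show "0 < c * (e / 4)" using c e by simp
    show "eventually (\<lambda>N. \<forall>z\<in>grid N. s z \<le> uh N z \<or>
      z \<in> inner_grid N \<and> (\<exists>\<alpha>\<in>A. s' z \<alpha> + c * (e / 4) \<le> f z * sqrt (fst \<alpha> * snd \<alpha>))) sequentially"
      using \<delta>x(2) uh_nonneg
    proof eventually_elim
      case (elim N)
      show ?case
      proof (intro ballI)
        fix z assume z: "z \<in> grid N"
        show "s z \<le> uh N z \<or> z \<in> inner_grid N \<and>
          (\<exists>\<alpha>\<in>A. s' z \<alpha> + c * (e / 4) \<le> f z * sqrt (fst \<alpha> * snd \<alpha>))"
        proof (cases "s z \<le> uh N z")
          case False
          have Kr: "0 \<le> K * (r z)\<^sup>2" using K by simp
          have s_pos: "0 < s z" using False elim(2) z by force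
          then have P_pos: "0 < profile a \<mu> e n (t z)" using Kr unfolding s_def by linarith
          then have tz: "- \<tau> < t z" "t z < 1 + \<tau>" using n(2)[of "t z"] by fastforce+
          have "profile a \<mu> e n (t z) \<le> a - e + (\<mu> + e) * 2"
            by (rule profile_le[OF n(1) \<mu> e]) (use tz \<tau> in auto)
          then have "K * (r z)\<^sup>2 < K * \<rho>\<^sup>2" using s_pos e K(2) unfolding s_def by linarith
          then have "(r z)\<^sup>2 < \<rho>\<^sup>2" using K(1) by (simp add: mult_less_cancel_left)
          then have rz: "\<bar>r z\<bar> < \<rho>"
            using power2_less_imp_less[of "\<bar>r z\<bar>" \<rho>] \<rho>(1) by simp
          have rd: "\<bar>r z * d1\<bar> \<le> \<bar>r z\<bar>" "\<bar>r z * d2\<bar> \<le> \<bar>r z\<bar>"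
            using d by (auto simp: abs_mult mult_left_le)
          show ?thesis
          proof (cases "t z < \<tau>")
            case True
            have td: "\<bar>t z * d1\<bar> \<le> \<bar>t z\<bar>" "\<bar>t z * d2\<bar> \<le> \<bar>t z\<bar>"
              using d by (auto simp: abs_mult mult_left_le)
            have "dist z (x1, x2) \<le> \<bar>fst z - x1\<bar> + \<bar>snd z - x2\<bar>"
              using norm_Pair_le[of "fst z - x1" "snd z - x2"] by (simp add: dist_norm minus_prod_def)
            also have "\<dots> < \<delta>x"
              using coords[of z] td rd tz True rz \<rho>(4) \<tau>(1,3) by linarith
            finally have "a - e / 2 \<le> uh N z" using elim(1) z by blast
            moreover have "profile a \<mu> e n (t z) \<le> a - e + (\<mu> + e) * \<tau>"
              by (rule profile_le[OF n(1) \<mu> e]) (use tz True in auto)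
            ultimately have "s z \<le> uh N z" using Kr \<tau>' unfolding s_def by linarith
            then show ?thesis ..
          next
            case t_ge: False
            have "\<tau> * y1 \<le> x1 + t z * d1" "\<tau> * y2 \<le> x2 + t z * d2"
            proof -
              have "\<tau> * x1 \<le> 1 * x1" "\<tau> * x2 \<le> 1 * x2" "\<tau> * d1 \<le> t z * d1" "\<tau> * d2 \<le> t z * d2"
                using \<tau>(1,2) x d(1,3) t_ge by (intro mult_right_mono; linarith)+
              moreover have "y1 = x1 + d1" "y2 = x2 + d2" by (auto simp: d1_def d2_def)
              ultimately show "\<tau> * y1 \<le> x1 + t z * d1" "\<tau> * y2 \<le> x2 + t z * d2"
                by (auto simp: distrib_left)
            qed
            then have "0 < fst z" "0 < snd z" using coords[of z] rd rz \<rho>(2,3) by linarith+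
            then have inner: "z \<in> inner_grid N" using grid_boundary[OF z] by auto
            \<comment> \<open>The tube overshoots the end point by up to \<open>\<tau>\<close>,
              where the bound \<open>m\<close> is not given; \<open>p\<close> is the point of the
              segment from which uniform continuity carries it over.\<close>
            define t' where "t' = min (t z) 1"
            define p where "p = (x1 + t' * d1, x2 + t' * d2)"
            have t': "0 \<le> t'" "t' \<le> 1" "0 \<le> t z - t'" "t z - t' \<le> \<tau>" using t_ge \<tau> tz by (auto simp: t'_def)
            have t'd: "0 \<le> t' * d1" "t' * d1 \<le> d1" "0 \<le> t' * d2" "t' * d2 \<le> d2"
              using t' d by (auto simp: mult_left_le_one_le)
            have p_box: "x1 \<le> fst p" "fst p \<le> y1" "x2 \<le> snd p" "snd p \<le> y2"
              using t'd by (auto simp: p_def d1_def d2_def)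
            have p_sq: "p \<in> unit_square" using p_box x y by (cases p) (auto simp: unit_square_def)
            have td: "\<bar>(t z - t') * d1\<bar> \<le> \<tau>" "\<bar>(t z - t') * d2\<bar> \<le> \<tau>"
            proof -
              have "(t z - t') * d1 \<le> \<tau> * 1" "(t z - t') * d2 \<le> \<tau> * 1"
                using t'(3,4) d(1-4) \<tau>(1) by (intro mult_mono; linarith)+
              then show "\<bar>(t z - t') * d1\<bar> \<le> \<tau>" "\<bar>(t z - t') * d2\<bar> \<le> \<tau>" using t' d by (auto simp: abs_mult)
            qed
            have "dist z p \<le> \<bar>fst z - fst p\<bar> + \<bar>snd z - snd p\<bar>"
              using norm_Pair_le[of "fst z - fst p" "snd z - snd p"] by (simp add: dist_norm minus_prod_def)
            also have "fst z - fst p = (t z - t') * d1 + r z * d2"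
              using coords[of z] by (simp add: p_def algebra_simps)
            also have "snd z - snd p = (t z - t') * d2 - r z * d1"
              using coords[of z] by (simp add: p_def algebra_simps)
            also have "\<bar>(t z - t') * d1 + r z * d2\<bar> + \<bar>(t z - t') * d2 - r z * d1\<bar> < \<rho>0"
              using td rd rz \<rho>(4) \<tau>(1,4) by linarith
            finally have "dist (f z) (f p) < e2"
              using p_sq z grid_subset_unit_square by (intro \<rho>0(2)) auto
            moreover have "m \<le> f p" using f_ge[OF p_box] by simp
            ultimately have "m - e2 \<le> f z" unfolding dist_real_def by linarith
            then have "(m - e2) * \<sigma> \<le> f z * \<sigma>" using \<sigma> by (rule mult_right_mono)
            then have "\<mu> - e / 4 \<le> f z * \<sigma>" using e2(2) by (simp add: \<mu>_def algebra_simps)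
            moreover have "profile_deriv \<mu> e n (t z) \<le> \<mu> - e / 2" using n(3) t_ge by simp
            ultimately have "profile_deriv \<mu> e n (t z) + e / 4 \<le> f z * \<sigma>" by linarith
            from mult_left_mono[OF this less_imp_le[OF c(1)]]
            have "s' z \<alpha> + c * (e / 4) \<le> f z * sqrt (fst \<alpha> * snd \<alpha>)"
              by (simp add: s'\<alpha> sqrt_\<alpha> algebra_simps)
            then show ?thesis using inner c(2) \<alpha>_def by blast
          qed
        qed simp
      qed
    qed
  qed
  have "t (y1, y2) = 1" "r (y1, y2) = 0"
  proof -
    have "t (y1, y2) = (d1 * d1 + d2 * d2) / D"
      by (simp add: t_def d1_def[symmetric] d2_def[symmetric] add_divide_distrib)
    then show "t (y1, y2) = 1" by (simp add: D_self)
    show "r (y1, y2) = 0" by (simp add: r_def d1_def[symmetric] d2_def[symmetric])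
  qed
  then have s_y: "s (y1, y2) = a + \<mu> - 3 * e" by (simp add: s_def profile_def)
  have "isCont s (y1, y2)" using der_s by (rule has_derivative_continuous)
  then obtain \<delta> where \<delta>: "\<delta> > 0" "\<And>z. dist z (y1, y2) < \<delta> \<Longrightarrow> dist (s z) (s (y1, y2)) < e"
    using e unfolding continuous_at_eps_delta by metis
  show ?thesis
  proof (intro exI[of _ \<delta>] conjI \<delta>(1))
    show "eventually (\<lambda>N. \<forall>z\<in>grid N. dist z (y1, y2) < \<delta> \<longrightarrow>
      a + m * sqrt ((y1 - x1) * (y2 - x2)) - \<epsilon> \<le> uh N z) sequentially"
      using ev
    proof eventually_elim
      case (elim N)
      show ?case
      proof (intro ballI impI)
        fix z assume z: "z \<in> grid N" "dist z (y1, y2) < \<delta>"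
        have "a + \<mu> - 4 * e \<le> s z" using \<delta>(2)[OF z(2)] s_y by (simp add: dist_real_def)
        also have "s z \<le> uh N z" using elim z by blast
        finally show "a + m * sqrt ((y1 - x1) * (y2 - x2)) - \<epsilon> \<le> uh N z"
          by (simp add: e_def \<mu>_def \<sigma>_def d1_def d2_def)
      qed
    qed
  qed
qed

end

subsection \<open>Convergence\<close>

locale scheme_extension = scheme_limit f A g uh + running_cost F M
  for f :: "real \<times> real \<Rightarrow> real" and A g uh and F :: "real \<times> real \<Rightarrow> real" and M +
  assumes F_cont: "continuous_on UNIV F" and F_eq: "z \<in> unit_square \<Longrightarrow> F z = f z"
begin

text \<open>The induction runs on a bound near the end point of the chain, the form that
  \<open>uh_lower_bound_segment\<close> both takes and returns.\<close>

lemma uh_lower_bound_chain: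
  assumes "chain_value F y1 y2 a" "(y1, y2) \<in> unit_square" "\<epsilon> > 0"
  shows "\<exists>\<delta>>0. eventually (\<lambda>N. \<forall>z\<in>grid N. dist z (y1, y2) < \<delta> \<longrightarrow> a - \<epsilon> \<le> uh N z) sequentially"
  using assms
proof (induction arbitrary: \<epsilon> rule: chain_value.induct)
  case origin
  have "eventually (\<lambda>N. \<forall>z\<in>grid N. dist z (0, 0) < 1 \<longrightarrow> 0 - \<epsilon> \<le> uh N z) sequentially"
    using uh_nonneg by eventually_elim (use origin in force)
  then show ?case by (intro exI[of _ 1]) simp
next
  case (step x1 x2 a y1 y2 m)
  note hyps = step.hyps
  have x: "0 \<le> x1" "0 \<le> x2" "0 \<le> a" using chain_value_nonneg[OF hyps(1)] by auto
  have y: "y1 \<le> 1" "y2 \<le> 1" using step.prems by (auto simp: unit_square_def)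
  \<comment> \<open>On an axis the chain has collected nothing, and a trivial step adds nothing;
    what remains has an end point off the axes and a genuine direction, as the segment estimate
    requires.\<close>
  consider "y1 = 0 \<or> y2 = 0" | "(x1, x2) = (y1, y2)" | "0 < y1" "0 < y2" "(x1, x2) \<noteq> (y1, y2)"
    using x hyps(2,3) by fastforce
  then show ?case
  proof cases
    case 1
    have "a + m * sqrt ((y1 - x1) * (y2 - x2)) \<le> M * sqrt (y1 * y2)"
      by (rule chain_value_le[OF chain_value.step[OF hyps]])
    also have "\<dots> = 0" using 1 by auto
    finally have le: "a + m * sqrt ((y1 - x1) * (y2 - x2)) \<le> 0" .
    have "eventually (\<lambda>N. \<forall>z\<in>grid N. dist z (y1, y2) < 1 \<longrightarrow>
      a + m * sqrt ((y1 - x1) * (y2 - x2)) - \<epsilon> \<le> uh N z) sequentially"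
      using uh_nonneg by eventually_elim (use le step.prems(2) in force)
    then show ?thesis by (intro exI[of _ 1]) simp
  next
    case 2
    then show ?thesis using step.IH[OF _ step.prems(2)] step.prems(1) by simp
  next
    case 3
    have sq: "(x1, x2) \<in> unit_square" using x hyps(2,3) y by (auto simp: unit_square_def)
    show ?thesis
    proof (rule uh_lower_bound_segment[OF x(1,2) hyps(2,3) 3(3,1) y(1) 3(2) y(2) hyps(4) _ x(3)])
      show "m \<le> f (z1, z2)" if "x1 \<le> z1" "z1 \<le> y1" "x2 \<le> z2" "z2 \<le> y2" for z1 z2
        using hyps(5)[OF that] F_eq[of "(z1, z2)"] that x y by (auto simp: unit_square_def)
      show "\<exists>\<delta>>0. eventually (\<lambda>N. \<forall>z\<in>grid N. dist z (x1, x2) < \<delta> \<longrightarrow> a - \<epsilon> \<le> uh N z) sequentially"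
        if "\<epsilon> > 0" for \<epsilon>
        by (rule step.IH[OF sq that])
    qed (rule step.prems(2))
  qed
qed

lemma clamped_sup_eq: "z \<in> unit_square \<Longrightarrow> clamped_sup z = chain_sup (fst z) (snd z)"
  by (auto simp: clamped_sup_def unit_square_def max_def min_def)

text \<open>\<open>\<epsilon>\<close> is divided among a near-optimal chain, the discrete bound near
  its end point and the continuity of \<open>clamped_sup\<close>. Compactness leaves finitely many
  neighbourhoods and hence a uniform bound.\<close>

lemma uh_eventually_ge:
  assumes \<epsilon>: "\<epsilon> > 0"
  shows "eventually (\<lambda>N. \<forall>z\<in>grid N. clamped_sup z - \<epsilon> \<le> uh N z) sequentially"
proof -
  have "\<exists>r>0. eventually (\<lambda>N. \<forall>z\<in>grid N. z \<in> ball y r \<longrightarrow> clamped_sup z - \<epsilon> \<le> uh N z) sequentially"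
    if y: "y \<in> unit_square" for y
  proof -
    obtain y1 y2 where y12: "y = (y1, y2)" by fastforce
    have y': "0 \<le> y1" "0 \<le> y2" using y by (auto simp: y12 unit_square_def)
    have "\<exists>a. chain_value F y1 y2 a \<and> clamped_sup y - \<epsilon> / 3 < a"
    proof (rule ccontr)
      assume "\<not> ?thesis"
      then have "chain_sup y1 y2 \<le> clamped_sup y - \<epsilon> / 3"
        using y' by (intro chain_sup_least) force+
      then show False using clamped_sup_eq[OF y] \<epsilon> by (simp add: y12)
    qed
    then obtain a where a: "chain_value F y1 y2 a" "clamped_sup y - \<epsilon> / 3 < a" by blast
    obtain \<delta> where \<delta>: "\<delta> > 0"
      "eventually (\<lambda>N. \<forall>z\<in>grid N. dist z (y1, y2) < \<delta> \<longrightarrow> a - \<epsilon> / 3 \<le> uh N z) sequentially"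
      using uh_lower_bound_chain[OF a(1), of "\<epsilon> / 3"] y \<epsilon> by (auto simp: y12)
    have "isCont clamped_sup y"
      using clamped_sup_continuous unfolding continuous_on_eq_continuous_at[OF open_UNIV] by blast
    then obtain \<delta>' where \<delta>': "\<delta>' > 0" "\<And>z. dist z y < \<delta>' \<Longrightarrow> dist (clamped_sup z) (clamped_sup y) < \<epsilon> / 3"
      using \<epsilon> unfolding continuous_at_eps_delta by (metis divide_pos_pos zero_less_numeral)
    show ?thesis
    proof (intro exI[of _ "min \<delta> \<delta>'"] conjI)
      show "0 < min \<delta> \<delta>'" using \<delta>(1) \<delta>'(1) by simp
      show "eventually (\<lambda>N. \<forall>z\<in>grid N. z \<in> ball y (min \<delta> \<delta>') \<longrightarrow> clamped_sup z - \<epsilon> \<le> uh N z) sequentially"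
        using \<delta>(2)
      proof eventually_elim
        case (elim N)
        show ?case
        proof (intro ballI impI)
          fix z assume z: "z \<in> grid N" "z \<in> ball y (min \<delta> \<delta>')"
          then have "dist z y < \<delta>" "dist z y < \<delta>'" by (auto simp: dist_commute)
          moreover from this(1) have "a - \<epsilon> / 3 \<le> uh N z" using elim z(1) by (simp add: y12)
          moreover have "\<bar>clamped_sup z - clamped_sup y\<bar> < \<epsilon> / 3"
            using \<delta>'(2)[OF \<open>dist z y < \<delta>'\<close>] by (simp add: dist_real_def)
          ultimately show "clamped_sup z - \<epsilon> \<le> uh N z" using a(2) by linarith
        qed
      qed
    qed
  qed
  then have "\<forall>y\<in>unit_square. \<exists>r. r > 0 \<and>
    eventually (\<lambda>N. \<forall>z\<in>grid N. z \<in> ball y r \<longrightarrow> clamped_sup z - \<epsilon> \<le> uh N z) sequentially" ..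
  from bchoice[OF this] obtain r where r: "\<forall>y\<in>unit_square. r y > 0 \<and>
    eventually (\<lambda>N. \<forall>z\<in>grid N. z \<in> ball y (r y) \<longrightarrow> clamped_sup z - \<epsilon> \<le> uh N z) sequentially" ..
  have "unit_square \<subseteq> (\<Union>y\<in>unit_square. ball y (r y))" using r by force
  then obtain C where C: "C \<subseteq> unit_square" "finite C" "unit_square \<subseteq> (\<Union>y\<in>C. ball y (r y))"
    using compactE_image[OF compact_unit_square, of unit_square "\<lambda>y. ball y (r y)"] by auto
  have "eventually (\<lambda>N. \<forall>y\<in>C. \<forall>z\<in>grid N. z \<in> ball y (r y) \<longrightarrow> clamped_sup z - \<epsilon> \<le> uh N z) sequentially"
    using C(1,2) r by (intro eventually_ball_finite) auto
  then show ?thesis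
  proof eventually_elim
    case (elim N)
    then show ?case using C(3) grid_subset_unit_square[of N] by blast
  qed
qed

text \<open>Controls have coordinate sum at least \<open>a0\<close>, so the proportional slack of
  the polynomial supersolution becomes the constant slack \<open>\<eta> * a0\<close>.\<close>

lemma uh_eventually_le:
  assumes \<epsilon>: "\<epsilon> > 0"
  shows "eventually (\<lambda>N. \<forall>z\<in>grid N. uh N z \<le> clamped_sup z + \<epsilon>) sequentially"
proof -
  obtain p p' \<eta> where p: "real_polynomial_function p" "\<forall>x. (p has_derivative p' x) (at x)" "\<eta> > 0"
    "\<forall>x\<in>unit_square. \<forall>v. 0 \<le> fst v \<longrightarrow> 0 \<le> snd v \<longrightarrow>
      F x * sqrt (fst v * snd v) + \<eta> * (fst v + snd v) \<le> p' x v"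
    "\<forall>x\<in>unit_square. 0 \<le> p x \<and> p x \<le> chain_sup (fst x) (snd x) + \<epsilon>"
    using polynomial_supersolution[OF F_cont \<epsilon>] by blast
  obtain a0 where a0: "a0 > 0" "\<And>\<alpha>. \<alpha> \<in> A \<Longrightarrow> a0 \<le> fst \<alpha> + snd \<alpha>" using A_sum_ge by blast
  have "eventually (\<lambda>N. \<forall>x\<in>grid N. 0 \<le> uh N x \<and> uh N x \<le> p x) sequentially"
  proof (rule uh_upper_bound[OF p(1)])
    show "(p has_derivative p' x) (at x)" for x using p(2) by blast
    show "0 < \<eta> * a0" using p(3) a0 by simp
    fix x \<alpha> :: "real \<times> real" assume x: "x \<in> unit_square" and \<alpha>: "\<alpha> \<in> A"
    have "F x * sqrt (fst \<alpha> * snd \<alpha>) + \<eta> * (fst \<alpha> + snd \<alpha>) \<le> p' x \<alpha>"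
      using p(4) x A_nonneg[OF \<alpha>] by blast
    moreover have "\<eta> * a0 \<le> \<eta> * (fst \<alpha> + snd \<alpha>)" using p(3) a0(2)[OF \<alpha>] by simp
    ultimately show "f x * sqrt (fst \<alpha> * snd \<alpha>) + \<eta> * a0 \<le> p' x \<alpha>" by (simp add: F_eq[OF x])
  next
    show "0 \<le> p x" if "x \<in> unit_square" for x using p(5) that by blast
  qed
  then show ?thesis
  proof eventually_elim
    case (elim N)
    show ?case
    proof
      fix z assume z: "z \<in> grid N"
      then have "z \<in> unit_square" using grid_subset_unit_square by blast
      then show "uh N z \<le> clamped_sup z + \<epsilon>" using p(5) clamped_sup_eq[of z] elim z by force
    qed
  qed
qed

text \<open>Polynomial supersolutions arbitrarily close to \<open>clamped_sup\<close> dominate all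
  energies, which also supplies the boundedness that gives the supremum a meaning; conversely,
  admissible paths realise chains.\<close>

lemma value_function_eq:
  assumes y: "y \<in> unit_square"
  shows "value_function f y = clamped_sup y"
proof -
  obtain y1 y2 where y12: "y = (y1, y2)" by fastforce
  have y': "0 \<le> y1" "0 \<le> y2" using y by (auto simp: y12 unit_square_def)
  have energy_le: "energy f \<phi> \<le> clamped_sup y" if \<phi>: "\<phi> \<in> admissible y" for \<phi>
  proof (rule field_le_epsilon)
    fix \<epsilon> :: real assume "\<epsilon> > 0"
    obtain p p' \<eta> where p: "real_polynomial_function p" "\<forall>x. (p has_derivative p' x) (at x)" "\<eta> > 0"
      "\<forall>x\<in>unit_square. \<forall>v. 0 \<le> fst v \<longrightarrow> 0 \<le> snd v \<longrightarrow>
        F x * sqrt (fst v * snd v) + \<eta> * (fst v + snd v) \<le> p' x v"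
      "\<forall>x\<in>unit_square. 0 \<le> p x \<and> p x \<le> chain_sup (fst x) (snd x) + \<epsilon>"
      using polynomial_supersolution[OF F_cont \<open>\<epsilon> > 0\<close>] by blast
    have "energy f \<phi> \<le> p y"
    proof (rule energy_le_supersolution[OF \<phi> y p(1)])
      show "(p has_derivative p' x) (at x)" for x using p(2) by blast
      fix z v :: "real \<times> real" assume z: "z \<in> unit_square" and v: "0 \<le> fst v" "0 \<le> snd v"
      have "F z * sqrt (fst v * snd v) + \<eta> * (fst v + snd v) \<le> p' z v"
        using p(4) z v by blast
      moreover have "0 \<le> \<eta> * (fst v + snd v)" using p(3) v by simp
      ultimately show "f z * sqrt (fst v * snd v) \<le> p' z v" by (simp add: F_eq[OF z])
    next
      show "0 \<le> p x" if "x \<in> unit_square" for x using p(5) that by blast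
    qed
    also have "\<dots> \<le> clamped_sup y + \<epsilon>" using p(5) y clamped_sup_eq[OF y] by simp
    finally show "energy f \<phi> \<le> clamped_sup y + \<epsilon>" .
  qed
  have path: "\<exists>\<phi>\<in>admissible y. a \<le> energy f \<phi>" if "chain_value F y1 y2 a" for a
    using chain_value_admissible_path[OF F_cont F_nonneg F_eq] y that by (simp add: y12)
  have bdd: "bdd_above (energy f ` admissible y)"
    using energy_le by (intro bdd_aboveI2)
  show ?thesis
  proof (rule antisym)
    have "admissible y \<noteq> {}" using path[OF chain_value_zero[OF y']] by blast
    then show "value_function f y \<le> clamped_sup y"
      unfolding value_function_def by (rule cSUP_least) (rule energy_le)
    have "chain_sup y1 y2 \<le> value_function f y"
    proof (rule chain_sup_least[OF y'])
      fix a assume "chain_value F y1 y2 a"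
      then obtain \<phi> where "\<phi> \<in> admissible y" "a \<le> energy f \<phi>" using path by blast
      moreover have "energy f \<phi> \<le> value_function f y"
        unfolding value_function_def by (rule cSUP_upper[OF \<open>\<phi> \<in> admissible y\<close> bdd])
      ultimately show "a \<le> value_function f y" by simp
    qed
    then show "clamped_sup y \<le> value_function f y" using clamped_sup_eq[OF y] by (simp add: y12)
  qed
qed

lemma max_error_tendsto_zero:
  "(\<lambda>N. Max ((\<lambda>x. \<bar>uh N x - value_function f x\<bar>) ` grid N)) \<longlonglongrightarrow> 0"
proof (rule tendstoI)
  fix \<epsilon> :: real assume "\<epsilon> > 0"
  then have \<epsilon>2: "\<epsilon> / 2 > 0" by simp
  show "eventually (\<lambda>N. dist (Max ((\<lambda>x. \<bar>uh N x - value_function f x\<bar>) ` grid N)) 0 < \<epsilon>) sequentially"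
    using uh_eventually_ge[OF \<epsilon>2] uh_eventually_le[OF \<epsilon>2]
  proof eventually_elim
    case (elim N)
    let ?E = "(\<lambda>x. \<bar>uh N x - value_function f x\<bar>) ` grid N"
    have E: "finite ?E" "?E \<noteq> {}" using finite_grid grid_nonempty by auto
    have "\<bar>uh N z - value_function f z\<bar> < \<epsilon>" if z: "z \<in> grid N" for z
    proof -
      have "z \<in> unit_square" using z grid_subset_unit_square by blast
      then have "value_function f z = clamped_sup z" by (rule value_function_eq)
      moreover have "clamped_sup z - \<epsilon> / 2 \<le> uh N z" "uh N z \<le> clamped_sup z + \<epsilon> / 2"
        using elim z by blast+
      ultimately show ?thesis using \<open>\<epsilon> > 0\<close> by linarith
    qed
    then have "Max ?E < \<epsilon>" using E by auto
    moreover have "0 \<le> Max ?E" using E by (auto simp: Max_ge_iff)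
    ultimately show ?case by (simp add: dist_real_def)
  qed
qed

end

theorem theorem3:
  fixes f :: "real \<times> real \<Rightarrow> real"
    and A :: "(real \<times> real) set"
    and g :: approximation
    and u\<^sub>h :: "nat \<Rightarrow> real \<times> real \<Rightarrow> real"
  assumes "continuous_on unit_square f"
    and "\<forall>x\<in>unit_square. f x \<ge> 0"
    and "cond_A1 A" and "cond_A2 A"
    and "cond_G1 A g" and "cond_G2 A g" and "cond_G3 A g" and "cond_G4 A g"
    and "\<forall>N\<ge>1. unique_scheme_solution f A g N (u\<^sub>h N)"
  shows "(\<lambda>N. Max ((\<lambda>x. \<bar>u\<^sub>h N x - value_function f x\<bar>) ` grid N)) \<longlonglongrightarrow> 0"
proof -
  interpret limit: scheme_limit f A g u\<^sub>h
    by unfold_locales (use assms in auto)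
  \<comment> \<open>Composition with the projection onto the square extends \<open>f\<close>
    continuously to the plane with the same sign and bound.\<close>
  define c :: "real \<times> real \<Rightarrow> real \<times> real"
    where "c z = (max 0 (min 1 (fst z)), max 0 (min 1 (snd z)))" for z
  have c_sq: "c z \<in> unit_square" for z by (simp add: c_def unit_square_def)
  have c_id: "c z = z" if "z \<in> unit_square" for z
    using that by (cases z) (simp add: c_def unit_square_def)
  have c_cont: "continuous_on UNIV c"
    unfolding c_def[abs_def] by (intro continuous_intros)
  obtain M where M: "\<forall>x\<in>unit_square. f x \<le> M" using limit.f_bounded by blast
  interpret ext: scheme_extension f A g u\<^sub>h "\<lambda>z. f (c z)" M
  proof unfold_locales
    show "continuous_on UNIV (\<lambda>z. f (c z))"
      by (rule continuous_on_compose2[OF assms(1) c_cont]) (use c_sq in auto)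
  qed (use c_sq c_id M assms(2) in auto)
  show ?thesis by (rule ext.max_error_tendsto_zero)
qed

end
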